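(* Let $\alpha>0$, let $(a_n)_{n\in\mathbb N}$ be an $\alpha$-almost uncorrelated triangular scheme, let $b=(b_n)_n$ be a sequence of $n$-bandwidths with $b_n\to\infty$ as $n\to\infty$, and let $(X_n)_n$ be the periodic random band matrices which are based on $(a_n)_n$ with bandwidth $b$. Then: 1. If $\alpha\ge \frac12$, then the semicircle law holds for $(X_n)_n$ in probability. 2. If $\alpha\ge\frac12$, $\frac{1}{b_n^3}$ is summable over $n$, and all entries of $(a_n)_n$ are $\{-1,1\}$-valued, then the semicircle law holds almost surely for $(X_n)_n$. 3. If $(a_n)_n$ is even strongly $\alpha$-almost uncorrelated with $\alpha>\frac12$, and the sequences $\frac{1}{b_n^2}$, $\frac{1}{b_n}D^{(l)}_n$ and $C^{(l)}_n$ are summable over $n$ for all $l\in\mathbb N$ (where $C_n^{(l)}$, $D_n^{(l)}$ are the constants in the definition of strongly $\alpha$-almost uncorrelated), then the semicircle law holds almost surely for $(X_n)_n$. 4. If $(a_n)_n$ is a Wigner scheme and $\big(\frac{1}{n b_n}\big)_n$ is summable, then the semicircle law holds almost surely for $(X_n)_n$.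
   Context: $\mathbb N=\{1,2,\dots\}$, $[n]=\{1,\dots,n\}$, $\square_n=[n]\times[n]$. $(\Omega,\mathcal A,\mathbb P)$ is a probability space with expectation $\mathbb E$ and variance $\mathbb V$. A triangular scheme is a sequence $(a_n)_{n\in\mathbb N}$ where each $a_n=(a_n(p,q))_{(p,q)\in\square_n}$ is a symmetric $n\times n$ matrix of real-valued random variables, all defined on $(\Omega,\mathcal A,\mathbb P)$. Pairs $(a,b),(c,d)\in\mathbb N^2$ are fundamentally different if $\{a,b\}\ne\{c,d\}$; several pairs are called fundamentally different if they are pairwise so. Let $\alpha>0$. A triangular scheme $(a_n)_n$ is $\alpha$-almost uncorrelated if (all moments of the entries exist and) there are sequences of constants $(C_k)_k$, $(C^{(m)}_n)_{n,m}$, $(D^{(m)}_n)_{n,m}$ with $\lim_{n\to\infty}C^{(m)}_n=0$ and $\lim_{n\to\infty}D^{(m)}_n=0$ for each $m\in\mathbb N$, such that for all $N,l\in\mathbb N$ and all fundamentally different pairs $(p_1,q_1),\dots,(p_l,q_l)\in\square_N$: (AAU1) for all $\delta_1,\dots,\delta_l\in\mathbb N$ and all $n\ge N$: $|\mathbb E\, a_n(p_1,q_1)^{\delta_1}\cdots a_n(p_l,q_l)^{\delta_l}|\le C_{\delta_1+\dots+\delta_l}\, n^{-\alpha\cdot\#\{i\in\{1,\dots,l\}:\delta_i=1\}}$; (AAU2) for all $n\ge N$: $|\mathbb E\, a_n(p_1,q_1)^2\cdots a_n(p_l,q_l)^2-1|\le C^{(l)}_n$. It is strongly $\alpha$-almost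 uncorrelated if additionally (AAU3) for all $n\ge N$: $|\mathbb E\, a_n(p_1,q_1)^4\,(a_n(p_2,q_2)^2\cdots a_n(p_l,q_l)^2-1)|\le D^{(l)}_n$ (an empty product equals $1$). A Wigner scheme is a triangular scheme $(a_n)_n$ such that: for every $n$ the family $(a_n(i,j))_{1\le i\le j\le n}$ is independent; $\mathbb E a_n(i,j)=0$ and $\mathbb V a_n(i,j)=1$ for all $n$ and $(i,j)\in\square_n$; and for every $p\in\mathbb N$ there is $C'_p>0$ with $\sup_{n}\sup_{(i,j)\in\square_n}\mathbb E|a_n(i,j)|^p\le C'_p$. For $n\in\mathbb N$, an ($n$-)bandwidth is a number $b_n\in\{b\in\mathbb N: b<n,\ b\text{ odd}\}\cup\{n\}$. If $b_n=n$, all index pairs $(i,j)\in\square_n$ are $b_n$-relevant; if $b_n<n$, the pair $(i,j)$ is $b_n$-relevant iff $|i-j|\le\frac{b_n-1}{2}$ or $|i-j|\ge n-\frac{b_n-1}{2}$. The periodic random band matrices based on $(a_n)_n$ with bandwidth $b=(b_n)_n$ are the $n\times n$ matrices $X_n$ with $X_n(i,j)=b_n^{-1/2}a_n(i,j)$ if $(i,j)$ is $b_n$-relevant and $X_n(i,j)=0$ otherwise. The empirical spectral distribution of $X_n$ is $\sigma_n=\frac1n\sum_{i=1}^n\delta_{\lambda_i}$, with $\lambda_1\le\dots\le\lambda_n$ the eigenvalues of $X_n$. The semicircle distribution $\sigma$ has Lebesgue density $\frac1{2\pi}\sqrt{4-x^2}\,\mathbf 1_{[-2,2]}(x)$. The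 semicircle law holds for $(X_n)_n$ in probability (resp. almost surely) if for every bounded continuous $f:\mathbb R\to\mathbb R$ one has $\int f\,d\sigma_n\to\int f\,d\sigma$ in probability (resp. almost surely) as $n\to\infty$. *)

theory Defs
  imports
    "HOL-Probability.Probability"
    "Jordan_Normal_Form.Char_Poly"
begin

(* Schemes, bandwidths and matrices are indexed by the positive integers. They are represented
   by functions on nat whose value at index 0 is never constrained and never matters. Matrix
   positions (p, q) run through {1..n} x {1..n}. *)

definition triangular_scheme :: "'w measure \<Rightarrow> (nat \<Rightarrow> nat \<Rightarrow> nat \<Rightarrow> 'w \<Rightarrow> real) \<Rightarrow> bool" where
  "triangular_scheme M a \<longleftrightarrow>
    (\<forall>n\<ge>1. \<forall>p\<in>{1..n}. \<forall>q\<in>{1..n}.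
      a n p q \<in> borel_measurable M \<and> (\<forall>\<omega>\<in>space M. a n p q \<omega> = a n q p \<omega>))"

definition all_moments_exist :: "'w measure \<Rightarrow> (nat \<Rightarrow> nat \<Rightarrow> nat \<Rightarrow> 'w \<Rightarrow> real) \<Rightarrow> bool" where
  "all_moments_exist M a \<longleftrightarrow>
    (\<forall>n\<ge>1. \<forall>p\<in>{1..n}. \<forall>q\<in>{1..n}. \<forall>k::nat. integrable M (\<lambda>\<omega>. a n p q \<omega> ^ k))"

(* l pairwise fundamentally different pairs (p 1, q 1), ..., (p l, q l) with entries in {1..N}. *)
definition fund_diff_pairs :: "nat \<Rightarrow> nat \<Rightarrow> (nat \<Rightarrow> nat) \<Rightarrow> (nat \<Rightarrow> nat) \<Rightarrow> bool" where
  "fund_diff_pairs N l p q \<longleftrightarrow>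
    (\<forall>i\<in>{1..l}. p i \<in> {1..N} \<and> q i \<in> {1..N}) \<and>
    (\<forall>i\<in>{1..l}. \<forall>j\<in>{1..l}. i \<noteq> j \<longrightarrow> {p i, q i} \<noteq> {p j, q j})"

definition AAU1 ::
  "'w measure \<Rightarrow> real \<Rightarrow> (nat \<Rightarrow> nat \<Rightarrow> nat \<Rightarrow> 'w \<Rightarrow> real) \<Rightarrow> (nat \<Rightarrow> real) \<Rightarrow> bool" where
  "AAU1 M \<alpha> a C \<longleftrightarrow>
    (\<forall>N\<ge>1. \<forall>l\<ge>1. \<forall>p q. fund_diff_pairs N l p q \<longrightarrow>
      (\<forall>\<delta>::nat \<Rightarrow> nat. (\<forall>i\<in>{1..l}. \<delta> i \<ge> 1) \<longrightarrow> (\<forall>n\<ge>N.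
        \<bar>\<integral>\<omega>. (\<Prod>i=1..l. a n (p i) (q i) \<omega> ^ \<delta> i) \<partial>M\<bar>
          \<le> C (\<Sum>i=1..l. \<delta> i) * real n powr (- \<alpha> * real (card {i \<in> {1..l}. \<delta> i = 1})))))"

(* In AAU2 and AAU3 the constants with superscript (m) and subscript n are written CC m n, D m n. *)
definition AAU2 ::
  "'w measure \<Rightarrow> (nat \<Rightarrow> nat \<Rightarrow> nat \<Rightarrow> 'w \<Rightarrow> real) \<Rightarrow> (nat \<Rightarrow> nat \<Rightarrow> real) \<Rightarrow> bool" where
  "AAU2 M a CC \<longleftrightarrow>
    (\<forall>N\<ge>1. \<forall>l\<ge>1. \<forall>p q. fund_diff_pairs N l p q \<longrightarrow> (\<forall>n\<ge>N.
      \<bar>(\<integral>\<omega>. (\<Prod>i=1..l. a n (p i) (q i) \<omega> ^ 2) \<partial>M) - 1\<bar> \<le> CC l n))"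

definition AAU3 ::
  "'w measure \<Rightarrow> (nat \<Rightarrow> nat \<Rightarrow> nat \<Rightarrow> 'w \<Rightarrow> real) \<Rightarrow> (nat \<Rightarrow> nat \<Rightarrow> real) \<Rightarrow> bool" where
  "AAU3 M a D \<longleftrightarrow>
    (\<forall>N\<ge>1. \<forall>l\<ge>1. \<forall>p q. fund_diff_pairs N l p q \<longrightarrow> (\<forall>n\<ge>N.
      \<bar>\<integral>\<omega>. a n (p 1) (q 1) \<omega> ^ 4 * ((\<Prod>i=2..l. a n (p i) (q i) \<omega> ^ 2) - 1) \<partial>M\<bar> \<le> D l n))"

definition almost_uncorrelated_with ::
  "'w measure \<Rightarrow> real \<Rightarrow> (nat \<Rightarrow> nat \<Rightarrow> nat \<Rightarrow> 'w \<Rightarrow> real) \<Rightarrow>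
    (nat \<Rightarrow> real) \<Rightarrow> (nat \<Rightarrow> nat \<Rightarrow> real) \<Rightarrow> bool" where
  "almost_uncorrelated_with M \<alpha> a C CC \<longleftrightarrow>
    triangular_scheme M a \<and> all_moments_exist M a \<and>
    (\<forall>m\<ge>1. CC m \<longlonglongrightarrow> 0) \<and> AAU1 M \<alpha> a C \<and> AAU2 M a CC"

definition almost_uncorrelated ::
  "'w measure \<Rightarrow> real \<Rightarrow> (nat \<Rightarrow> nat \<Rightarrow> nat \<Rightarrow> 'w \<Rightarrow> real) \<Rightarrow> bool" where
  "almost_uncorrelated M \<alpha> a \<longleftrightarrow> (\<exists>C CC. almost_uncorrelated_with M \<alpha> a C CC)"

(* The scheme is strongly alpha-almost uncorrelated iff this holds for some C, CC, D. *)
definition strongly_almost_uncorrelated_with ::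
  "'w measure \<Rightarrow> real \<Rightarrow> (nat \<Rightarrow> nat \<Rightarrow> nat \<Rightarrow> 'w \<Rightarrow> real) \<Rightarrow>
    (nat \<Rightarrow> real) \<Rightarrow> (nat \<Rightarrow> nat \<Rightarrow> real) \<Rightarrow> (nat \<Rightarrow> nat \<Rightarrow> real) \<Rightarrow> bool" where
  "strongly_almost_uncorrelated_with M \<alpha> a C CC D \<longleftrightarrow>
    almost_uncorrelated_with M \<alpha> a C CC \<and> (\<forall>m\<ge>1. D m \<longlonglongrightarrow> 0) \<and> AAU3 M a D"

definition wigner_scheme :: "'w measure \<Rightarrow> (nat \<Rightarrow> nat \<Rightarrow> nat \<Rightarrow> 'w \<Rightarrow> real) \<Rightarrow> bool" where
  "wigner_scheme M a \<longleftrightarrow>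
    triangular_scheme M a \<and>
    (\<forall>n\<ge>1. prob_space.indep_vars M (\<lambda>_. borel) (\<lambda>(i, j). a n i j)
              {(i, j). 1 \<le> i \<and> i \<le> j \<and> j \<le> n}) \<and>
    (\<forall>n\<ge>1. \<forall>i\<in>{1..n}. \<forall>j\<in>{1..n}.
      prob_space.expectation M (a n i j) = 0 \<and> prob_space.variance M (a n i j) = 1) \<and>
    (\<forall>p::nat. p \<ge> 1 \<longrightarrow> (\<exists>C'>0. \<forall>n\<ge>1. \<forall>i\<in>{1..n}. \<forall>j\<in>{1..n}.
      integrable M (\<lambda>\<omega>. \<bar>a n i j \<omega>\<bar> ^ p) \<and> prob_space.expectation M (\<lambda>\<omega>. \<bar>a n i j \<omega>\<bar> ^ p) \<le> C'))"

definition bandwidth :: "nat \<Rightarrow> nat \<Rightarrow> bool" where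
  "bandwidth n b \<longleftrightarrow> (1 \<le> b \<and> b < n \<and> odd b) \<or> b = n"

definition relevant :: "nat \<Rightarrow> nat \<Rightarrow> nat \<Rightarrow> nat \<Rightarrow> bool" where
  "relevant n b i j \<longleftrightarrow> b = n \<or>
    \<bar>real i - real j\<bar> \<le> (real b - 1) / 2 \<or> \<bar>real i - real j\<bar> \<ge> real n - (real b - 1) / 2"

(* Matrices of the imported library are indexed from 0, hence the shift by one. *)
definition band_matrix ::
  "(nat \<Rightarrow> nat \<Rightarrow> nat \<Rightarrow> 'w \<Rightarrow> real) \<Rightarrow> (nat \<Rightarrow> nat) \<Rightarrow> nat \<Rightarrow> 'w \<Rightarrow> real mat" where
  "band_matrix a b n \<omega> = Matrix.mat n n (\<lambda>(i, j).
     if relevant n (b n) (i + 1) (j + 1)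
     then real (b n) powr (- 1 / 2) * a n (i + 1) (j + 1) \<omega> else 0)"

(* The real eigenvalues in increasing order, repeated according to algebraic multiplicity; for a
   symmetric n x n matrix this list has length n. *)
definition eigenvalue_list :: "real mat \<Rightarrow> real list" where
  "eigenvalue_list A = sorted_list_of_multiset (proots (char_poly A))"

(* The measure (1/n) * sum of the Dirac measures at the n eigenvalues of a symmetric n x n matrix,
   as the law of an eigenvalue with uniformly chosen index; see measure_esd. *)
definition esd :: "real mat \<Rightarrow> real measure" where
  "esd A = distr (uniform_count_measure {..<dim_row A}) borel (\<lambda>i. eigenvalue_list A ! i)"

lemma measure_esd:
  assumes "B \<in> sets borel"
  shows "measure (esd A) B = (\<Sum>i<dim_row A. indicator B (eigenvalue_list A ! i)) / real (dim_row A)"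
proof -
  let ?f = "\<lambda>i. eigenvalue_list A ! i"
  have "measure (esd A) B =
      measure (uniform_count_measure {..<dim_row A}) (?f -` B \<inter> {..<dim_row A})"
    unfolding esd_def using assms
    by (subst measure_distr) (auto simp: measurable_def space_uniform_count_measure
        sets_uniform_count_measure)
  also have "\<dots> = real (card (?f -` B \<inter> {..<dim_row A})) / real (dim_row A)"
    by (subst measure_uniform_count_measure) auto
  also have "real (card (?f -` B \<inter> {..<dim_row A})) = (\<Sum>i<dim_row A. indicator B (?f i))"
    by (subst sum.cong[OF refl, of _ _ "indicator (?f -` B)"])
       (auto simp: indicator_def sum.If_cases Int_commute vimage_def)
  finally show ?thesis .
qed

definition semicircle :: "real measure" where
  "semicircle = density lborel
     (\<lambda>x. ennreal (1 / (2 * pi) * sqrt (4 - x\<^sup>2) * indicator {-2..2} x))"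

(* The library has no convergence in probability. Measurability is part of the notion, because
   measure is 0 on non-measurable sets. *)
definition tendsto_in_prob :: "'w measure \<Rightarrow> (nat \<Rightarrow> 'w \<Rightarrow> real) \<Rightarrow> real \<Rightarrow> bool" where
  "tendsto_in_prob M Y c \<longleftrightarrow>
    (\<forall>n. Y n \<in> borel_measurable M) \<and>
    (\<forall>\<epsilon>>0. (\<lambda>n. measure M {\<omega> \<in> space M. \<bar>Y n \<omega> - c\<bar> > \<epsilon>}) \<longlonglongrightarrow> 0)"

definition semicircle_law_in_prob :: "'w measure \<Rightarrow> (nat \<Rightarrow> 'w \<Rightarrow> real mat) \<Rightarrow> bool" where
  "semicircle_law_in_prob M X \<longleftrightarrow>
    (\<forall>f::real \<Rightarrow> real. continuous_on UNIV f \<and> bounded (range f) \<longrightarrow>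
      tendsto_in_prob M (\<lambda>n \<omega>. \<integral>x. f x \<partial>esd (X n \<omega>)) (\<integral>x. f x \<partial>semicircle))"

definition semicircle_law_almost_surely :: "'w measure \<Rightarrow> (nat \<Rightarrow> 'w \<Rightarrow> real mat) \<Rightarrow> bool" where
  "semicircle_law_almost_surely M X \<longleftrightarrow>
    (\<forall>f::real \<Rightarrow> real. continuous_on UNIV f \<and> bounded (range f) \<longrightarrow>
      (AE \<omega> in M. (\<lambda>n. \<integral>x. f x \<partial>esd (X n \<omega>)) \<longlonglongrightarrow> (\<integral>x. f x \<partial>semicircle)))"

end

theory Submission
  imports Defs "Jordan_Normal_Form.Schur_Decomposition"
begin

text \<open>
  The method of moments. The \<open>k\<close>-th moment of the empirical spectral distribution is a normalised sum
  over closed walks of length \<open>k\<close> in the relevance graph, in which every vertex has \<open>b\<^sub>n\<close> neighbours.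
  The walks that traverse each edge of a tree exactly twice are counted by Dyck paths and yield the
  moments of the semicircle distribution. Any \<open>z\<close>-tuple of other closed walks with \<open>v\<close> vertices and \<open>s\<close>
  edges of multiplicity one satisfies \<open>2 v \<le> z k + s\<close>, because an edge of odd multiplicity in a closed
  walk lies on a cycle. Since each single edge contributes a factor \<open>1 / \<surd>n\<close> and the walks, weighted by
  \<open>b\<^sub>n\<close> to the power \<open>- v\<close>, have total mass of order \<open>(n / b\<^sub>n)\<^sup>z\<close>, the \<open>z\<close>-th moment of their contribution
  is \<open>O((1 / b\<^sub>n)\<^sup>z)\<close>. The choices \<open>z = 2\<close> and \<open>z = 4\<close> give the first three parts: the double trees have a
  second moment controlled by AAU2, and are deterministic for signs. For Wigner schemes only
  pairs of walks with a common edge contribute to the variance, which is \<open>O(1 / (n b\<^sub>n))\<close>.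
\<close>

text \<open>A walk that doubles a tree has one vertex more than edges, \<open>2 v = k + 2\<close>,
  and the bound requires every other closed walk to lose this surplus. An odd multiplicity causes
  the loss through a cycle. If all multiplicities are even and the surplus persists, some edge is
  used at least four times, since otherwise every edge is used exactly twice and the walk doubles a
  tree; the two excess traversals then pay for the vertex. A single edge leaves half a vertex
  unpaid, which is why the decay \<open>n^(-1/2)\<close> per single edge is enough: with
  \<open>b \<le> n\<close> it is at most \<open>b^(-1/2)\<close>. In a tuple, a walk that meets
  earlier ones brings no more new vertices than new edges, so the surplus only has to be excluded
  for walks disjoint from the earlier ones. Walks are not classified by shape. In the sum of
  \<open>b^(-v)\<close> a step costs a bounded factor whether it reaches a new or an old vertex, and
  only the free choice of a start costs \<open>n / b\<close>. This separates the two rates: two free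
  starts give \<open>1 / b^2\<close> for dependent entries, whereas pairs known to meet have one
  free start and give \<open>1 / (n b)\<close>.\<close>

section \<open>Closed walks and their edge multiplicities\<close>

text \<open>An edge is the set of its endpoints, so that a loop is a singleton.\<close>
fun edges :: "'v list \<Rightarrow> 'v set list" where
  "edges (x # y # r) = {x, y} # edges (y # r)"
| "edges _ = []"

lemma length_edges [simp]: "length (edges xs) = length xs - 1"
  by (induction xs rule: edges.induct) auto

lemma edges_subset: "e \<in> set (edges xs) \<Longrightarrow> e \<subseteq> set xs"
  by (induction xs rule: edges.induct) auto

lemma edges_append: "edges (us @ s # ws) = edges (us @ [s]) @ edges (s # ws)"
proof (induction us)
  case (Cons u us)
  then show ?case by (cases us) auto
qed (cases ws; simp)

lemma edges_rev: "edges (rev xs) = rev (edges xs)"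
proof (induction xs rule: edges.induct)
  case (1 x y r)
  have "edges (rev (x # y # r)) = edges (rev r @ y # [x])" by simp
  also have "\<dots> = edges (rev r @ [y]) @ edges [y, x]" by (rule edges_append)
  finally show ?case using 1 by (simp add: insert_commute)
qed auto

text \<open>Each new vertex is entered along an edge that contains it, and this edge is not in
  \<open>F\<close> because members of \<open>F\<close> lie inside \<open>S\<close>. Keeping
  \<open>S\<close> and \<open>F\<close> arbitrary lets one count serve for a single walk and for a
  walk glued to an explored graph.\<close>

lemma card_walk_from:
  assumes "finite S" "hd xs \<in> S" "xs \<noteq> []" "\<And>e. e \<in> F \<Longrightarrow> e \<subseteq> S"
  shows "card (S \<union> set xs) \<le> card S + card (set (edges xs) - F)"
  using assms
proof (induction xs arbitrary: S F rule: edges.induct)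
  case (1 x y r)
  show ?case
  proof (cases "y \<in> S")
    case True
    have "card (S \<union> set (y # r)) \<le> card S + card (set (edges (y # r)) - F)"
      using 1 True by auto
    moreover have "S \<union> set (x # y # r) = S \<union> set (y # r)" using 1 by auto
    moreover have "card (set (edges (y # r)) - F) \<le> card (set (edges (x # y # r)) - F)"
      by (rule card_mono) auto
    ultimately show ?thesis by simp
  next
    case False
    let ?F = "insert {x, y} F"
    have notF: "{x, y} \<notin> F" using False 1(5) by blast
    have "card (insert y S \<union> set (y # r)) \<le> card (insert y S) + card (set (edges (y # r)) - ?F)"
      using 1 by (intro 1(1)) auto
    moreover have "S \<union> set (x # y # r) = insert y S \<union> set (y # r)" using 1 by auto
    moreover have "set (edges (x # y # r)) - F = insert {x, y} (set (edges (y # r)) - ?F)"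
      using notF by auto
    ultimately show ?thesis using False 1(2) by simp
  qed
qed (auto simp: insert_absorb)

text \<open>The meeting point may lie in the middle, so the walk is cut there: the second half
  starts in \<open>S\<close>, and the first half, traversed backwards, starts in the set enlarged by
  the second half.\<close>

lemma card_walk_meeting:
  assumes "finite S" "set xs \<inter> S \<noteq> {}" "\<And>e. e \<in> F \<Longrightarrow> e \<subseteq> S"
  shows "card (S \<union> set xs) \<le> card S + card (set (edges xs) - F)"
proof -
  obtain s where s: "s \<in> set xs" "s \<in> S" using assms by blast
  obtain us ws where xs: "xs = us @ s # ws" using split_list[OF s(1)] by blast
  let ?S = "S \<union> set (s # ws)" and ?F = "F \<union> set (edges (s # ws))"
  have 1: "card ?S \<le> card S + card (set (edges (s # ws)) - F)"
    using assms s by (intro card_walk_from) auto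
  have 2: "card (?S \<union> set (rev (us @ [s]))) \<le> card ?S + card (set (edges (rev (us @ [s]))) - ?F)"
  proof (rule card_walk_from)
    show "e \<subseteq> ?S" if "e \<in> ?F" for e
      using that assms(3) edges_subset[of e "s # ws"] by blast
  qed (use assms(1) in auto)
  have 3: "set (edges xs) - F = (set (edges (s # ws)) - F) \<union> (set (edges (us @ [s])) - ?F)"
    by (auto simp: xs edges_append[of us s ws])
  have "card (set (edges xs) - F)
      = card (set (edges (s # ws)) - F) + card (set (edges (us @ [s])) - ?F)"
    unfolding 3 by (rule card_Un_disjoint) auto
  moreover have "S \<union> set xs = ?S \<union> set (rev (us @ [s]))" by (auto simp: xs)
  moreover have "set (edges (rev (us @ [s]))) = set (edges (us @ [s]))"
    by (simp only: edges_rev set_rev)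
  ultimately show ?thesis using 1 2 by simp
qed

corollary card_walk: "xs \<noteq> [] \<Longrightarrow> card (set xs) \<le> Suc (card (set (edges xs)))"
  using card_walk_from[of "{hd xs}" xs "{}"] by (simp add: insert_absorb)

text \<open>A step changes membership in \<open>S\<close> exactly when its edge crosses the boundary
  of \<open>S\<close>, so the parity of the crossings depends only on the two ends. A loop is a
  singleton and never crosses.\<close>

lemma odd_crossings:
  "xs \<noteq> [] \<Longrightarrow> odd (length (filter (\<lambda>e. e \<inter> S \<noteq> {} \<and> \<not> e \<subseteq> S) (edges xs)))
     \<longleftrightarrow> (hd xs \<in> S) \<noteq> (last xs \<in> S)"
  by (induction xs rule: edges.induct) auto

lemma edge_in_edges: "e \<in> set (edges xs) \<Longrightarrow> \<exists>x y. x \<in> set xs \<and> y \<in> set xs \<and> e = {x, y}"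
  by (induction xs rule: edges.induct) auto

lemma edges_no_crossing:
  assumes "\<And>f. f \<in> set (edges xs) \<Longrightarrow> f \<inter> S \<noteq> {} \<Longrightarrow> f \<subseteq> S" "set xs \<inter> S \<noteq> {}"
  shows "set xs \<subseteq> S"
  using assms
proof (induction xs rule: edges.induct)
  case (1 x y r)
  have "{x, y} \<inter> S \<noteq> {} \<Longrightarrow> {x, y} \<subseteq> S" using 1(2)[of "{x, y}"] by simp
  moreover have "set (y # r) \<inter> S \<noteq> {} \<Longrightarrow> set (y # r) \<subseteq> S" using 1 by auto
  ultimately show ?case using 1(3) by auto
qed auto

text \<open>If the edge could be removed without disconnecting the walk, the remaining edges already
  connect all vertices; otherwise a closed walk crosses it an even number of times.\<close>
lemma card_closed_walk_odd:
  assumes "xs \<noteq> []" "hd xs = last xs" "odd (count_list (edges xs) e)"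
  shows "card (set xs) \<le> card (set (edges xs))"
proof -
  let ?E = "set (edges xs)"
  have eE: "e \<in> ?E" using assms(3) by (metis count_list_0_iff even_zero)
  then obtain x y where e: "x \<in> set xs" "y \<in> set xs" "e = {x, y}" using edge_in_edges by blast
  \<comment> \<open>\<open>P\<close> keeps only the edge count of connectedness: at most one vertex
    more than edges other than \<open>e\<close> inside \<open>S\<close>. A largest such
    \<open>S\<close> is not left by any edge other than \<open>e\<close>, since following one would
    add one vertex and at least one edge.\<close>
  define P where "P S \<longleftrightarrow> x \<in> S \<and> S \<subseteq> set xs \<and> card S \<le> Suc (card {f \<in> ?E - {e}. f \<subseteq> S})" for S
  have "P {x}" using e by (auto simp: P_def)
  moreover have "\<forall>S. P S \<longrightarrow> card S < Suc (card (set xs))"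
    by (auto simp: P_def less_Suc_eq_le intro: card_mono)
  ultimately have "\<exists>S. P S \<and> (\<forall>T. P T \<longrightarrow> card T \<le> card S)" by (rule ex_has_greatest_nat)
  then obtain S where S: "P S" "\<And>T. P T \<Longrightarrow> card T \<le> card S" by blast
  have finS: "finite S" using S(1) by (auto simp: P_def intro: finite_subset)
  have closed: "f \<subseteq> S" if f: "f \<in> ?E" "f \<noteq> e" "f \<inter> S \<noteq> {}" for f
  proof (rule ccontr)
    assume nf: "\<not> f \<subseteq> S"
    obtain u w where fuw: "f = {u, w}" "u \<in> set xs" "w \<in> set xs" using edge_in_edges[OF f(1)] by blast
    define T where "T = S \<union> f"
    obtain w' where w': "w' \<notin> S" "T = insert w' S" "w' \<in> set xs"
      using fuw f(3) nf that unfolding T_def by auto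
    have "card T = Suc (card S)" using w' finS by simp
    also have "\<dots> \<le> Suc (Suc (card {f \<in> ?E - {e}. f \<subseteq> S}))" using S(1) by (simp add: P_def)
    also have "Suc (card {f \<in> ?E - {e}. f \<subseteq> S}) = card (insert f {f \<in> ?E - {e}. f \<subseteq> S})"
      using nf by simp
    also have "\<dots> \<le> card {f \<in> ?E - {e}. f \<subseteq> T}"
      using f by (intro card_mono) (auto simp: T_def)
    finally have "P T" using S(1) w' by (simp add: P_def)
    from S(2)[OF this] \<open>card T = Suc (card S)\<close> show False by simp
  qed
  have "y \<in> S"
  proof (rule ccontr)
    assume "y \<notin> S"
    \<comment> \<open>Now \<open>e\<close> is the only edge that leaves \<open>S\<close>, so the
      number of crossings is the odd multiplicity of \<open>e\<close>, which is impossible for a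
      closed walk.\<close>
    have "filter (\<lambda>f. f \<inter> S \<noteq> {} \<and> \<not> f \<subseteq> S) (edges xs) = filter (\<lambda>f. e = f) (edges xs)"
      using closed \<open>y \<notin> S\<close> S(1) e(3) by (intro filter_cong) (auto simp: P_def)
    hence "odd (length (filter (\<lambda>f. f \<inter> S \<noteq> {} \<and> \<not> f \<subseteq> S) (edges xs)))"
      using assms(3) by (simp add: count_list_eq_length_filter)
    thus False using odd_crossings[OF assms(1), of S] assms(2) by simp
  qed
  hence "set xs \<subseteq> S"
    using closed e S(1) by (intro edges_no_crossing) (auto simp: P_def)
  hence "card (set xs) \<le> card S" using finS card_mono by blast
  also have "\<dots> \<le> Suc (card {f \<in> ?E - {e}. f \<subseteq> S})" using S(1) by (simp add: P_def)
  also have "\<dots> \<le> Suc (card (?E - {e}))" by (intro Suc_le_mono[THEN iffD2] card_mono) auto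
  also have "\<dots> = card ?E" by (rule card_Suc_Diff1) (use eE in auto)
  finally show ?thesis .
qed

section \<open>Exploration of walks that traverse a tree twice\<close>

text \<open>The first list is the path from the current vertex back to the root and \<open>S\<close> the set of visited
  vertices: each step leads to a new vertex or back to the parent. The resulting closed walks traverse
  every edge of a tree exactly twice.\<close>
fun excursion :: "'v list \<Rightarrow> 'v set \<Rightarrow> 'v list \<Rightarrow> bool" where
  "excursion [] S ys \<longleftrightarrow> False"
| "excursion (x # st) S [] \<longleftrightarrow> st = []"
| "excursion (x # st) S (y # ys) \<longleftrightarrow>
     (if y \<in> S then st \<noteq> [] \<and> y = hd st \<and> excursion st S ys
      else excursion (y # x # st) (insert y S) ys)"

fun double_tree :: "'v list \<Rightarrow> bool" where
  "double_tree [] \<longleftrightarrow> False"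
| "double_tree (x # ys) \<longleftrightarrow> excursion [x] {x} ys"

lemma edge_notin_edges: "x \<notin> set xs \<Longrightarrow> {x, y} \<notin> set (edges xs)"
  using edges_subset by fastforce

text \<open>Invariant of the exploration: \<open>S\<close> and \<open>F\<close> hold the visited
  vertices and traversed edges, edges on the path to the root have one traversal left, other old
  edges none, and new edges will be used twice or never. The last premise says that the rest of the
  walk attains equality in \<open>card_walk_from\<close>, so every further new edge must discover a
  vertex.\<close>

lemma excursionI:
  assumes "distinct (x # st)" "set (x # st) \<subseteq> S" "finite S" "\<And>f. f \<in> F \<Longrightarrow> f \<subseteq> S"
    and "set (edges (x # st)) \<subseteq> F"
    and "\<And>e. e \<in> set (edges (x # st)) \<Longrightarrow> count_list (edges (x # ys)) e = 1"
    and "\<And>e. e \<in> F \<Longrightarrow> e \<notin> set (edges (x # st)) \<Longrightarrow> count_list (edges (x # ys)) e = 0"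
    and "\<And>e. e \<notin> F \<Longrightarrow> count_list (edges (x # ys)) e \<in> {0, 2}"
    and "card S + card (set (edges (x # ys)) - F) \<le> card (S \<union> set ys)"
  shows "excursion (x # st) S ys"
  using assms
proof (induction ys arbitrary: x st S F)
  case Nil
  then show ?case by (cases st) auto
next
  case (Cons y ys)
  let ?e = "{x, y}"
  have cnt: "count_list (edges (x # y # ys)) e
      = (if ?e = e then 1 else 0) + count_list (edges (y # ys)) e" for e by simp
  show ?case
  proof (cases "y \<in> S")
    case True
    \<comment> \<open>A new edge between two visited vertices would leave too few new edges to
      discover the remaining vertices, against the last premise.\<close>
    have "?e \<in> F"
    proof (rule ccontr)
      assume nF: "?e \<notin> F"
      have "card (S \<union> set (y # ys)) \<le> card S + card (set (edges (y # ys)) - insert ?e F)"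
        using Cons.prems True by (intro card_walk_from) auto
      moreover have "set (edges (x # y # ys)) - F = insert ?e (set (edges (y # ys)) - insert ?e F)"
        using nF by auto
      ultimately show False using Cons.prems(9) by simp
    qed
    \<comment> \<open>An old edge that is used now still has a traversal left, hence lies on the
      path to the root. As \<open>x\<close> does not occur in \<open>st\<close>, it is the first
      edge of that path, and \<open>y\<close> is the parent of \<open>x\<close>.\<close>
    moreover have "?e \<in> set (edges (x # st))"
      using Cons.prems(7)[OF calculation] cnt[of ?e] by fastforce
    then obtain z st' where st: "st = z # st'" by (cases st) auto
    have "?e \<notin> set (edges st)" using Cons.prems(1) by (intro edge_notin_edges) auto
    hence y: "y = z" using \<open>?e \<in> set (edges (x # st))\<close> st by (auto simp: doubleton_eq_iff)
    have nst: "?e \<notin> set (edges st)" by fact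
    have E: "set (edges (x # st)) = insert ?e (set (edges st))" by (simp add: st y)
    have "excursion (y # st') S ys"
    proof (rule Cons.IH[where F = F])
      show "count_list (edges (y # ys)) e = 1" if "e \<in> set (edges (y # st'))" for e
      proof -
        have "e \<in> set (edges st)" using that st y by simp
        hence "?e \<noteq> e" "e \<in> set (edges (x # st))" using nst E by auto
        thus ?thesis using Cons.prems(6)[of e] cnt[of e] by simp
      qed
      show "count_list (edges (y # ys)) e = 0" if "e \<in> F" "e \<notin> set (edges (y # st'))" for e
      proof (cases "?e = e")
        case True
        then show ?thesis using Cons.prems(6)[of e] cnt[of e] E by simp
      next
        case False
        moreover have "e \<notin> set (edges st)" using that st y by simp
        ultimately have "e \<notin> set (edges (x # st))" using E by simp
        then show ?thesis using Cons.prems(7)[of e] that cnt[of e] False by simp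
      qed
      show "count_list (edges (y # ys)) e \<in> {0, 2}" if "e \<notin> F" for e
      proof -
        have "?e \<noteq> e" using that \<open>?e \<in> F\<close> by blast
        thus ?thesis using Cons.prems(8)[OF that] cnt[of e] by simp
      qed
      have "set (edges (x # y # ys)) - F = set (edges (y # ys)) - F" using \<open>?e \<in> F\<close> by auto
      thus "card S + card (set (edges (y # ys)) - F) \<le> card (S \<union> set ys)"
        using Cons.prems(9) True by (simp add: insert_absorb)
      show "distinct (y # st')" "set (y # st') \<subseteq> S" using Cons.prems(1,2) st y by simp_all
      show "set (edges (y # st')) \<subseteq> F" using Cons.prems(5) st y by simp
    qed (use Cons.prems(3,4) in blast)+
    thus ?thesis using True st y by simp
  next
    case False
    have nF: "?e \<notin> F" using Cons.prems(4) False by blast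
    have "excursion (y # x # st) (insert y S) ys"
    proof (rule Cons.IH[where F = "insert ?e F"])
      have e2: "count_list (edges (y # ys)) ?e = 1"
        using Cons.prems(8)[OF nF] cnt[of ?e] by auto
      have E: "set (edges (y # x # st)) = insert ?e (set (edges (x # st)))"
        by (simp add: insert_commute)
      show "count_list (edges (y # ys)) e = 1" if "e \<in> set (edges (y # x # st))" for e
      proof (cases "?e = e")
        case False
        hence "e \<in> set (edges (x # st))" using that unfolding E by auto
        thus ?thesis using Cons.prems(6)[of e] cnt[of e] False by simp
      qed (use e2 in simp)
      show "count_list (edges (y # ys)) e = 0"
        if "e \<in> insert ?e F" "e \<notin> set (edges (y # x # st))" for e
      proof -
        have "?e \<noteq> e" "e \<in> F" "e \<notin> set (edges (x # st))" using that E by auto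
        thus ?thesis using Cons.prems(7)[of e] cnt[of e] by simp
      qed
      show "count_list (edges (y # ys)) e \<in> {0, 2}" if "e \<notin> insert ?e F" for e
      proof -
        have "?e \<noteq> e" "e \<notin> F" using that by auto
        thus ?thesis using Cons.prems(8)[of e] cnt[of e] by simp
      qed
      have "set (edges (x # y # ys)) - F = insert ?e (set (edges (y # ys)) - insert ?e F)"
        using nF by auto
      thus "card (insert y S) + card (set (edges (y # ys)) - insert ?e F) \<le> card (insert y S \<union> set ys)"
        using Cons.prems(9) Cons.prems(3) False by simp
      show "distinct (y # x # st)" using Cons.prems(1,2) False by auto
      show "set (y # x # st) \<subseteq> insert y S" "finite (insert y S)" using Cons.prems(2,3) by auto
      show "f \<subseteq> insert y S" if "f \<in> insert ?e F" for f using that Cons.prems(2,4) by auto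
      show "set (edges (y # x # st)) \<subseteq> insert ?e F" using Cons.prems(5) E by auto
    qed
    thus ?thesis using False by simp
  qed
qed

text \<open>The path to the root is a stack of open edges: each of them is closed by one more
  traversal, closed edges are never reused, and an edge with an unvisited end is opened on discovery
  of that end and closed on return, if it is used at all.\<close>

lemma excursion_count:
  assumes "excursion (x # st) S ys" "distinct (x # st)" "set (x # st) \<subseteq> S"
  shows "(e \<in> set (edges (x # st)) \<longrightarrow> count_list (edges (x # ys)) e = 1) \<and>
         (e \<notin> set (edges (x # st)) \<and> e \<subseteq> S \<longrightarrow> count_list (edges (x # ys)) e = 0) \<and>
         (\<not> e \<subseteq> S \<longrightarrow> count_list (edges (x # ys)) e \<in> {0, 2})"
  using assms
proof (induction ys arbitrary: x st S)
  case Nil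
  then show ?case by auto
next
  case (Cons y ys)
  let ?e = "{x, y}"
  have cnt: "count_list (edges (x # y # ys)) e
      = (if ?e = e then 1 else 0) + count_list (edges (y # ys)) e" for e by simp
  show ?case
  proof (cases "y \<in> S")
    case True
    then obtain st' where st: "st = y # st'" "excursion (y # st') S ys"
      using Cons.prems(1) by (cases st) auto
    note IH = Cons.IH[OF st(2)]
    have nst: "?e \<notin> set (edges st)" using Cons.prems(2) by (intro edge_notin_edges) auto
    have E: "set (edges (x # st)) = insert ?e (set (edges st))" by (simp add: st)
    have sub: "?e \<subseteq> S" using Cons.prems True by auto
    show ?thesis using IH Cons.prems(2,3) st(1) nst sub unfolding E cnt
      by (cases "?e = e") auto
  next
    case False
    hence "excursion (y # x # st) (insert y S) ys" using Cons.prems(1) by simp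
    note IH = Cons.IH[OF this]
    have nS: "\<not> ?e \<subseteq> S" using False by auto
    have E: "set (edges (y # x # st)) = insert ?e (set (edges (x # st)))" by (simp add: insert_commute)
    have sub: "f \<subseteq> S" if "f \<in> set (edges (x # st))" for f
      using edges_subset[OF that] Cons.prems(3) by blast
    have d: "distinct (y # x # st)" "set (y # x # st) \<subseteq> insert y S" using Cons.prems False by auto
    show ?thesis
    proof (cases "?e = e")
      case True
      then show ?thesis using IH[OF d] nS sub unfolding E cnt by auto
    next
      case ne: False
      show ?thesis
      proof (cases "e \<subseteq> S")
        case True
        then show ?thesis using IH[OF d] ne unfolding E cnt by auto
      next
        case nsub: False
        hence "e \<notin> set (edges (x # st))" using sub by blast
        then show ?thesis using IH[OF d] ne nsub unfolding E cnt by auto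
      qed
    qed
  qed
qed

lemma double_tree_count:
  assumes "double_tree xs" "e \<in> set (edges xs)"
  shows "count_list (edges xs) e = 2"
proof -
  obtain x ys where xs: "xs = x # ys" "excursion [x] {x} ys" using assms(1) by (cases xs) auto
  have "count_list (edges xs) e \<noteq> 0" using assms(2) by (simp add: count_list_0_iff)
  thus ?thesis using excursion_count[OF xs(2), of e] xs(1) by auto
qed

text \<open>The bound 4 is the least even multiplicity with two traversals to spare beyond the two
  charged to every edge; this surplus pays for one more vertex.\<close>

definition heavy_edges :: "'v set list \<Rightarrow> 'v set set" where
  "heavy_edges es = {e \<in> set es. count_list es e \<ge> 4}"

lemma finite_heavy_edges [simp]: "finite (heavy_edges es)"
  by (simp add: heavy_edges_def)

text \<open>If the bound failed, there would be one vertex more than edges, no heavy edge and, by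
  \<open>card_closed_walk_odd\<close>, only even multiplicities. Every edge would then be used
  exactly twice, and \<open>excursionI\<close>, started at the root with no traversed edges, would
  yield a double tree.\<close>

lemma card_closed_walk_not_double_tree:
  assumes "xs \<noteq> []" "hd xs = last xs" "\<not> double_tree xs"
  shows "card (set xs) \<le> card (set (edges xs)) + card (heavy_edges (edges xs))"
proof (rule ccontr)
  assume less: "\<not> ?thesis"
  obtain x ys where xs: "xs = x # ys" using assms(1) by (cases xs) auto
  have even: "even (count_list (edges xs) e)" for e
    using card_closed_walk_odd[OF assms(1,2), of e] less by auto
  have "heavy_edges (edges xs) = {}"
    using card_walk[OF assms(1)] less card_gt_0_iff[of "heavy_edges (edges xs)"] by fastforce
  hence lt: "count_list (edges xs) e < 4" for e
    by (cases "e \<in> set (edges xs)") (auto simp: heavy_edges_def not_le count_list_0_iff)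
  have "count_list (edges xs) e \<in> {0, 2}" for e
  proof -
    have "count_list (edges xs) e \<noteq> 1" "count_list (edges xs) e \<noteq> 3"
      using even[of e] by (auto simp del: One_nat_def)
    thus ?thesis using lt[of e] by auto
  qed
  moreover have "Suc (card (set (edges xs))) \<le> card (set xs)" using less by simp
  ultimately have "excursion [x] {x} ys"
    unfolding xs by (intro excursionI[where F = "{}"]) auto
  thus False using assms(3) xs by simp
qed

text \<open>Induction over the walks. One that is disjoint from the others has disjoint edges too,
  so the bounds add up; one that meets the others brings at most as many vertices as edges. Heavy
  edges of the parts stay heavy in the concatenation.\<close>

lemma card_closed_walks_not_double_tree:
  assumes "\<And>xs. xs \<in> set xss \<Longrightarrow> xs \<noteq> [] \<and> hd xs = last xs \<and> \<not> double_tree xs"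
  shows "card (\<Union>(set ` set xss)) \<le>
    card (set (concat (map edges xss))) + card (heavy_edges (concat (map edges xss)))"
  using assms
proof (induction xss)
  case (Cons xs xss)
  let ?V = "\<Union>(set ` set xss)" and ?L = "concat (map edges xss)"
  have IH: "card ?V \<le> card (set ?L) + card (heavy_edges ?L)" using Cons by auto
  have xs: "xs \<noteq> []" "hd xs = last xs" "\<not> double_tree xs" using Cons.prems[of xs] by auto
  have L: "concat (map edges (xs # xss)) = edges xs @ ?L" by simp
  have heavy: "heavy_edges (edges xs) \<union> heavy_edges ?L \<subseteq> heavy_edges (edges xs @ ?L)"
    by (auto simp: heavy_edges_def)
  have sub: "e \<subseteq> ?V" if "e \<in> set ?L" for e using that edges_subset by fastforce
  show ?case
  proof (cases "set xs \<inter> ?V = {}")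
    case True
    have disj: "set (edges xs) \<inter> set ?L = {}"
    proof (rule ccontr)
      assume "set (edges xs) \<inter> set ?L \<noteq> {}"
      then obtain e where e: "e \<in> set (edges xs)" "e \<in> set ?L" by blast
      then obtain x y where "e = {x, y}" using edge_in_edges by blast
      thus False using True edges_subset[OF e(1)] sub[OF e(2)] by auto
    qed
    have "card (\<Union>(set ` set (xs # xss))) = card (set xs) + card ?V"
      using True by (simp add: card_Un_disjoint)
    also have "card (set xs) \<le> card (set (edges xs)) + card (heavy_edges (edges xs))"
      by (rule card_closed_walk_not_double_tree) (use xs in auto)
    also note IH
    also have "card (set (edges xs)) + card (heavy_edges (edges xs)) + (card (set ?L) + card (heavy_edges ?L))
      = card (set (edges xs) \<union> set ?L) + card (heavy_edges (edges xs) \<union> heavy_edges ?L)"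
      using disj by (subst (1 2) card_Un_disjoint) (auto simp: heavy_edges_def)
    also have "\<dots> \<le> card (set (edges xs @ ?L)) + card (heavy_edges (edges xs @ ?L))"
      using card_mono[OF _ heavy] by simp
    finally show ?thesis unfolding L by simp
  next
    case False
    have "card (?V \<union> set xs) \<le> card ?V + card (set (edges xs) - set ?L)"
      by (rule card_walk_meeting) (use False sub in auto)
    also note IH
    also have "card (set ?L) + card (heavy_edges ?L) + card (set (edges xs) - set ?L)
      = card (set ?L \<union> (set (edges xs) - set ?L)) + card (heavy_edges ?L)"
      by (subst card_Un_disjoint) auto
    also have "\<dots> \<le> card (set (edges xs @ ?L)) + card (heavy_edges (edges xs @ ?L))"
      using heavy by (intro add_mono card_mono) auto
    finally show ?thesis unfolding L by (simp add: Un_commute)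
  qed
qed auto

definition single_edges :: "'v set list \<Rightarrow> 'v set set" where
  "single_edges es = {e \<in> set es. count_list es e = 1}"

text \<open>Summation over the edges of \<open>2 + 2 * [m \<ge> 4] \<le> m + [m = 1]\<close>, where
  \<open>m \<ge> 1\<close> is the multiplicity.\<close>

lemma card_edges_le:
  "2 * (card (set es) + card (heavy_edges es)) \<le> length es + card (single_edges es)"
proof -
  have "2 * (card (set es) + card (heavy_edges es))
      = (\<Sum>e\<in>set es. 2 + 2 * (if count_list es e \<ge> 4 then 1 else 0))"
    unfolding sum.distrib sum_distrib_left[symmetric]
    by (simp add: heavy_edges_def sum.If_cases Int_def)
  also have "\<dots> \<le> (\<Sum>e\<in>set es. count_list es e + (if count_list es e = 1 then 1 else 0))"
  proof (rule sum_mono)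
    fix e assume "e \<in> set es"
    hence "count_list es e \<noteq> 0" by (simp add: count_list_0_iff)
    thus "2 + 2 * (if count_list es e \<ge> 4 then 1 else 0)
      \<le> count_list es e + (if count_list es e = 1 then 1 else (0::nat))" by auto
  qed
  also have "\<dots> = length es + card (single_edges es)"
    by (simp add: sum.distrib single_edges_def sum.If_cases Int_def sum_count_set)
  finally show ?thesis .
qed

text \<open>Connectedness alone would allow \<open>k + 1\<close> vertices; the shared edge takes one
  away. If its multiplicity is odd in one of the walks, that walk has no more vertices than edges.
  Otherwise it is used at least twice in each walk and is heavy in the concatenation.\<close>

lemma card_walks_sharing_edge:
  assumes xs: "length xs = Suc k" "hd xs = last xs" and ys: "length ys = Suc k" "hd ys = last ys"
    and share: "set (edges xs) \<inter> set (edges ys) \<noteq> {}"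
    and no_single: "single_edges (edges xs @ edges ys) = {}"
  shows "card (set xs \<union> set ys) \<le> k"
proof -
  let ?es = "edges xs @ edges ys"
  obtain e where e: "e \<in> set (edges xs)" "e \<in> set (edges ys)" using share by blast
  have ne: "xs \<noteq> []" "ys \<noteq> []" using xs ys by auto
  obtain u v where uv: "e = {u, v}" "u \<in> set xs" using edge_in_edges[OF e(1)] by blast
  have meet: "set xs \<inter> set ys \<noteq> {}" using uv edges_subset[OF e(2)] by auto
  have 1: "card (set xs \<union> set ys) \<le> card (set xs) + card (set (edges ys) - set (edges xs))"
    by (rule card_walk_meeting) (use meet edges_subset in auto)
  have 2: "card (set ys \<union> set xs) \<le> card (set ys) + card (set (edges xs) - set (edges ys))"
    by (rule card_walk_meeting) (use meet edges_subset in auto)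
  have E1: "card (set ?es) = card (set (edges xs)) + card (set (edges ys) - set (edges xs))"
    by (subst card_Un_disjoint[symmetric]) (auto simp: Un_Diff_cancel)
  have E2: "card (set ?es) = card (set (edges ys)) + card (set (edges xs) - set (edges ys))"
    by (subst card_Un_disjoint[symmetric]) (auto simp: Un_Diff_cancel Un_commute)
  have len: "2 * (card (set ?es) + card (heavy_edges ?es)) \<le> 2 * k"
    using card_edges_le[of ?es] no_single xs(1) ys(1) by simp
  hence E_le: "card (set ?es) + card (heavy_edges ?es) \<le> k" by simp
  show ?thesis
  proof (cases "odd (count_list (edges xs) e) \<or> odd (count_list (edges ys) e)")
    case True
    hence "card (set xs) \<le> card (set (edges xs)) \<or> card (set ys) \<le> card (set (edges ys))"
      using card_closed_walk_odd ne xs(2) ys(2) by blast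
    thus ?thesis using 1 2 E1 E2 E_le unfolding Un_commute[of "set ys"] by linarith
  next
    case False
    have "count_list (edges xs) e \<noteq> 0" "count_list (edges ys) e \<noteq> 0"
      using e by (simp_all add: count_list_0_iff)
    hence "count_list (edges xs) e \<ge> 2" "count_list (edges ys) e \<ge> 2"
      using False by (auto elim!: evenE)
    hence "e \<in> heavy_edges ?es" using e by (simp add: heavy_edges_def)
    hence "card (heavy_edges ?es) \<ge> 1"
      by (metis One_nat_def Suc_leI card_gt_0_iff empty_iff finite_heavy_edges)
    thus ?thesis using 1 card_walk[OF ne(1)] E1 E_le by linarith
  qed
qed

section \<open>Weighted counts of walks\<close>

text \<open>The lists omit the start vertex, which \<open>walks\<close> puts in front;
  \<open>m\<close> and \<open>k\<close> count steps.\<close>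

fun walks_from :: "('v \<Rightarrow> 'v set) \<Rightarrow> 'v \<Rightarrow> nat \<Rightarrow> 'v list set" where
  "walks_from N x 0 = {[]}"
| "walks_from N x (Suc m) = (\<Union>y\<in>N x. (#) y ` walks_from N y m)"

definition walks :: "'v set \<Rightarrow> ('v \<Rightarrow> 'v set) \<Rightarrow> nat \<Rightarrow> 'v list set" where
  "walks V N k = (\<Union>x\<in>V. (#) x ` walks_from N x k)"

definition tuples :: "'x set \<Rightarrow> nat \<Rightarrow> 'x list set" where
  "tuples A z = {xss. set xss \<subseteq> A \<and> length xss = z}"

lemma walks_from_length: "ys \<in> walks_from N x m \<Longrightarrow> length ys = m"
  by (induction m arbitrary: x ys) auto

lemma walks_length: "xs \<in> walks V N k \<Longrightarrow> length xs = Suc k"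
  by (auto simp: walks_def dest: walks_from_length)

lemma finite_walks_from: "(\<And>x. finite (N x)) \<Longrightarrow> finite (walks_from N x m)"
  by (induction m arbitrary: x) auto

lemma finite_walks: "(\<And>x. finite (N x)) \<Longrightarrow> finite V \<Longrightarrow> finite (walks V N k)"
  by (auto simp: walks_def finite_walks_from)

lemma finite_tuples: "finite A \<Longrightarrow> finite (tuples A z)"
  unfolding tuples_def by (rule finite_lists_length_eq)

lemma sum_Cons_images:
  assumes "finite A" "\<And>y. finite (W y)"
  shows "sum f (\<Union>y\<in>A. (#) y ` W y) = (\<Sum>y\<in>A. \<Sum>ys\<in>W y. f (y # ys))"
  using assms by (subst sum.UNION_disjoint) (auto simp: sum.reindex o_def intro!: sum.cong)

lemma sum_walks_from_Suc:
  assumes "\<And>x. finite (N x)"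
  shows "sum f (walks_from N x (Suc m)) = (\<Sum>y\<in>N x. \<Sum>ys\<in>walks_from N y m. f (y # ys))"
  unfolding walks_from.simps by (rule sum_Cons_images) (auto intro: finite_walks_from assms)

lemma sum_walks:
  assumes "\<And>x. finite (N x)" "finite V"
  shows "sum f (walks V N k) = (\<Sum>x\<in>V. \<Sum>ys\<in>walks_from N x k. f (x # ys))"
  unfolding walks_def by (rule sum_Cons_images) (auto intro: finite_walks_from assms)

lemma tuples_0 [simp]: "tuples A 0 = {[]}"
  by (auto simp: tuples_def)

lemma tuples_Suc: "tuples A (Suc z) = (\<Union>x\<in>A. (#) x ` tuples A z)"
  by (auto simp: tuples_def length_Suc_conv)

lemma sum_tuples_Suc:
  assumes "finite A"
  shows "sum f (tuples A (Suc z)) = (\<Sum>x\<in>A. \<Sum>xss\<in>tuples A z. f (x # xss))"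
  unfolding tuples_Suc by (rule sum_Cons_images) (use assms finite_tuples in auto)

lemma power_sum_tuples:
  fixes g :: "'x \<Rightarrow> 'r::comm_semiring_1"
  assumes "finite A"
  shows "(\<Sum>x\<in>A. g x) ^ z = (\<Sum>xss\<in>tuples A z. prod_list (map g xss))"
proof (induction z)
  case (Suc z)
  then show ?case using assms
    by (simp add: sum_tuples_Suc sum_distrib_left sum_distrib_right)
      (simp add: sum_distrib_left[symmetric] sum_distrib_right[symmetric])
qed simp

lemma sum_power_card_insert:
  fixes \<beta> :: real
  assumes "finite S" "finite A" "0 \<le> \<beta>"
  shows "(\<Sum>y\<in>A. \<beta> ^ card (insert y S)) \<le> (real (card S) + real (card A) * \<beta>) * \<beta> ^ card S"
proof -
  have "(\<Sum>y\<in>A. \<beta> ^ card (insert y S))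
      = (\<Sum>y\<in>A \<inter> S. \<beta> ^ card (insert y S)) + (\<Sum>y\<in>A - S. \<beta> ^ card (insert y S))"
    using assms by (subst sum.union_disjoint[symmetric]) (auto simp: Int_Diff_Un)
  also have "(\<Sum>y\<in>A \<inter> S. \<beta> ^ card (insert y S)) = real (card (A \<inter> S)) * \<beta> ^ card S"
    by (simp add: insert_absorb)
  also have "(\<Sum>y\<in>A - S. \<beta> ^ card (insert y S)) = real (card (A - S)) * (\<beta> * \<beta> ^ card S)"
    using assms by simp
  also have "real (card (A \<inter> S)) * \<beta> ^ card S \<le> real (card S) * \<beta> ^ card S"
    using assms by (intro mult_right_mono) (auto intro: card_mono)
  also have "real (card (A - S)) * (\<beta> * \<beta> ^ card S) \<le> real (card A) * (\<beta> * \<beta> ^ card S)"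
    using assms by (intro mult_right_mono) (auto intro: card_mono)
  finally show ?thesis by (simp add: algebra_simps)
qed

context
  fixes N :: "'v \<Rightarrow> 'v set" and B :: nat
  assumes fin: "\<And>x. finite (N x)" and deg: "\<And>x. card (N x) \<le> B" and B: "B \<ge> 1"
begin

text \<open>A step to a new vertex has at most \<open>B\<close> choices and costs a factor \<open>1 / B\<close>; a step to an old
  vertex has at most \<open>K\<close> choices.\<close>
lemma sum_walks_from_bound:
  assumes "finite S" "card S + m \<le> K"
  shows "(\<Sum>ys\<in>walks_from N x m. (1 / real B) ^ card (S \<union> set ys))
           \<le> (real K + 1) ^ m * (1 / real B) ^ card S"
  using assms
proof (induction m arbitrary: x S)
  case (Suc m)
  have "(\<Sum>ys\<in>walks_from N x (Suc m). (1 / real B) ^ card (S \<union> set ys))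
      = (\<Sum>y\<in>N x. \<Sum>ys\<in>walks_from N y m. (1 / real B) ^ card (insert y S \<union> set ys))"
    by (simp add: sum_walks_from_Suc fin del: walks_from.simps)
  also have "\<dots> \<le> (\<Sum>y\<in>N x. (real K + 1) ^ m * (1 / real B) ^ card (insert y S))"
    using Suc.prems card_insert_if[of S]
    by (intro sum_mono Suc.IH) (auto simp: card_insert_if)
  also have "\<dots> = (real K + 1) ^ m * (\<Sum>y\<in>N x. (1 / real B) ^ card (insert y S))"
    by (simp add: sum_distrib_left)
  also have "\<dots> \<le> (real K + 1) ^ m * ((real (card S) + real (card (N x)) * (1 / real B)) * (1 / real B) ^ card S)"
    using Suc.prems by (intro mult_left_mono sum_power_card_insert fin) auto
  also have "\<dots> \<le> (real K + 1) ^ m * ((real K + 1) * (1 / real B) ^ card S)"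
    using deg[of x] Suc.prems B by (intro mult_left_mono mult_right_mono add_mono) auto
  finally show ?case by (simp add: mult_ac)
qed simp

text \<open>Only the start vertex is chosen from all of \<open>V\<close>, and this choice costs
  \<open>card V / B\<close> instead of a constant.\<close>

lemma sum_walks_bound:
  assumes "finite V" "B \<le> card V" "finite S" "card S + Suc k \<le> K"
  shows "(\<Sum>xs\<in>walks V N k. (1 / real B) ^ card (S \<union> set xs))
           \<le> (real K + 1) ^ Suc k * (real (card V) / real B) * (1 / real B) ^ card S"
proof -
  have "(\<Sum>xs\<in>walks V N k. (1 / real B) ^ card (S \<union> set xs))
      = (\<Sum>x\<in>V. \<Sum>ys\<in>walks_from N x k. (1 / real B) ^ card (insert x S \<union> set ys))"
    by (simp add: sum_walks fin assms)
  also have "\<dots> \<le> (\<Sum>x\<in>V. (real K + 1) ^ k * (1 / real B) ^ card (insert x S))"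
    using assms by (intro sum_mono sum_walks_from_bound) (auto simp: card_insert_if)
  also have "\<dots> = (real K + 1) ^ k * (\<Sum>x\<in>V. (1 / real B) ^ card (insert x S))"
    by (simp add: sum_distrib_left)
  also have "\<dots> \<le> (real K + 1) ^ k * ((real (card S) + real (card V) * (1 / real B)) * (1 / real B) ^ card S)"
    using assms by (intro mult_left_mono sum_power_card_insert) auto
  also have "\<dots> \<le> (real K + 1) ^ k * ((real K * (real (card V) / real B) + real (card V) / real B) * (1 / real B) ^ card S)"
  proof (intro mult_left_mono mult_right_mono add_mono)
    \<comment> \<open>A start inside \<open>S\<close> has at most \<open>K\<close> choices, and
      these are absorbed by the factor \<open>card V / B \<ge> 1\<close>.\<close>
    have "1 \<le> real (card V) / real B" using assms B by (simp add: field_simps)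
    hence "real (card S) * 1 \<le> real K * (real (card V) / real B)"
      using assms by (intro mult_mono) auto
    thus "real (card S) \<le> real K * (real (card V) / real B)" by simp
  qed auto
  finally show ?thesis by (simp add: algebra_simps)
qed

text \<open>\<open>S\<close> collects the vertices of the walks summed so far, so a vertex common to
  several walks is weighted once. Each walk adds one free start.\<close>

lemma sum_tuples_walks_bound:
  assumes "finite V" "B \<le> card V" "finite S" "card S + z * Suc k \<le> K"
  shows "(\<Sum>xss\<in>tuples (walks V N k) z. (1 / real B) ^ card (S \<union> \<Union>(set ` set xss)))
           \<le> ((real K + 1) ^ Suc k * (real (card V) / real B)) ^ z * (1 / real B) ^ card S"
  using assms(3,4)
proof (induction z arbitrary: S)
  case (Suc z)
  let ?C = "(real K + 1) ^ Suc k * (real (card V) / real B)"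
  have "(\<Sum>xss\<in>tuples (walks V N k) (Suc z). (1 / real B) ^ card (S \<union> \<Union>(set ` set xss)))
      = (\<Sum>xs\<in>walks V N k. \<Sum>xss\<in>tuples (walks V N k) z.
            (1 / real B) ^ card ((S \<union> set xs) \<union> \<Union>(set ` set xss)))"
    by (simp add: sum_tuples_Suc finite_walks fin assms Un_assoc)
  also have "\<dots> \<le> (\<Sum>xs\<in>walks V N k. ?C ^ z * (1 / real B) ^ card (S \<union> set xs))"
  proof (intro sum_mono Suc.IH)
    fix xs assume "xs \<in> walks V N k"
    hence "card (set xs) \<le> Suc k" using card_length[of xs] walks_length by fastforce
    thus "card (S \<union> set xs) + z * Suc k \<le> K" using card_Un_le[of S "set xs"] Suc.prems by simp
  qed (use Suc.prems in auto)
  also have "\<dots> = ?C ^ z * (\<Sum>xs\<in>walks V N k. (1 / real B) ^ card (S \<union> set xs))"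
    by (simp only: sum_distrib_left)
  also have "\<dots> \<le> ?C ^ z * (?C * (1 / real B) ^ card S)"
    using Suc.prems assms by (intro mult_left_mono sum_walks_bound) auto
  finally show ?case by (simp only: power_Suc mult_ac)
qed simp

lemma walks_from_Cons:
  "y # ys \<in> walks_from N x (Suc m) \<longleftrightarrow> y \<in> N x \<and> ys \<in> walks_from N y m"
  by auto

lemma walks_from_append:
  "us @ ws \<in> walks_from N x m \<longleftrightarrow>
     length us \<le> m \<and> us \<in> walks_from N x (length us) \<and>
     ws \<in> walks_from N (last (x # us)) (m - length us)"
proof (induction us arbitrary: x m)
  case (Cons u us)
  show ?case
  proof (cases m)
    case (Suc m')
    show ?thesis
      using Cons.IH[of u m'] by (auto simp: Suc walks_from_Cons simp del: walks_from.simps(2))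
  qed simp
qed simp

lemma walks_from_rev:
  assumes sym: "\<And>x y. y \<in> N x \<Longrightarrow> x \<in> N y"
  shows "us @ [s] \<in> walks_from N x (Suc (length us)) \<Longrightarrow> rev us @ [x] \<in> walks_from N s (Suc (length us))"
proof (induction us arbitrary: x)
  case (Cons u us)
  hence "u \<in> N x" "us @ [s] \<in> walks_from N u (Suc (length us))" by auto
  thus ?case using Cons.IH[of u] sym walks_from_append[of "rev us @ [u]" "[x]" s "Suc (Suc (length us))"]
    by simp
qed (use sym in auto)

lemma walks_split:
  assumes sym: "\<And>x y. y \<in> N x \<Longrightarrow> x \<in> N y" and w: "us @ s # ws \<in> walks V N k"
  shows "length us \<le> k \<and> rev us \<in> walks_from N s (length us) \<and> ws \<in> walks_from N s (k - length us)"
proof (cases us)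
  case Nil
  then show ?thesis using w by (auto simp: walks_def)
next
  case (Cons x us')
  hence "(us' @ [s]) @ ws \<in> walks_from N x k" using w by (auto simp: walks_def)
  hence *: "length us' + 1 \<le> k" "us' @ [s] \<in> walks_from N x (Suc (length us'))"
    "ws \<in> walks_from N s (k - (length us' + 1))"
    unfolding walks_from_append by auto
  show ?thesis using * walks_from_rev[OF sym *(2)] Cons by simp
qed

text \<open>A walk forced through \<open>S\<close> has no free start: it is given by a position, a
  vertex of \<open>S\<close> and two walks leaving that vertex, one of them reversed by symmetry of
  \<open>N\<close>. This saves the factor \<open>card V / B\<close> of
  \<open>sum_walks_bound\<close>.\<close>

lemma sum_walks_meeting_bound:
  assumes sym: "\<And>x y. y \<in> N x \<Longrightarrow> x \<in> N y" and "finite V" "finite S" "card S + k \<le> K"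
  shows "(\<Sum>xs\<in>{xs \<in> walks V N k. set xs \<inter> S \<noteq> {}}. (1 / real B) ^ card (S \<union> set xs))
           \<le> (real k + 1) * (real K * (real K + 1) ^ k) * (1 / real B) ^ card S"
proof -
  let ?f = "\<lambda>xs. (1 / real B) ^ card (S \<union> set xs)"
  let ?D = "SIGMA j:{..k}. SIGMA s:S. walks_from N s j \<times> walks_from N s (k - j)"
  \<comment> \<open>\<open>?g\<close> is not injective, since a walk can meet \<open>S\<close>
    several times; covering all walks suffices for an upper bound.\<close>
  let ?g = "\<lambda>(j::nat, s, us, ws). rev us @ s # ws"
  have finW: "finite (walks_from N x m)" for x m by (rule finite_walks_from) (rule fin)
  have finD: "finite ?D" 
    by (intro finite_SigmaI finite_cartesian_product finW assms(3) finite_atMost)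
  have sub: "{xs \<in> walks V N k. set xs \<inter> S \<noteq> {}} \<subseteq> ?g ` ?D"
  proof
    fix xs assume xs: "xs \<in> {xs \<in> walks V N k. set xs \<inter> S \<noteq> {}}"
    then obtain s where s: "s \<in> set xs" "s \<in> S" by blast
    obtain us ws where us: "xs = us @ s # ws" using split_list[OF s(1)] by blast
    have "us @ s # ws \<in> walks V N k" using xs us by simp
    note split = walks_split[OF sym this]
    have "(length us, s, rev us, ws) \<in> ?D"
      by (intro SigmaI) (use split s(2) in simp_all)
    moreover have "xs = ?g (length us, s, rev us, ws)" using us by simp
    ultimately show "xs \<in> ?g ` ?D" by (rule rev_image_eqI)
  qed
  have "(\<Sum>xs\<in>{xs \<in> walks V N k. set xs \<inter> S \<noteq> {}}. ?f xs) \<le> (\<Sum>xs\<in>?g ` ?D. ?f xs)"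
    by (rule sum_mono2[OF finite_imageI[OF finD] sub]) simp
  also have "\<dots> \<le> (\<Sum>d\<in>?D. (?f \<circ> ?g) d)"
    by (rule sum_image_le[OF finD]) simp
  also have "\<dots> = (\<Sum>(j, s, us, ws)\<in>?D. (1 / real B) ^ card (S \<union> set us \<union> set ws))"
  proof (rule sum.cong[OF refl])
    fix d assume "d \<in> ?D"
    then obtain j s us ws where d: "d = (j, s, us, ws)" "s \<in> S" by blast
    have "S \<union> set (rev us @ s # ws) = S \<union> set us \<union> set ws" using d(2) by auto
    thus "(?f \<circ> ?g) d = (case d of (j, s, us, ws) \<Rightarrow> (1 / real B) ^ card (S \<union> set us \<union> set ws))"
      by (simp only: d(1) o_apply prod.case)
  qed
  also have "\<dots> = (\<Sum>j\<in>{..k}. \<Sum>(s, us, ws)\<in>(SIGMA s:S. walks_from N s j \<times> walks_from N s (k - j)).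
      (1 / real B) ^ card (S \<union> set us \<union> set ws))"
    by (rule sum.Sigma[symmetric]) (intro finite_atMost ballI finite_SigmaI finite_cartesian_product finW assms(3))+
  also have "\<dots> = (\<Sum>j\<in>{..k}. \<Sum>s\<in>S. \<Sum>(us, ws)\<in>walks_from N s j \<times> walks_from N s (k - j).
      (1 / real B) ^ card (S \<union> set us \<union> set ws))"
    by (intro sum.cong refl sum.Sigma[symmetric]) (intro ballI finite_cartesian_product finW assms(3))+
  also have "\<dots> = (\<Sum>j\<in>{..k}. \<Sum>s\<in>S. \<Sum>us\<in>walks_from N s j. \<Sum>ws\<in>walks_from N s (k - j).
      (1 / real B) ^ card (S \<union> set us \<union> set ws))"
    unfolding sum.cartesian_product ..
  also have "\<dots> \<le> (\<Sum>j\<in>{..k}. \<Sum>s\<in>S. (real K + 1) ^ k * (1 / real B) ^ card S)"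
  proof (intro sum_mono)
    fix j s assume j: "j \<in> {..k}" and s: "s \<in> S"
    have "(\<Sum>us\<in>walks_from N s j. \<Sum>ws\<in>walks_from N s (k - j). (1 / real B) ^ card (S \<union> set us \<union> set ws))
        \<le> (\<Sum>us\<in>walks_from N s j. (real K + 1) ^ (k - j) * (1 / real B) ^ card (S \<union> set us))"
    proof (intro sum_mono sum_walks_from_bound)
      fix us assume "us \<in> walks_from N s j"
      hence "card (set us) \<le> j" using card_length[of us] walks_from_length[of us N s j] by simp
      thus "card (S \<union> set us) + (k - j) \<le> K" using card_Un_le[of S "set us"] assms(2-4) j by simp
    qed (use assms(2-4) in auto)
    also have "\<dots> = (real K + 1) ^ (k - j) * (\<Sum>us\<in>walks_from N s j. (1 / real B) ^ card (S \<union> set us))"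
      by (simp add: sum_distrib_left)
    also have "\<dots> \<le> (real K + 1) ^ (k - j) * ((real K + 1) ^ j * (1 / real B) ^ card S)"
      using assms(2-4) j by (intro mult_left_mono sum_walks_from_bound) auto
    also have "\<dots> = (real K + 1) ^ k * (1 / real B) ^ card S"
      using j by (simp add: power_add[symmetric] mult.assoc[symmetric])
    finally show "(\<Sum>us\<in>walks_from N s j. \<Sum>ws\<in>walks_from N s (k - j). (1 / real B) ^ card (S \<union> set us \<union> set ws))
      \<le> (real K + 1) ^ k * (1 / real B) ^ card S" .
  qed
  also have "\<dots> = (real k + 1) * (real (card S) * (real K + 1) ^ k) * (1 / real B) ^ card S"
    by simp
  also have "\<dots> \<le> (real k + 1) * (real K * (real K + 1) ^ k) * (1 / real B) ^ card S"
    using assms(2-4) by (intro mult_right_mono mult_left_mono) auto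
  finally show ?thesis .
qed

end

section \<open>Counting double trees\<close>

text \<open>The number of nonnegative \<open>\<plusminus>1\<close>-paths of length \<open>m\<close> from height \<open>l\<close> to \<open>0\<close>.\<close>
fun ballot :: "nat \<Rightarrow> nat \<Rightarrow> nat" where
  "ballot 0 l = (if l = 0 then 1 else 0)"
| "ballot (Suc m) l = ballot m (Suc l) + (case l of 0 \<Rightarrow> 0 | Suc l' \<Rightarrow> ballot m l')"

lemma ballot_le: "ballot m l \<le> 2 ^ m"
proof (induction m arbitrary: l)
  case (Suc m)
  show ?case using Suc[of "Suc l"] Suc[of "l - 1"] by (cases l) auto
qed simp

lemma ballot_even_le: "real (ballot (2 * L) 0) \<le> 4 ^ L"
proof -
  have "real (ballot (2 * L) 0) \<le> real (2 ^ (2 * L))" by (simp only: of_nat_le_iff ballot_le)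
  thus ?thesis by (simp add: power_mult)
qed

lemma excursion_last: "excursion (x # st) S ys \<Longrightarrow> last (x # ys) = last (x # st)"
proof (induction "x # st" S ys arbitrary: x st rule: excursion.induct)
  case (3 x st S y ys)
  then show ?case by (cases st) (auto split: if_splits)
qed auto

lemma double_tree_closed: "double_tree xs \<Longrightarrow> hd xs = last xs"
  by (cases xs) (use excursion_last in fastforce)+

context
  fixes N :: "'v \<Rightarrow> 'v set" and V :: "'v set" and B :: nat
  assumes finV: "finite V" and NV: "\<And>x. N x \<subseteq> V" and deg: "\<And>x. x \<in> V \<Longrightarrow> card (N x) = B"
begin

definition excursions :: "'v \<Rightarrow> 'v list \<Rightarrow> 'v set \<Rightarrow> nat \<Rightarrow> real" where
  "excursions x st S m = (\<Sum>ys\<in>walks_from N x m. of_bool (excursion (x # st) S ys))"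

lemma finN: "finite (N x)"
  using finV NV finite_subset by blast

text \<open>The return to the parent is the only admissible step to a visited vertex. It is
  available as a step in \<open>N\<close> because consecutive members of \<open>x # st\<close> are
  neighbours.\<close>

lemma excursions_Suc:
  assumes "set st \<subseteq> S" "successively (\<lambda>x y. y \<in> N x) (x # st)"
  shows "excursions x st S (Suc m) =
    (\<Sum>y\<in>N x - S. excursions y (x # st) (insert y S) m) +
    (case st of [] \<Rightarrow> 0 | p # st' \<Rightarrow> excursions p st' S m)"
proof -
  let ?g = "\<lambda>y. \<Sum>ys\<in>walks_from N y m. (of_bool (excursion (x # st) S (y # ys)) :: real)"
  have "excursions x st S (Suc m) = (\<Sum>y\<in>N x. ?g y)"
    unfolding excursions_def by (rule sum_walks_from_Suc) (rule finN)
  also have "\<dots> = (\<Sum>y\<in>N x - S. ?g y) + (\<Sum>y\<in>N x \<inter> S. ?g y)"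
    using finN by (subst sum.union_disjoint[symmetric]) (auto simp: Un_Diff_Int)
  also have "(\<Sum>y\<in>N x - S. ?g y) = (\<Sum>y\<in>N x - S. excursions y (x # st) (insert y S) m)"
    by (intro sum.cong) (auto simp: excursions_def)
  also have "(\<Sum>y\<in>N x \<inter> S. ?g y) = (case st of [] \<Rightarrow> 0 | p # st' \<Rightarrow> excursions p st' S m)"
  proof (cases st)
    case Nil
    then show ?thesis by (auto intro!: sum.neutral)
  next
    case (Cons p st')
    have p: "p \<in> N x \<inter> S" using assms Cons by auto
    have "(\<Sum>y\<in>N x \<inter> S. ?g y) = (\<Sum>y\<in>N x \<inter> S. if y = p then excursions p st' S m else 0)"
      using Cons by (intro sum.cong) (auto simp: excursions_def)
    also have "\<dots> = excursions p st' S m" using p finN by simp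
    finally show ?thesis using Cons by simp
  qed
  finally show ?thesis .
qed

text \<open>A path of \<open>m\<close> steps from height \<open>length st\<close> to 0 has
  \<open>(m - length st) / 2\<close> up-steps, and \<open>ballot\<close> vanishes if this is not a
  natural number. Up-steps lead to new vertices and have at most \<open>B\<close> choices;
  down-steps have one.\<close>

lemma excursions_le:
  assumes "set st \<subseteq> S" "finite S" "x \<in> V" "set st \<subseteq> V" "B \<ge> 1" "successively (\<lambda>x y. y \<in> N x) (x # st)"
    "\<And>x y. y \<in> N x \<Longrightarrow> x \<in> N y" "x \<in> S"
  shows "excursions x st S m
           \<le> real (ballot m (length st)) * real B powr ((real m - real (length st)) / 2)"
  using assms
proof (induction m arbitrary: x st S)
  case 0
  then show ?case by (auto simp: excursions_def)
next
  case (Suc m)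
  define l where "l = length st"
  let ?e = "(real (Suc m) - real l) / 2"
  have "(\<Sum>y\<in>N x - S. excursions y (x # st) (insert y S) m)
      \<le> (\<Sum>y\<in>N x - S. real (ballot m (Suc l)) * real B powr ((real m - real (Suc l)) / 2))"
    unfolding l_def using Suc.prems NV[of x]
    by (intro sum_mono order_trans[OF Suc.IH]) auto
  also have "\<dots> = real (card (N x - S)) * (real (ballot m (Suc l)) * real B powr ((real m - real (Suc l)) / 2))"
    by simp
  also have "\<dots> \<le> real B * (real (ballot m (Suc l)) * real B powr ((real m - real (Suc l)) / 2))"
    using deg[OF \<open>x \<in> V\<close>] card_mono[OF finN, of "N x - S" x] by (intro mult_right_mono) auto
  also have "\<dots> = real (ballot m (Suc l)) * real B powr (1 + (real m - real (Suc l)) / 2)"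
    using Suc.prems by (simp add: powr_add)
  also have "1 + (real m - real (Suc l)) / 2 = ?e" by (simp add: field_simps)
  finally have 1: "(\<Sum>y\<in>N x - S. excursions y (x # st) (insert y S) m)
      \<le> real (ballot m (Suc l)) * real B powr ?e" .
  have 2: "(case st of [] \<Rightarrow> 0 | p # st' \<Rightarrow> excursions p st' S m)
      \<le> real (case l of 0 \<Rightarrow> 0 | Suc l' \<Rightarrow> ballot m l') * real B powr ?e"
  proof (cases st)
    case (Cons p st')
    then show ?thesis using Suc.prems by (auto simp: l_def intro!: order_trans[OF Suc.IH])
  qed (simp add: l_def)
  show ?case
    using 1 2 Suc.prems by (simp add: excursions_Suc l_def[symmetric] distrib_right)
qed

text \<open>At most \<open>K\<close> vertices are ever visited, so each up-step keeps at least
  \<open>B - K\<close> choices.\<close>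

lemma excursions_ge:
  assumes "set st \<subseteq> S" "finite S" "x \<in> V" "set st \<subseteq> V" "successively (\<lambda>x y. y \<in> N x) (x # st)"
    "\<And>x y. y \<in> N x \<Longrightarrow> x \<in> N y" "x \<in> S" "card S + m \<le> K" "K < B"
  shows "real (ballot m (length st)) * (real B - real K) powr ((real m - real (length st)) / 2)
           \<le> excursions x st S m"
  using assms
proof (induction m arbitrary: x st S)
  case 0
  then show ?case by (cases st) (auto simp: excursions_def)
next
  case (Suc m)
  define l where "l = length st"
  define c where "c = real B - real K"
  have c: "c > 0" using Suc.prems by (simp add: c_def)
  let ?e = "(real (Suc m) - real l) / 2"
  show ?case
  proof -
    have "real (ballot m (Suc l)) * c powr ?e
        = real (ballot m (Suc l)) * c powr (1 + (real m - real (Suc l)) / 2)"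
      by (simp add: field_simps)
    also have "\<dots> = c * (real (ballot m (Suc l)) * c powr ((real m - real (Suc l)) / 2))"
      using c by (simp add: powr_add)
    also have "\<dots> \<le> real (card (N x - S)) * (real (ballot m (Suc l)) * c powr ((real m - real (Suc l)) / 2))"
    proof (intro mult_right_mono)
      have "card (N x) - card S \<le> card (N x - S)" using Suc.prems by (intro diff_card_le_card_Diff) auto
      thus "c \<le> real (card (N x - S))" using deg[OF \<open>x \<in> V\<close>] Suc.prems by (simp add: c_def)
    qed (use c in simp)
    also have "\<dots> = (\<Sum>y\<in>N x - S. real (ballot m (Suc l)) * c powr ((real m - real (Suc l)) / 2))"
      by simp
    also have "\<dots> \<le> (\<Sum>y\<in>N x - S. excursions y (x # st) (insert y S) m)"
      unfolding l_def c_def using Suc.prems NV[of x]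
      by (intro sum_mono order_trans[OF _ Suc.IH]) (auto simp: card_insert_if)
    finally have 1: "real (ballot m (Suc l)) * c powr ?e
        \<le> (\<Sum>y\<in>N x - S. excursions y (x # st) (insert y S) m)" .
    have 2: "real (case l of 0 \<Rightarrow> 0 | Suc l' \<Rightarrow> ballot m l') * c powr ?e
        \<le> (case st of [] \<Rightarrow> 0 | p # st' \<Rightarrow> excursions p st' S m)"
    proof (cases st)
      case (Cons p st')
      then show ?thesis using Suc.prems
        by (auto simp: l_def c_def intro!: order_trans[OF _ Suc.IH])
    qed (simp add: l_def)
    show ?thesis
      using 1 2 Suc.prems by (simp add: excursions_Suc l_def[symmetric] c_def[symmetric] distrib_right)
  qed
qed

lemma card_double_trees:
  fixes k :: nat
  assumes sym: "\<And>x y. y \<in> N x \<Longrightarrow> x \<in> N y" and "B \<ge> 1"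
  defines "g \<equiv> real (card {xs \<in> walks V N k. double_tree xs})"
  shows "g \<le> real (card V) * (real (ballot k 0) * real B powr (real k / 2))"
    and "Suc k < B \<Longrightarrow> real (card V) * (real (ballot k 0) * (real B - real (Suc k)) powr (real k / 2)) \<le> g"
proof -
  have "g = (\<Sum>xs\<in>walks V N k. of_bool (double_tree xs))"
    unfolding g_def by (simp add: of_bool_def sum.If_cases finite_walks finN finV Int_def)
  also have "\<dots> = (\<Sum>x\<in>V. excursions x [] {x} k)"
    by (simp add: sum_walks finN finV excursions_def)
  finally have g: "g = (\<Sum>x\<in>V. excursions x [] {x} k)" .
  have "(\<Sum>x\<in>V. excursions x [] {x} k)
      \<le> (\<Sum>x\<in>V. real (ballot k (length ([] :: 'v list))) * real B powr ((real k - real (length ([] :: 'v list))) / 2))"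
    using assms by (intro sum_mono excursions_le) auto
  thus "g \<le> real (card V) * (real (ballot k 0) * real B powr (real k / 2))" by (simp add: g)
  assume "Suc k < B"
  hence "(\<Sum>x\<in>V. real (ballot k (length ([] :: 'v list))) * (real B - real (Suc k)) powr ((real k - real (length ([] :: 'v list))) / 2))
      \<le> (\<Sum>x\<in>V. excursions x [] {x} k)"
    using assms by (intro sum_mono excursions_ge) auto
  thus "real (card V) * (real (ballot k 0) * (real B - real (Suc k)) powr (real k / 2)) \<le> g"
    by (simp add: g)
qed

end

section \<open>Moments of the semicircle distribution\<close>

text \<open>Orthogonality of the Chebyshev polynomials of the second kind: for
  \<open>x = - 2 * cos t\<close>, the quotient \<open>(- 1) ^ l * sin ((l + 1) * t) / sin t\<close>
  is \<open>U_l (x / 2)\<close>, here paired with \<open>U_0\<close>. The value matches the base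
  case \<open>ballot 0 l\<close>.\<close>

lemma sin_product_integral:
  "((\<lambda>t. sin (real (Suc l) * t) * sin t) has_integral (if l = 0 then pi / 2 else 0)) {0..pi}"
proof (cases "l = 0")
  case True
  have "((\<lambda>t. sin t * sin t) has_integral ((pi / 2 - sin (2 * pi) / 4) - (0 / 2 - sin (2 * 0) / 4))) {0..pi}"
  proof (rule fundamental_theorem_of_calculus)
    fix t :: real assume "t \<in> {0..pi}"
    have "1 / 2 - (cos (2 * t) * 2) / 4 = sin t * sin t"
      unfolding cos_double_sin by (simp add: power2_eq_square field_simps)
    moreover have "((\<lambda>t. t / 2 - sin (2 * t) / 4) has_real_derivative (1 / 2 - (cos (2 * t) * 2) / 4)) (at t within {0..pi})"
      by (auto intro!: derivative_eq_intros)
    ultimately show "((\<lambda>t. t / 2 - sin (2 * t) / 4) has_vector_derivative sin t * sin t) (at t within {0..pi})"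
      by (simp add: has_real_derivative_iff_has_vector_derivative)
  qed simp
  then show ?thesis using True by simp
next
  case False
  \<comment> \<open>Antiderivative from \<open>2 * sin ((l + 1) * t) * sin t = cos (l * t) - cos ((l
    + 2) * t)\<close>; its first denominator is the reason for treating \<open>l = 0\<close>
    apart.\<close>
  let ?F = "\<lambda>t. sin (real l * t) / (2 * real l) - sin (real (l + 2) * t) / (2 * real (l + 2))"
  have "((\<lambda>t. sin (real (Suc l) * t) * sin t) has_integral (?F pi - ?F 0)) {0..pi}"
  proof (rule fundamental_theorem_of_calculus)
    fix t :: real assume "t \<in> {0..pi}"
    have "cos (real l * t) = cos (real (Suc l) * t) * cos t + sin (real (Suc l) * t) * sin t"
      by (subst cos_diff[symmetric]) (simp add: algebra_simps)
    moreover have "cos (real (l + 2) * t) = cos (real (Suc l) * t) * cos t - sin (real (Suc l) * t) * sin t"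
      by (subst cos_add[symmetric]) (simp add: algebra_simps)
    ultimately have "cos (real l * t) / 2 - cos (real (l + 2) * t) / 2 = sin (real (Suc l) * t) * sin t"
      by (simp only:) (simp add: field_simps)
    moreover have "(?F has_real_derivative (cos (real l * t) / 2 - cos (real (l + 2) * t) / 2)) (at t within {0..pi})"
    proof -
      have "((\<lambda>t. sin (c * t) / (2 * c)) has_real_derivative cos (c * t) / 2) (at t within {0..pi})"
        if "c \<noteq> 0" for c
        using that by (auto intro!: derivative_eq_intros)
      from DERIV_diff[OF this[of "real l"] this[of "real (l + 2)"]] show ?thesis using False by simp
    qed
    ultimately show "(?F has_vector_derivative sin (real (Suc l) * t) * sin t) (at t within {0..pi})"
      by (simp add: has_real_derivative_iff_has_vector_derivative)
  qed simp
  moreover have "?F pi - ?F 0 = 0" by (simp only: sin_npi mult_zero_right sin_zero)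
  ultimately show ?thesis using False by simp
qed

text \<open>Both sides satisfy the same recursion in \<open>m\<close>, by
  \<open>2 cos t sin ((l + 1) t) = sin ((l + 2) t) + sin (l t)\<close>. The sign comes from the increasing
  substitution \<open>x = - 2 cos t\<close>.\<close>
lemma ballot_integral:
  "((\<lambda>t. (- 2 * cos t) ^ m * ((- 1) ^ l * sin (real (Suc l) * t) * sin t))
      has_integral (pi / 2 * real (ballot m l))) {0..pi}"
proof (induction m arbitrary: l)
  case 0
  show ?case using has_integral_mult_right[OF sin_product_integral[of l], of "(- 1) ^ l"]
    by (simp add: mult.assoc if_distrib cong: if_cong)
next
  case (Suc m)
  let ?h = "\<lambda>l t. (- 2 * cos t) ^ m * ((- 1) ^ l * sin (real (Suc l) * t) * sin t)"
  let ?d = "\<lambda>t. case l of 0 \<Rightarrow> 0 | Suc l' \<Rightarrow> ?h l' t"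
  have "(?d has_integral (pi / 2 * real (case l of 0 \<Rightarrow> 0 | Suc l' \<Rightarrow> ballot m l'))) {0..pi}"
    using Suc by (cases l) auto
  from has_integral_add[OF Suc[of "Suc l"] this]
  have "((\<lambda>t. ?h (Suc l) t + ?d t) has_integral (pi / 2 * real (ballot (Suc m) l))) {0..pi}"
    by (simp add: distrib_left)
  moreover have "?h (Suc l) t + ?d t
      = (- 2 * cos t) ^ Suc m * ((- 1) ^ l * sin (real (Suc l) * t) * sin t)" for t
  proof -
    have s: "sin (real (Suc (Suc l)) * t) + sin (real l * t) = 2 * cos t * sin (real (Suc l) * t)"
    proof -
      have "sin (real (Suc (Suc l)) * t) = sin (real (Suc l) * t) * cos t + cos (real (Suc l) * t) * sin t"
        by (subst sin_add[symmetric]) (simp add: algebra_simps)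
      moreover have "sin (real l * t) = sin (real (Suc l) * t) * cos t - cos (real (Suc l) * t) * sin t"
        by (subst sin_diff[symmetric]) (simp add: algebra_simps)
      ultimately show ?thesis by simp
    qed
    have d: "?d t = (- 2 * cos t) ^ m * (- ((- 1) ^ l) * sin (real l * t) * sin t)"
      by (cases l) auto
    have "?h (Suc l) t + ?d t = (- 2 * cos t) ^ m * (- ((- 1) ^ l) * sin t)
        * (sin (real (Suc (Suc l)) * t) + sin (real l * t))"
      unfolding d by (simp add: algebra_simps)
    thus ?thesis unfolding s by (simp add: algebra_simps)
  qed
  ultimately show ?case by simp
qed

text \<open>\<open>ballot k 0\<close> counts Dyck paths of length \<open>k\<close>, so it is a
  Catalan number for even \<open>k\<close> and 0 for odd \<open>k\<close>. The substitution
  \<open>x = - 2 * cos t\<close> turns the square root into \<open>2 * sin t\<close> and reduces the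
  moment to the case \<open>l = 0\<close> of \<open>ballot_integral\<close>.\<close>

lemma semicircle_moment:
  shows "integrable semicircle (\<lambda>x. x ^ k)" and "(\<integral>x. x ^ k \<partial>semicircle) = real (ballot k 0)"
proof -
  let ?w = "\<lambda>x::real. 1 / (2 * pi) * sqrt (4 - x\<^sup>2)"
  let ?d = "\<lambda>x::real. ?w x * indicator {-2..2} x"
  let ?f = "\<lambda>x::real. ?w x * x ^ k"
  let ?g = "\<lambda>t. - 2 * cos t :: real"
  have pos: "AE x in lborel. 0 \<le> ?d x"
  proof (rule AE_I2)
    fix x :: real
    have "x\<^sup>2 \<le> 4" if "x \<in> {-2..2}" using that abs_le_square_iff[of x 2] by auto
    thus "0 \<le> ?d x" by (auto simp: indicator_def)
  qed
  have "continuous_on {?g 0..?g pi} ?f" by (intro continuous_intros) auto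
  hence int: "set_integrable lborel {?g 0..?g pi} ?f" by (rule borel_integrable_atLeastAtMost')
  hence int': "integrable lborel (\<lambda>x. ?d x * x ^ k)"
    by (simp add: set_integrable_def mult_ac)
  show "integrable semicircle (\<lambda>x. x ^ k)"
    unfolding semicircle_def using pos int' by (subst integrable_real_density) auto
  have "(\<integral>x. x ^ k \<partial>semicircle) = (LBINT x. ?d x * x ^ k)"
    unfolding semicircle_def using pos by (subst integral_real_density) auto
  also have "\<dots> = (LBINT x. ?f x * indicator {?g 0..?g pi} x)"
    by (simp add: mult_ac)
  also have "\<dots> = (LBINT t. ?f (?g t) * (2 * sin t) * indicator {0..pi} t)"
    by (rule integral_substitution(2)[where g = ?g, OF int])
      (auto intro!: derivative_eq_intros continuous_intros simp: sin_ge_zero)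
  also have "\<dots> = (LBINT t:{0..pi}. ?f (?g t) * (2 * sin t))"
    by (simp add: set_lebesgue_integral_def mult_ac)
  also have "\<dots> = integral {0..pi} (\<lambda>t. ?f (?g t) * (2 * sin t))"
    by (intro set_borel_integral_eq_integral borel_integrable_atLeastAtMost' continuous_intros)
  also have "\<dots> = integral {0..pi} (\<lambda>t. 2 / pi * (?g t ^ k * ((- 1) ^ 0 * sin (real (Suc 0) * t) * sin t)))"
  proof (rule integral_cong)
    fix t :: real assume t: "t \<in> {0..pi}"
    have "4 - (?g t)\<^sup>2 = (2 * sin t)\<^sup>2" by (simp add: power_mult_distrib sin_squared_eq)
    hence "sqrt (4 - (?g t)\<^sup>2) = \<bar>2 * sin t\<bar>" by (simp only: real_sqrt_abs)
    hence "sqrt (4 - (?g t)\<^sup>2) = 2 * sin t" using t sin_ge_zero[of t] by simp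
    thus "?f (?g t) * (2 * sin t) = 2 / pi * (?g t ^ k * ((- 1) ^ 0 * sin (real (Suc 0) * t) * sin t))"
      by (simp add: field_simps)
  qed
  also have "\<dots> = 2 / pi * (pi / 2 * real (ballot k 0))"
    using has_integral_mult_right[OF ballot_integral[of k 0], of "2 / pi"] by (rule integral_unique)
  finally show "(\<integral>x. x ^ k \<partial>semicircle) = real (ballot k 0)" by simp
qed

section \<open>Spectral moments of real symmetric matrices\<close>

text \<open>The factorisation exists over the complex numbers; its roots are eigenvalues and
  therefore real, because the Hermitian form of a real symmetric matrix takes real values.\<close>

lemma real_symmetric_char_poly_splits:
  fixes A :: "real mat"
  assumes A: "A \<in> carrier_mat n n" and sym: "\<And>i j. i < n \<Longrightarrow> j < n \<Longrightarrow> A $$ (i, j) = A $$ (j, i)"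
  shows "\<exists>es. char_poly A = (\<Prod>e\<leftarrow>es. [:- e, 1:]) \<and> length es = n"
proof -
  let ?h = "complex_of_real"
  let ?B = "map_mat ?h A"
  have B: "?B \<in> carrier_mat n n" using A by simp
  obtain as where as: "char_poly ?B = (\<Prod>a\<leftarrow>as. [:- a, 1:])" "length as = n"
    using char_poly_factorized[OF B] by blast
  have real: "a \<in> \<real>" if "a \<in> set as" for a
  proof -
    have "poly (char_poly ?B) a = 0" unfolding as(1) using that
      by (auto simp: poly_prod_list prod_list_zero_iff image_iff)
    hence "eigenvalue ?B a" using eigenvalue_root_char_poly[OF B] by simp
    then obtain v where v: "v \<in> carrier_vec n" "v \<noteq> 0\<^sub>v n" "?B *\<^sub>v v = a \<cdot>\<^sub>v v"
      using B unfolding eigenvalue_def eigenvector_def by auto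
    have ent: "(\<Sum>j<n. ?h (A $$ (i, j)) * v $ j) = a * v $ i" if "i < n" for i
    proof -
      have "(?B *\<^sub>v v) $ i = (\<Sum>j<n. ?h (A $$ (i, j)) * v $ j)"
        using A v(1) that by (auto simp: scalar_prod_def atLeast0LessThan intro!: sum.cong)
      thus ?thesis using v that by simp
    qed
    \<comment> \<open>\<open>?q\<close> is the Hermitian form at \<open>v\<close> and
      \<open>?s\<close> the squared norm of \<open>v\<close>. Both are fixed by conjugation, so
      \<open>?q = a * ?s\<close> with \<open>?s\<close> nonzero makes \<open>a\<close> real.\<close>
    let ?q = "\<Sum>i<n. cnj (v $ i) * (\<Sum>j<n. ?h (A $$ (i, j)) * v $ j)"
    let ?s = "\<Sum>i<n. cnj (v $ i) * v $ i"
    have "?q = (\<Sum>i<n. cnj (v $ i) * (a * v $ i))" by (intro sum.cong refl) (simp add: ent)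
    hence q: "?q = a * ?s" by (simp add: sum_distrib_left mult_ac)
    have q': "cnj ?q = ?q"
    proof -
      have "cnj ?q = (\<Sum>i<n. \<Sum>j<n. v $ i * (?h (A $$ (i, j)) * cnj (v $ j)))"
        by (simp add: sum_distrib_left)
      also have "\<dots> = (\<Sum>j<n. \<Sum>i<n. v $ i * (?h (A $$ (i, j)) * cnj (v $ j)))" by (rule sum.swap)
      also have "\<dots> = ?q"
        unfolding sum_distrib_left using sym by (intro sum.cong refl) (simp add: mult_ac)
      finally show ?thesis .
    qed
    have s: "cnj ?s = ?s" by (simp add: mult.commute)
    have s0: "?s \<noteq> 0"
    proof -
      obtain i where i: "i < n" "v $ i \<noteq> 0" using v by (metis carrier_vecD eq_vecI index_zero_vec)
      have "?s = ?h (\<Sum>i<n. (cmod (v $ i))\<^sup>2)"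
        unfolding of_real_sum complex_norm_square by (simp add: mult.commute)
      moreover have "(\<Sum>i<n. (cmod (v $ i))\<^sup>2) > 0"
        using i by (intro sum_pos2[of _ i]) auto
      ultimately show ?thesis by (metis less_irrefl of_real_eq_0_iff)
    qed
    have "cnj a * ?s = cnj ?q" unfolding q complex_cnj_mult s ..
    also have "\<dots> = a * ?s" using q q' by simp
    finally have "cnj a = a" using mult_right_cancel[OF s0] by blast
    thus ?thesis by (simp add: Reals_cnj_iff)
  qed
  define es where "es = map Re as"
  have "map ?h es = as" unfolding es_def using real by (auto intro!: map_idI simp: o_def)
  interpret poly_hom: map_poly_comm_ring_hom ?h ..
  have "map_poly ?h (\<Prod>e\<leftarrow>fs. [:- e, 1:]) = (\<Prod>e\<leftarrow>fs. [:- ?h e, 1:])" for fs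
    by (induction fs) (simp_all add: poly_hom.hom_mult map_poly_pCons del: mult_pCons_left)
  hence "map_poly ?h (\<Prod>e\<leftarrow>es. [:- e, 1:]) = (\<Prod>a\<leftarrow>map ?h es. [:- a, 1:])"
    by (simp add: o_def)
  also have "\<dots> = (\<Prod>a\<leftarrow>as. [:- a, 1:])" by (simp only: \<open>map ?h es = as\<close>)
  also have "\<dots> = map_poly ?h (char_poly A)"
  proof -
    have "char_poly ?B = map_poly ?h (char_poly A)" by (rule of_real_hom.char_poly_hom[OF A])
    thus ?thesis using as(1) by simp
  qed
  finally have "map_poly ?h (\<Prod>e\<leftarrow>es. [:- e, 1:]) = map_poly ?h (char_poly A)" .
  hence "char_poly A = (\<Prod>e\<leftarrow>es. [:- e, 1:])"
    by (simp add: poly_eq_iff coeff_map_poly)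
  moreover have "length es = n" using as(2) by (simp add: es_def)
  ultimately show ?thesis by blast
qed

lemma upper_triangular_pow:
  fixes B :: "'a :: comm_semiring_1 mat"
  assumes B: "B \<in> carrier_mat n n" and ut: "upper_triangular B"
  shows "upper_triangular (B ^\<^sub>m k) \<and> (\<forall>i<n. (B ^\<^sub>m k) $$ (i, i) = (B $$ (i, i)) ^ k)"
proof (induction k)
  case 0
  then show ?case using B by auto
next
  case (Suc k)
  let ?P = "B ^\<^sub>m k"
  have P: "?P \<in> carrier_mat n n" using B by simp
  have ent: "(?P * B) $$ (i, j) = (\<Sum>l<n. ?P $$ (i, l) * B $$ (l, j))" if "i < n" "j < n" for i j
    using that B P by (auto simp: scalar_prod_def atLeast0LessThan intro!: sum.cong)
  have z: "?P $$ (i, l) * B $$ (l, j) = 0" if "i < n" "j < n" "l < n" "l < i \<or> j < l" for i j l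
    using that Suc ut P B by (auto simp: upper_triangular_def)
  have "(?P * B) $$ (i, j) = 0" if "i < n" "j < i" for i j
    using ent[of i j] z[of i j] that by (auto intro!: sum.neutral) (metis linorder_neqE_nat order_less_trans)
  moreover have "(?P * B) $$ (i, i) = B $$ (i, i) ^ Suc k" if i: "i < n" for i
  proof -
    have "(?P * B) $$ (i, i) = (\<Sum>l<n. if l = i then ?P $$ (i, i) * B $$ (i, i) else 0)"
      unfolding ent[OF i i] using z[OF i i] by (intro sum.cong) (auto simp: neq_iff)
    thus ?thesis using i Suc by (simp add: mult.commute)
  qed
  ultimately show ?case using B P by (auto simp: upper_triangular_def)
qed

lemma trace_mult_comm:
  fixes A B :: "'a :: comm_semiring_1 mat"
  assumes "A \<in> carrier_mat n n" "B \<in> carrier_mat n n"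
  shows "(\<Sum>i<n. (A * B) $$ (i, i)) = (\<Sum>i<n. (B * A) $$ (i, i))"
proof -
  have "(\<Sum>i<n. (A * B) $$ (i, i)) = (\<Sum>i<n. \<Sum>j<n. A $$ (i, j) * B $$ (j, i))"
    using assms by (intro sum.cong) (auto simp: scalar_prod_def atLeast0LessThan intro!: sum.cong)
  also have "\<dots> = (\<Sum>j<n. \<Sum>i<n. A $$ (i, j) * B $$ (j, i))" by (rule sum.swap)
  also have "\<dots> = (\<Sum>i<n. (B * A) $$ (i, i))"
    using assms by (intro sum.cong) (auto simp: scalar_prod_def atLeast0LessThan mult.commute intro!: sum.cong)
  finally show ?thesis .
qed

text \<open>Since the characteristic polynomial splits, a real Schur form with the roots on its
  diagonal is available. Powers keep it triangular, and the trace is invariant under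
  similarity.\<close>

lemma sum_eigenvalue_power:
  fixes A :: "real mat"
  assumes A: "A \<in> carrier_mat n n" and sym: "\<And>i j. i < n \<Longrightarrow> j < n \<Longrightarrow> A $$ (i, j) = A $$ (j, i)"
  shows "length (eigenvalue_list A) = n"
    and "(\<Sum>i<n. (eigenvalue_list A ! i) ^ k) = (\<Sum>i<n. (A ^\<^sub>m k) $$ (i, i))"
proof -
  obtain es where es: "char_poly A = (\<Prod>e\<leftarrow>es. [:- e, 1:])" "length es = n"
    using real_symmetric_char_poly_splits[OF A sym] by blast
  have "proots (\<Prod>e\<leftarrow>es. [:- e, 1:]) = mset es"
  proof (induction es)
    case (Cons e es)
    have "(\<Prod>e\<leftarrow>es. [:- e, 1:]) \<noteq> (0 :: real poly)" by (auto simp: prod_list_zero_iff)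
    hence "proots ([:- e, 1:] * (\<Prod>e\<leftarrow>es. [:- e, 1:])) = proots [:- e, 1:] + proots (\<Prod>e\<leftarrow>es. [:- e, 1:])"
      by (intro proots_mult) auto
    thus ?case using Cons by simp
  qed simp
  hence m: "mset (eigenvalue_list A) = mset es" by (simp add: eigenvalue_list_def es)
  thus len: "length (eigenvalue_list A) = n" using es(2) mset_eq_length by blast
  obtain B P Q where BPQ: "schur_decomposition A es = (B, P, Q)" by (cases "schur_decomposition A es")
  note S = schur_decomposition[OF A es(1) BPQ]
  have wit: "similar_mat_wit A B P Q" using S by simp
  hence c: "B \<in> carrier_mat n n" "P \<in> carrier_mat n n" "Q \<in> carrier_mat n n" "Q * P = 1\<^sub>m n"
    using A unfolding similar_mat_wit_def Let_def by auto
  have Bk: "B ^\<^sub>m k \<in> carrier_mat n n" using c by simp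
  have "(\<Sum>i<n. (A ^\<^sub>m k) $$ (i, i)) = (\<Sum>i<n. (P * (B ^\<^sub>m k * Q)) $$ (i, i))"
    using similar_mat_wit_pow_id[OF wit, of k] c Bk by (simp add: assoc_mult_mat[of P n n])
  also have "\<dots> = (\<Sum>i<n. ((B ^\<^sub>m k * Q) * P) $$ (i, i))"
    using c Bk by (intro trace_mult_comm) auto
  also have "(B ^\<^sub>m k * Q) * P = B ^\<^sub>m k" using c Bk by (simp add: assoc_mult_mat[of _ n n _ n _ n])
  also have "(\<Sum>i<n. (B ^\<^sub>m k) $$ (i, i)) = (\<Sum>i<n. (diag_mat B ! i) ^ k)"
    using upper_triangular_pow[of B n k] S c by (intro sum.cong) (auto simp: diag_mat_def)
  also have "\<dots> = sum_list (map (\<lambda>e. e ^ k) es)"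
    using S es(2) by (simp add: sum_list_sum_nth atLeast0LessThan)
  also have "\<dots> = sum_mset (image_mset (\<lambda>e. e ^ k) (mset es))" by (metis mset_map sum_mset_sum_list)
  also have "\<dots> = sum_list (map (\<lambda>e. e ^ k) (eigenvalue_list A))"
    unfolding m[symmetric] by (metis mset_map sum_mset_sum_list)
  also have "\<dots> = (\<Sum>i<n. (eigenvalue_list A ! i) ^ k)"
    using len by (simp add: sum_list_sum_nth atLeast0LessThan)
  finally show "(\<Sum>i<n. (eigenvalue_list A ! i) ^ k) = (\<Sum>i<n. (A ^\<^sub>m k) $$ (i, i))" by simp
qed

lemma integral_esd:
  fixes f :: "real \<Rightarrow> real"
  assumes "f \<in> borel_measurable borel" "dim_row A = n"
  shows "(\<integral>x. f x \<partial>esd A) = (\<Sum>i<n. f (eigenvalue_list A ! i)) / real n"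
proof -
  have "(\<integral>x. f x \<partial>esd A) = (\<integral>i. f (eigenvalue_list A ! i) \<partial>uniform_count_measure {..<n})"
    unfolding esd_def assms(2) using assms(1)
    by (intro integral_distr) (auto simp: measurable_def space_uniform_count_measure sets_uniform_count_measure)
  also have "\<dots> = (\<Sum>i<n. f (eigenvalue_list A ! i)) / real n"
    by (simp add: uniform_count_measure_def lebesgue_integral_point_measure_finite sum_divide_distrib)
  finally show ?thesis .
qed

section \<open>The method of moments\<close>

text \<open>A deterministic and non-asymptotic form of the method of moments, uniform in
  \<open>n\<close> and in the points: \<open>K\<close> and \<open>\<delta>\<close> depend only on
  \<open>f\<close>, its bound and \<open>e\<close>. It can therefore be used both for single
  outcomes and inside probabilities. Points far from the support are controlled by one high even
  moment.\<close>

lemma moment_criterion: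
  fixes f :: "real \<Rightarrow> real"
  assumes cont: "continuous_on UNIV f" and bnd: "\<And>x. \<bar>f x\<bar> \<le> Bd" and e: "e > 0"
  shows "\<exists>K \<delta>. \<delta> > 0 \<and> (\<forall>n\<ge>1. \<forall>\<mu>.
    (\<forall>k\<le>K. \<bar>(\<Sum>i<n. \<mu> i ^ k) / real n - real (ballot k 0)\<bar> \<le> \<delta>) \<longrightarrow>
    \<bar>(\<Sum>i<n. f (\<mu> i)) / real n - (\<integral>x. f x \<partial>semicircle)\<bar> \<le> e)"
proof -
  have Bd: "Bd \<ge> 0" using bnd[of 0] by simp
  \<comment> \<open>The interval strictly contains the support \<open>[-2, 2]\<close>: beyond it
    even powers grow at least like \<open>9 ^ L\<close>, while the semicircle moments are at most
    \<open>4 ^ L\<close>.\<close>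
  obtain g where g: "real_polynomial_function g" "\<And>x. x \<in> {-3..3} \<Longrightarrow> \<bar>f x - g x\<bar> < e / 8"
    using Stone_Weierstrass_real_polynomial_function[of "{-3..3::real}" f "e / 8"] cont e
      continuous_on_subset by (metis compact_Icc subset_UNIV zero_less_divide_iff zero_less_numeral)
  obtain a d where gsum: "g = (\<lambda>x. \<Sum>i\<le>d. a i * x ^ i)"
    using g(1) real_polynomial_function_iff_sum by blast
  define A where "A = Bd + (\<Sum>i\<le>d. \<bar>a i\<bar>)"
  have A: "A \<ge> 0" "(\<Sum>i\<le>d. \<bar>a i\<bar>) \<le> A" using Bd by (auto simp: A_def sum_nonneg)
  have "(\<lambda>L. A * 9 ^ d * ((4 / 9) ^ L + (1 / 9) ^ L)) \<longlonglongrightarrow> A * 9 ^ d * (0 + 0)"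
    by (intro tendsto_intros LIMSEQ_power_zero) auto
  hence "\<forall>\<^sub>F L in sequentially. A * 9 ^ d * ((4 / 9) ^ L + (1 / 9) ^ L) < e / 8"
    using e by (intro order_tendstoD(2)[where a = "e / 8"]) auto
  then obtain L0 where L0: "\<And>L. L \<ge> L0 \<Longrightarrow> A * 9 ^ d * ((4 / 9) ^ L + (1 / 9) ^ L) < e / 8"
    by (auto simp: eventually_sequentially)
  define L where "L = max L0 d"
  \<comment> \<open>For \<open>\<bar>x\<bar> \<ge> 3\<close> the crude bound
    \<open>A * \<bar>x\<bar> ^ (2 * d)\<close> is at most \<open>c * x ^ (2 * L)\<close>. Moments of
    order \<open>2 * L\<close> are at most \<open>4 ^ L + 1\<close>, where 1 allows for the
    deviation of the empirical moment, so \<open>c * (4 ^ L + 1)\<close> bounds the tail.\<close>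
  define c where "c = A * 9 ^ d / 9 ^ L"
  have c0: "c \<ge> 0" using A by (simp add: c_def)
  have c: "c * (4 ^ L + 1) \<le> e / 8"
    using L0[of L] by (simp add: L_def c_def power_divide field_simps)
  have far: "\<bar>f x - g x\<bar> \<le> e / 8 + c * x ^ (2 * L)" for x
  proof (cases "x \<in> {-3..3}")
    case True
    have "0 \<le> c * x ^ (2 * L)" using c0 by (intro mult_nonneg_nonneg zero_le_even_power) auto
    then show ?thesis using g(2)[OF True] by linarith
  next
    case False
    hence x: "\<bar>x\<bar> \<ge> 3" by auto
    have "\<bar>g x\<bar> \<le> (\<Sum>i\<le>d. \<bar>a i\<bar> * \<bar>x\<bar> ^ i)"
      unfolding gsum by (rule order_trans[OF sum_abs]) (simp add: abs_mult power_abs)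
    also have "\<dots> \<le> (\<Sum>i\<le>d. \<bar>a i\<bar> * \<bar>x\<bar> ^ (2 * d))"
      using x by (intro sum_mono mult_left_mono power_increasing) auto
    finally have "\<bar>g x\<bar> \<le> (\<Sum>i\<le>d. \<bar>a i\<bar>) * \<bar>x\<bar> ^ (2 * d)" by (simp add: sum_distrib_right)
    moreover have "\<bar>f x\<bar> \<le> Bd * \<bar>x\<bar> ^ (2 * d)"
      using bnd[of x] Bd x mult_left_mono[OF one_le_power[of "\<bar>x\<bar>" "2 * d"], of Bd] by linarith
    ultimately have fg: "\<bar>f x - g x\<bar> \<le> A * \<bar>x\<bar> ^ (2 * d)" by (simp add: A_def distrib_right)
    have "\<bar>x\<bar> ^ (2 * d) * 9 ^ (L - d) \<le> \<bar>x\<bar> ^ (2 * d) * (\<bar>x\<bar>\<^sup>2) ^ (L - d)"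
      using power_mono[OF x, of 2] by (intro mult_left_mono power_mono) auto
    also have "\<dots> = x ^ (2 * L)"
    proof -
      have "2 * d + 2 * (L - d) = 2 * L" by (simp add: L_def)
      thus ?thesis by (simp only: power_mult[symmetric] power_add[symmetric]) (simp add: power_even_abs)
    qed
    finally have "A * \<bar>x\<bar> ^ (2 * d) \<le> A * (x ^ (2 * L) / 9 ^ (L - d))"
      using A by (intro mult_left_mono) (simp_all add: field_simps)
    also have "\<dots> = c * x ^ (2 * L)"
      by (simp add: c_def L_def power_diff)
    finally show ?thesis using fg e by simp
  qed
  note M = semicircle_moment
  have int1: "integrable semicircle (\<lambda>_. 1 :: real)" using M(1)[of 0] by simp
  have [measurable]: "f \<in> borel_measurable borel" using cont by (rule borel_measurable_continuous_onI)
  have sets: "sets semicircle = sets borel" by (simp add: semicircle_def)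
  have intf: "integrable semicircle f"
  proof (rule Bochner_Integration.integrable_bound)
    show "integrable semicircle (\<lambda>_. Bd * 1)" by (intro integrable_mult_right int1)
    show "f \<in> borel_measurable semicircle" using sets by (simp cong: measurable_cong_sets)
  qed (use bnd Bd in auto)
  have intg: "integrable semicircle g" unfolding gsum by (intro Bochner_Integration.integrable_sum integrable_mult_right M)
  have Ig: "(\<integral>x. g x \<partial>semicircle) = (\<Sum>i\<le>d. a i * real (ballot i 0))"
    unfolding gsum by (subst Bochner_Integration.integral_sum) (auto simp: M intro!: integrable_mult_right)
  have int2: "integrable semicircle (\<lambda>x. e / 8 * x ^ 0 + c * x ^ (2 * L))"
    by (intro Bochner_Integration.integrable_add integrable_mult_right M)
  have "\<bar>(\<integral>x. f x \<partial>semicircle) - (\<integral>x. g x \<partial>semicircle)\<bar> = \<bar>\<integral>x. f x - g x \<partial>semicircle\<bar>"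
    by (simp add: intf intg)
  also have "\<dots> \<le> (\<integral>x. \<bar>f x - g x\<bar> \<partial>semicircle)" by (rule integral_abs_bound)
  also have "\<dots> \<le> (\<integral>x. e / 8 * x ^ 0 + c * x ^ (2 * L) \<partial>semicircle)"
    using far by (intro integral_mono int2 integrable_abs Bochner_Integration.integrable_diff intf intg) auto
  also have "\<dots> = e / 8 + c * real (ballot (2 * L) 0)"
  proof -
    have "(\<integral>x. e / 8 * x ^ 0 + c * x ^ (2 * L) \<partial>semicircle)
        = (\<integral>x. e / 8 * x ^ 0 \<partial>semicircle) + (\<integral>x. c * x ^ (2 * L) \<partial>semicircle)"
      by (intro Bochner_Integration.integral_add integrable_mult_right M)
    also have "\<dots> = e / 8 * real (ballot 0 0) + c * real (ballot (2 * L) 0)"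
      by (simp only: integral_mult_right_zero M(2))
    finally show ?thesis by simp
  qed
  also have "c * real (ballot (2 * L) 0) \<le> c * (4 ^ L + 1)"
    by (intro mult_left_mono c0 order_trans[OF ballot_even_le]) simp
  finally have semi: "\<bar>(\<integral>x. f x \<partial>semicircle) - (\<Sum>i\<le>d. a i * real (ballot i 0))\<bar> \<le> e / 4"
    using c Ig by simp
  \<comment> \<open>The bound 1 serves the moment of order \<open>2 * L\<close> in the tail; the
    other bound serves the polynomial \<open>g\<close>, whose coefficients have absolute sum at most
    \<open>A\<close>.\<close>
  define \<delta> where "\<delta> = min 1 (e / (8 * (1 + A)))"
  have \<delta>: "\<delta> > 0" "\<delta> \<le> 1" "A * \<delta> \<le> e / 8"
  proof -
    show "\<delta> > 0" "\<delta> \<le> 1" using A e by (auto simp: \<delta>_def)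
    have "A * \<delta> \<le> A * (e / (8 * (1 + A)))" using A by (intro mult_left_mono) (auto simp: \<delta>_def)
    also have "\<dots> \<le> e / 8" using A e by (simp add: field_simps)
    finally show "A * \<delta> \<le> e / 8" .
  qed
  show ?thesis
  proof (intro exI[of _ "2 * L"] exI[of _ \<delta>] conjI \<delta> allI impI)
    fix n :: nat and \<mu> :: "nat \<Rightarrow> real"
    assume n: "1 \<le> n" and mom: "\<forall>k\<le>2 * L. \<bar>(\<Sum>i<n. \<mu> i ^ k) / real n - real (ballot k 0)\<bar> \<le> \<delta>"
    have "\<bar>(\<Sum>i<n. f (\<mu> i)) / real n - (\<Sum>i<n. g (\<mu> i)) / real n\<bar> = \<bar>\<Sum>i<n. f (\<mu> i) - g (\<mu> i)\<bar> / real n"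
      by (simp add: sum_subtractf diff_divide_distrib[symmetric])
    also have "\<dots> \<le> (\<Sum>i<n. e / 8 + c * \<mu> i ^ (2 * L)) / real n"
      by (intro divide_right_mono order_trans[OF sum_abs] sum_mono far) auto
    also have "\<dots> = e / 8 + c * ((\<Sum>i<n. \<mu> i ^ (2 * L)) / real n)"
      using n by (simp add: sum.distrib sum_distrib_left add_divide_distrib)
    also have "c * ((\<Sum>i<n. \<mu> i ^ (2 * L)) / real n) \<le> c * (4 ^ L + 1)"
    proof (intro mult_left_mono c0)
      show "(\<Sum>i<n. \<mu> i ^ (2 * L)) / real n \<le> 4 ^ L + 1"
        using mom[rule_format, of "2 * L"] \<delta>(2) ballot_even_le[of L] by linarith
    qed
    finally have 1: "\<bar>(\<Sum>i<n. f (\<mu> i)) / real n - (\<Sum>i<n. g (\<mu> i)) / real n\<bar> \<le> e / 4" using c by simp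
    have "(\<Sum>i<n. g (\<mu> i)) = (\<Sum>k\<le>d. a k * (\<Sum>i<n. \<mu> i ^ k))"
      unfolding gsum by (subst sum.swap) (simp add: sum_distrib_left)
    hence "(\<Sum>i<n. g (\<mu> i)) / real n = (\<Sum>k\<le>d. a k * ((\<Sum>i<n. \<mu> i ^ k) / real n))"
      by (simp only: sum_divide_distrib[of _ "{..d}"] times_divide_eq_right)
    hence "(\<Sum>i<n. g (\<mu> i)) / real n - (\<Sum>k\<le>d. a k * real (ballot k 0))
        = (\<Sum>k\<le>d. a k * ((\<Sum>i<n. \<mu> i ^ k) / real n - real (ballot k 0)))"
      by (simp only: right_diff_distrib sum_subtractf)
    also have "\<bar>\<dots>\<bar> \<le> (\<Sum>k\<le>d. \<bar>a k\<bar> * \<delta>)"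
    proof (rule order_trans[OF sum_abs], intro sum_mono)
      fix k assume "k \<in> {..d}"
      hence "\<bar>(\<Sum>i<n. \<mu> i ^ k) / real n - real (ballot k 0)\<bar> \<le> \<delta>"
        using mom by (auto simp: L_def)
      thus "\<bar>a k * ((\<Sum>i<n. \<mu> i ^ k) / real n - real (ballot k 0))\<bar> \<le> \<bar>a k\<bar> * \<delta>"
        unfolding abs_mult by (intro mult_left_mono) auto
    qed
    also have "\<dots> \<le> A * \<delta>" using A(2) \<delta>(1) by (simp add: sum_distrib_right[symmetric])
    finally have 2: "\<bar>(\<Sum>i<n. g (\<mu> i)) / real n - (\<Sum>k\<le>d. a k * real (ballot k 0))\<bar> \<le> e / 8"
      using \<delta>(3) by linarith
    show "\<bar>(\<Sum>i<n. f (\<mu> i)) / real n - (\<integral>x. f x \<partial>semicircle)\<bar> \<le> e"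
      using 1 2 semi e by linarith
  qed
qed

text \<open>Measurability of \<open>\<integral>f d\<sigma>\<^sub>n\<close> follows from that of the moments, since \<open>f\<close> is a locally uniform
  limit of polynomials.\<close>
lemma measurable_eigenvalue_average:
  fixes f :: "real \<Rightarrow> real" and \<mu> :: "'w \<Rightarrow> nat \<Rightarrow> real"
  assumes cont: "continuous_on UNIV f"
    and mom: "\<And>k. (\<lambda>\<omega>. \<Sum>i<n. \<mu> \<omega> i ^ k) \<in> borel_measurable M"
  shows "(\<lambda>\<omega>. (\<Sum>i<n. f (\<mu> \<omega> i)) / real n) \<in> borel_measurable M"
proof -
  have "\<exists>g. real_polynomial_function g \<and> (\<forall>x\<in>{- real j..real j}. \<bar>f x - g x\<bar> < 1 / real (Suc j))" for j
    using Stone_Weierstrass_real_polynomial_function[of "{- real j..real j}" f "1 / real (Suc j)"]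
      continuous_on_subset[OF cont] by (metis compact_Icc of_nat_0_less_iff subset_UNIV zero_less_Suc zero_less_divide_1_iff)
  then obtain g where g: "\<And>j. real_polynomial_function (g j)"
    "\<And>j x. x \<in> {- real j..real j} \<Longrightarrow> \<bar>f x - g j x\<bar> < 1 / real (Suc j)" by metis
  have "(\<lambda>j. g j x) \<longlonglongrightarrow> f x" for x
  proof (rule LIMSEQ_I)
    fix r :: real assume "r > 0"
    obtain j0 where j0: "1 / real (Suc j0) < r" using \<open>r > 0\<close> nat_approx_posE by blast
    obtain j1 :: nat where j1: "\<bar>x\<bar> \<le> real j1" using real_arch_simple by blast
    have "norm (g j x - f x) < r" if "j \<ge> max j0 j1" for j
    proof -
      have "\<bar>f x - g j x\<bar> < 1 / real (Suc j)" using that j1 by (intro g) auto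
      also have "\<dots> \<le> 1 / real (Suc j0)" using that by (simp add: field_simps)
      finally show ?thesis using j0 by (simp add: abs_minus_commute)
    qed
    thus "\<exists>no. \<forall>j\<ge>no. norm (g j x - f x) < r" by blast
  qed
  hence lim: "(\<lambda>j. (\<Sum>i<n. g j (\<mu> \<omega> i)) / real n) \<longlonglongrightarrow> (\<Sum>i<n. f (\<mu> \<omega> i)) / real n" for \<omega>
    by (cases "n = 0") (auto intro!: tendsto_intros)
  show ?thesis
  proof (rule borel_measurable_LIMSEQ_real[OF lim])
    fix j
    obtain a d where gsum: "g j = (\<lambda>x. \<Sum>i\<le>d. a i * x ^ i)"
      using g(1)[of j] real_polynomial_function_iff_sum by blast
    have "(\<lambda>\<omega>. (\<Sum>i<n. g j (\<mu> \<omega> i)) / real n) = (\<lambda>\<omega>. (\<Sum>k\<le>d. a k * (\<Sum>i<n. \<mu> \<omega> i ^ k)) / real n)"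
      unfolding gsum by (subst sum.swap) (simp add: sum_distrib_left)
    also have "\<dots> \<in> borel_measurable M" using mom by measurable
    finally show "(\<lambda>\<omega>. (\<Sum>i<n. g j (\<mu> \<omega> i)) / real n) \<in> borel_measurable M" .
  qed
qed

section \<open>Random weights on closed walks\<close>

definition edges_in :: "'v set \<Rightarrow> 'v set set" where
  "edges_in V = {{p, q} | p q. p \<in> V \<and> q \<in> V}"

definition edge_prod :: "('e \<Rightarrow> 'w \<Rightarrow> real) \<Rightarrow> 'e list \<Rightarrow> 'w \<Rightarrow> real" where
  "edge_prod Y es \<omega> = prod_list (map (\<lambda>e. Y e \<omega>) es)"

lemma edge_prod_simps [simp]:
  "edge_prod Y [] \<omega> = 1" "edge_prod Y (e # es) \<omega> = Y e \<omega> * edge_prod Y es \<omega>"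
  "edge_prod Y (es @ fs) \<omega> = edge_prod Y es \<omega> * edge_prod Y fs \<omega>"
  by (simp_all add: edge_prod_def)

lemma edge_prod_append: "edge_prod Y (es @ fs) = (\<lambda>\<omega>. edge_prod Y es \<omega> * edge_prod Y fs \<omega>)"
  by (rule ext) simp

lemma edge_prod_eq_prod: "edge_prod Y es \<omega> = (\<Prod>e\<in>set es. Y e \<omega> ^ count_list es e)"
proof (induction es)
  case (Cons x es)
  have *: "(\<Prod>e\<in>set (x # es). Y e \<omega> ^ count_list (x # es) e)
      = (\<Prod>e\<in>insert x (set es). (if e = x then Y e \<omega> else 1) * Y e \<omega> ^ count_list es e)"
    by (intro prod.cong) auto
  also have "\<dots> = Y x \<omega> * (\<Prod>e\<in>insert x (set es). Y e \<omega> ^ count_list es e)"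
    by (simp add: prod.distrib)
  also have "(\<Prod>e\<in>insert x (set es). Y e \<omega> ^ count_list es e) = (\<Prod>e\<in>set es. Y e \<omega> ^ count_list es e)"
    by (intro prod.mono_neutral_right) (auto simp: count_list_0_iff)
  finally show ?case using Cons by simp
qed simp

lemma edges_in_walk:
  assumes "set xs \<subseteq> V"
  shows "set (edges xs) \<subseteq> edges_in V"
proof
  fix e assume "e \<in> set (edges xs)"
  then obtain x y where "x \<in> set xs" "y \<in> set xs" "e = {x, y}" using edge_in_edges by blast
  thus "e \<in> edges_in V" using assms unfolding edges_in_def by blast
qed

lemma walks_from_subset:
  assumes "\<And>x. N x \<subseteq> V"
  shows "ys \<in> walks_from N x m \<Longrightarrow> set ys \<subseteq> V"
proof (induction m arbitrary: x ys)
  case (Suc m)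
  then obtain y ys' where "ys = y # ys'" "y \<in> N x" "ys' \<in> walks_from N y m" by auto
  then show ?case using Suc.IH[of ys' y] assms[of x] by auto
qed simp

lemma walks_subset:
  assumes "\<And>x. N x \<subseteq> V" "xs \<in> walks V N k"
  shows "set xs \<subseteq> V"
proof -
  obtain x ys where "xs = x # ys" "x \<in> V" "ys \<in> walks_from N x k"
    using assms(2) by (auto simp: walks_def)
  thus ?thesis using walks_from_subset[of N V, OF assms(1)] by auto
qed

text \<open>A regular graph with a random weight on each edge. Correlation bounds and independence
  enter as premises of the individual lemmas, so that almost uncorrelated and Wigner weights share
  the counting.\<close>

locale edge_variables = prob_space M for M :: "'w measure" +
  fixes V :: "'v set" and N :: "'v \<Rightarrow> 'v set" and B :: nat and Y :: "'v set \<Rightarrow> 'w \<Rightarrow> real"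
  assumes finV: "finite V" and NV: "\<And>x. N x \<subseteq> V" and N_out: "\<And>x. x \<notin> V \<Longrightarrow> N x = {}"
    and deg: "\<And>x. x \<in> V \<Longrightarrow> card (N x) = B" and sym: "\<And>x y. y \<in> N x \<Longrightarrow> x \<in> N y"
    and B1: "B \<ge> 1" and BV: "B \<le> card V"
    and moments: "\<And>e k. e \<in> edges_in V \<Longrightarrow> integrable M (\<lambda>\<omega>. Y e \<omega> ^ k)"
begin

abbreviation X :: "'v set list \<Rightarrow> 'w \<Rightarrow> real" where "X \<equiv> edge_prod Y"

definition closed_walks :: "nat \<Rightarrow> 'v list set" where
  "closed_walks k = {xs \<in> walks V N k. hd xs = last xs}"

definition tree_walks :: "nat \<Rightarrow> 'v list set" where
  "tree_walks k = {xs \<in> walks V N k. double_tree xs}"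

definition scale :: "nat \<Rightarrow> real" where
  "scale k = real (card V) * real B powr (real k / 2)"

definition moment :: "nat \<Rightarrow> 'w \<Rightarrow> real" where
  "moment k \<omega> = (\<Sum>xs\<in>closed_walks k. X (edges xs) \<omega>) / scale k"

definition tree_moment :: "nat \<Rightarrow> 'w \<Rightarrow> real" where
  "tree_moment k \<omega> = (\<Sum>xs\<in>tree_walks k. X (edges xs) \<omega>) / scale k"

definition rest_moment :: "nat \<Rightarrow> 'w \<Rightarrow> real" where
  "rest_moment k \<omega> = (\<Sum>xs\<in>closed_walks k - tree_walks k. X (edges xs) \<omega>) / scale k"

text \<open>The value of the tree part if all squared weights were 1. It is deterministic and serves
  as the centre in place of the mean.\<close>

definition tree_density :: "nat \<Rightarrow> real" where
  "tree_density k = real (card (tree_walks k)) / scale k"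

lemma V_pos: "real (card V) > 0"
  using B1 BV by simp

lemma scale_pos: "scale k > 0"
  using V_pos B1 by (simp add: scale_def)

lemma finite_N: "finite (N x)"
  using finV NV finite_subset by blast

lemma deg_le: "card (N x) \<le> B"
  using deg[of x] N_out[of x] by (cases "x \<in> V") auto

lemma finite_closed_walks [simp]: "finite (closed_walks k)"
  unfolding closed_walks_def using finite_walks[of N, OF finite_N finV] by simp

lemma tree_walks_subset: "tree_walks k \<subseteq> closed_walks k"
  using double_tree_closed by (auto simp: tree_walks_def closed_walks_def)

lemma finite_tree_walks [simp]: "finite (tree_walks k)"
  by (rule finite_subset[OF tree_walks_subset finite_closed_walks])

lemma moment_split: "moment k \<omega> = tree_moment k \<omega> + rest_moment k \<omega>"
  unfolding moment_def tree_moment_def rest_moment_def add_divide_distrib[symmetric]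
  using sum.subset_diff[OF tree_walks_subset finite_closed_walks, of "\<lambda>xs. X (edges xs) \<omega>" k]
  by (simp add: add.commute)

lemma closed_walkD:
  assumes "xs \<in> closed_walks k"
  shows "length xs = Suc k" "hd xs = last xs" "xs \<noteq> []" "set (edges xs) \<subseteq> edges_in V"
    "xs \<in> walks V N k"
  using assms walks_length[of xs V N k] walks_subset[of N V xs k, OF NV] edges_in_walk[of xs V]
  by (auto simp: closed_walks_def)

text \<open>Stated for all powers so that the induction closes: the factors may be dependent, and
  \<open>\<bar>u * v\<bar> ^ k \<le> u ^ (2 * k) + v ^ (2 * k)\<close> separates them.\<close>

lemma integrable_edge_prod_power:
  "set es \<subseteq> edges_in V \<Longrightarrow> integrable M (\<lambda>\<omega>. X es \<omega> ^ k)"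
proof (induction es arbitrary: k)
  case (Cons e es)
  have int: "integrable M (\<lambda>\<omega>. Y e \<omega> ^ j)" "integrable M (\<lambda>\<omega>. X es \<omega> ^ j)" for j
    using Cons moments by auto
  have meas: "Y e \<in> borel_measurable M" "X es \<in> borel_measurable M"
    using int(1)[of 1] int(2)[of 1] by (auto dest: borel_measurable_integrable)
  show ?case
  proof (rule Bochner_Integration.integrable_bound)
    show "integrable M (\<lambda>\<omega>. Y e \<omega> ^ (2 * k) + X es \<omega> ^ (2 * k))"
      by (intro Bochner_Integration.integrable_add int)
    show "(\<lambda>\<omega>. X (e # es) \<omega> ^ k) \<in> borel_measurable M" using meas by simp
    have "\<bar>(u * v) ^ k\<bar> \<le> \<bar>u ^ (2 * k) + v ^ (2 * k)\<bar>" for u v :: real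
    proof -
      have "2 * (\<bar>u ^ k\<bar> * \<bar>v ^ k\<bar>) \<le> \<bar>u ^ k\<bar>\<^sup>2 + \<bar>v ^ k\<bar>\<^sup>2"
        using sum_squares_bound[of "\<bar>u ^ k\<bar>" "\<bar>v ^ k\<bar>"] by simp
      moreover have "0 \<le> \<bar>u ^ k\<bar> * \<bar>v ^ k\<bar>" by simp
      ultimately have "\<bar>u ^ k\<bar> * \<bar>v ^ k\<bar> \<le> \<bar>u ^ k\<bar>\<^sup>2 + \<bar>v ^ k\<bar>\<^sup>2" by linarith
      thus ?thesis by (simp add: power_mult_distrib abs_mult power_mult mult.commute[of 2 k])
    qed
    thus "AE \<omega> in M. norm (X (e # es) \<omega> ^ k) \<le> norm (Y e \<omega> ^ (2 * k) + X es \<omega> ^ (2 * k))"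
      by simp
  qed
qed simp

lemma integrable_edge_prod: "set es \<subseteq> edges_in V \<Longrightarrow> integrable M (X es)"
  using integrable_edge_prod_power[of es 1] by simp

lemma edges_in_concat:
  assumes "set xss \<subseteq> closed_walks k"
  shows "set (concat (map edges xss)) \<subseteq> edges_in V"
proof
  fix e assume "e \<in> set (concat (map edges xss))"
  then obtain xs where "xs \<in> set xss" "e \<in> set (edges xs)" by auto
  thus "e \<in> edges_in V" using assms closed_walkD(4)[of xs k] by blast
qed

lemma length_concat_edges:
  "set xss \<subseteq> closed_walks k \<Longrightarrow> length (concat (map edges xss)) = length xss * k"
  by (induction xss) (auto simp: closed_walkD(1))

lemma prod_list_edge_prod: "prod_list (map (\<lambda>xs. X (edges xs) \<omega>) xss) = X (concat (map edges xss)) \<omega>"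
  by (induction xss) auto

lemma rest_moment_power:
  "rest_moment k \<omega> ^ z = (\<Sum>xss\<in>tuples (closed_walks k - tree_walks k) z.
      X (concat (map edges xss)) \<omega>) / scale k ^ z"
  unfolding rest_moment_def power_divide by (subst power_sum_tuples) (simp_all add: prod_list_edge_prod)

lemma tuples_rest:
  "xss \<in> tuples (closed_walks k - tree_walks k) z \<Longrightarrow> set xss \<subseteq> closed_walks k \<and> length xss = z"
  by (auto simp: tuples_def)

lemma integrable_rest_moment_power: "integrable M (\<lambda>\<omega>. rest_moment k \<omega> ^ z)"
  unfolding rest_moment_power
  by (intro integrable_divide_zero Bochner_Integration.integrable_sum integrable_edge_prod
      edges_in_concat[of _ k]) (simp add: tuples_rest)

text \<open>Trades the decay from single edges for the weight of the walk counts, by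
  \<open>2 * v \<le> z * k + s\<close> for \<open>v\<close> vertices and \<open>s\<close> single
  edges.\<close>

lemma rest_tuple_bound:
  assumes "xss \<in> tuples (closed_walks k - tree_walks k) z"
  shows "real B powr (- real (card (single_edges (concat (map edges xss)))) / 2)
    \<le> real B powr (real (z * k) / 2) * (1 / real B) ^ card (\<Union>(set ` set xss))"
proof -
  let ?es = "concat (map edges xss)" and ?v = "card (\<Union>(set ` set xss))"
  have "?v \<le> card (set ?es) + card (heavy_edges ?es)"
  proof (rule card_closed_walks_not_double_tree)
    fix xs assume "xs \<in> set xss"
    hence "xs \<in> closed_walks k" "xs \<notin> tree_walks k" using assms by (auto simp: tuples_def)
    thus "xs \<noteq> [] \<and> hd xs = last xs \<and> \<not> double_tree xs"
      using closed_walkD[of xs k] by (auto simp: tree_walks_def)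
  qed
  hence "2 * ?v \<le> 2 * (card (set ?es) + card (heavy_edges ?es))" by (rule mult_le_mono2)
  also have "\<dots> \<le> length ?es + card (single_edges ?es)" by (rule card_edges_le)
  also have "length ?es = z * k" using length_concat_edges[of xss k] tuples_rest[OF assms] by simp
  finally have "2 * ?v \<le> z * k + card (single_edges ?es)" .
  hence "2 * real ?v \<le> real (z * k) + real (card (single_edges ?es))" by linarith
  hence "- real (card (single_edges ?es)) / 2 \<le> real (z * k) / 2 - real ?v" by (simp add: field_simps)
  hence "real B powr (- real (card (single_edges ?es)) / 2) \<le> real B powr (real (z * k) / 2 - real ?v)"
    using B1 by (intro powr_mono) auto
  also have "\<dots> = real B powr (real (z * k) / 2) * (1 / real B) ^ ?v"
    using B1 by (simp add: powr_diff powr_realpow power_divide)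
  finally show ?thesis .
qed

lemma tuples_mono: "A \<subseteq> A' \<Longrightarrow> tuples A z \<subseteq> tuples A' z"
  by (auto simp: tuples_def)

lemma expectation_rest_moment_power_le:
  assumes bound: "\<And>es. set es \<subseteq> edges_in V \<Longrightarrow> es \<noteq> [] \<Longrightarrow>
      \<bar>expectation (X es)\<bar> \<le> C (length es) * real (card V) powr (- real (card (single_edges es)) / 2)"
    and C: "\<And>m. C m \<ge> 0" and k: "k \<ge> 1" and z: "z \<ge> 1"
  shows "expectation (\<lambda>\<omega>. rest_moment k \<omega> ^ z)
    \<le> C (z * k) * (real (z * Suc k) + 1) ^ (Suc k * z) / real B ^ z"
proof -
  let ?R = "closed_walks k - tree_walks k" and ?K = "z * Suc k"
  let ?b = "real B powr (real (z * k) / 2)" and ?n = "real (card V)"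
  let ?D = "(real ?K + 1) ^ Suc k"
  have each: "expectation (X (concat (map edges xss))) \<le> C (z * k) * (?b * (1 / real B) ^ card (\<Union>(set ` set xss)))"
    if xss: "xss \<in> tuples ?R z" for xss
  proof -
    let ?es = "concat (map edges xss)"
    have len: "length ?es = z * k" using length_concat_edges tuples_rest[OF xss] by blast
    hence "length ?es \<noteq> 0" using k z by simp
    hence ne: "?es \<noteq> []" by (simp only: length_0_conv not_False_eq_True)
    have "expectation (X ?es) \<le> C (z * k) * ?n powr (- real (card (single_edges ?es)) / 2)"
      using bound[OF edges_in_concat ne] tuples_rest[OF xss] len by force
    \<comment> \<open>Since \<open>B \<le> card V\<close>, decay in the size of the matrix is
      weakened to decay in \<open>B\<close>, the unit of the counting weight.\<close>
    also have "?n powr (- real (card (single_edges ?es)) / 2) \<le> real B powr (- real (card (single_edges ?es)) / 2)"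
      using B1 BV by (intro powr_mono2') auto
    also note rest_tuple_bound[OF xss]
    finally show ?thesis using C by (simp add: mult_left_mono)
  qed
  have "(\<Sum>xss\<in>tuples ?R z. (1 / real B) ^ card (\<Union>(set ` set xss)))
      \<le> (\<Sum>xss\<in>tuples (walks V N k) z. (1 / real B) ^ card (\<Union>(set ` set xss)))"
    by (intro sum_mono2 finite_tuples finite_walks finite_N finV tuples_mono)
      (auto simp: closed_walks_def)
  also have "\<dots> \<le> (?D * (?n / real B)) ^ z"
    using sum_tuples_walks_bound[of N B V "{}" z k ?K] finite_N deg_le B1 BV finV by simp
  finally have sum: "(\<Sum>xss\<in>tuples ?R z. (1 / real B) ^ card (\<Union>(set ` set xss))) \<le> (?D * (?n / real B)) ^ z" .
  have "expectation (\<lambda>\<omega>. rest_moment k \<omega> ^ z)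
      = (\<Sum>xss\<in>tuples ?R z. expectation (X (concat (map edges xss)))) / scale k ^ z"
    unfolding rest_moment_power
  proof (subst integral_divide_zero, subst Bochner_Integration.integral_sum)
    show "integrable M (X (concat (map edges xss)))" if "xss \<in> tuples ?R z" for xss
      using tuples_rest[OF that] by (intro integrable_edge_prod edges_in_concat) auto
  qed simp
  also have "\<dots> \<le> (\<Sum>xss\<in>tuples ?R z. C (z * k) * (?b * (1 / real B) ^ card (\<Union>(set ` set xss)))) / scale k ^ z"
    using scale_pos[of k] by (intro divide_right_mono sum_mono each) auto
  also have "\<dots> = C (z * k) * ?b * (\<Sum>xss\<in>tuples ?R z. (1 / real B) ^ card (\<Union>(set ` set xss))) / scale k ^ z"
    by (simp add: sum_distrib_left mult.assoc)
  also have "\<dots> \<le> C (z * k) * ?b * (?D * (?n / real B)) ^ z / scale k ^ z"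
    using scale_pos[of k] C sum by (intro divide_right_mono mult_left_mono) auto
  also have "scale k ^ z = ?n ^ z * ?b"
    using B1 by (simp add: scale_def power_mult_distrib powr_powr[symmetric] powr_realpow[symmetric] powr_powr mult.commute)
  \<comment> \<open>The normalisation cancels \<open>?b\<close> and the numerators of the free
    starts \<open>?n / real B\<close>; what remains is \<open>1 / B\<close> for each of the
    \<open>z\<close> walks.\<close>
  also have "C (z * k) * ?b * (?D * (?n / real B)) ^ z / (?n ^ z * ?b) = C (z * k) * (?D ^ z / real B ^ z)"
    using V_pos B1 by (simp add: power_mult_distrib power_divide)
  also have "?D ^ z = (real ?K + 1) ^ (Suc k * z)" by (rule power_mult[symmetric])
  finally show ?thesis by simp
qed

lemma tree_density_le: "tree_density k \<le> real (ballot k 0)"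
  using card_double_trees(1)[of V N B k, OF finV NV deg sym B1] scale_pos[of k]
  by (simp add: tree_density_def tree_walks_def scale_def divide_le_eq mult_ac)

lemma tree_density_nonneg: "tree_density k \<ge> 0"
  using scale_pos[of k] by (simp add: tree_density_def)

lemma tree_density_ge:
  assumes "Suc k < B"
  shows "real (ballot k 0) * (1 - real (Suc k) / real B) powr (real k / 2) \<le> tree_density k"
proof -
  have "1 - real (Suc k) / real B = (real B - real (Suc k)) / real B"
    using B1 by (simp add: field_simps)
  hence "(1 - real (Suc k) / real B) powr (real k / 2)
      = (real B - real (Suc k)) powr (real k / 2) / real B powr (real k / 2)"
    using assms by (simp add: powr_divide)
  hence "real (ballot k 0) * (1 - real (Suc k) / real B) powr (real k / 2)
      = real (card V) * (real (ballot k 0) * (real B - real (Suc k)) powr (real k / 2)) / scale k"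
    using V_pos by (simp add: scale_def)
  also have "\<dots> \<le> tree_density k"
    unfolding tree_density_def tree_walks_def using scale_pos[of k]
    by (intro divide_right_mono card_double_trees(2)[of V N B k, OF finV NV deg sym B1 assms]) auto
  finally show ?thesis .
qed

lemma tree_walk_edge_prod:
  assumes "xs \<in> tree_walks k"
  shows "X (edges xs) \<omega> = (\<Prod>e\<in>set (edges xs). (Y e \<omega>)\<^sup>2)" and "2 * card (set (edges xs)) = k"
proof -
  have c: "count_list (edges xs) e = 2" if "e \<in> set (edges xs)" for e
    using double_tree_count[OF _ that] assms by (simp add: tree_walks_def)
  show "X (edges xs) \<omega> = (\<Prod>e\<in>set (edges xs). (Y e \<omega>)\<^sup>2)"
    unfolding edge_prod_eq_prod by (intro prod.cong) (auto simp: c)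
  have "length xs = Suc k" using assms walks_length by (auto simp: tree_walks_def)
  hence "k = (\<Sum>e\<in>set (edges xs). count_list (edges xs) e)" by (simp add: sum_count_set)
  thus "2 * card (set (edges xs)) = k" by (simp add: c)
qed

text \<open>Allows a constant bound for a pair to be multiplied by the counting weight. The price is
  only \<open>B ^ k\<close>, which the squared \<open>scale k\<close> contains, because such a pair
  has at most \<open>k\<close> vertices.\<close>

lemma pair_weight_bound:
  assumes "xs \<in> closed_walks k" "ys \<in> closed_walks k" "set (edges xs) \<inter> set (edges ys) \<noteq> {}"
    "single_edges (edges xs @ edges ys) = {}"
  shows "1 \<le> real B ^ k * (1 / real B) ^ card (set xs \<union> set ys)"
proof -
  have "card (set xs \<union> set ys) \<le> k"
    using assms closed_walkD[of xs k] closed_walkD[of ys k] by (intro card_walks_sharing_edge) auto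
  hence "real B ^ card (set xs \<union> set ys) \<le> real B ^ k" using B1 by (intro power_increasing) auto
  thus ?thesis using B1 by (simp add: power_one_over field_simps)
qed

end

lemma integral_double_sum:
  fixes h :: "'x \<Rightarrow> 'x \<Rightarrow> 'w \<Rightarrow> real"
  assumes "\<And>x y. x \<in> A \<Longrightarrow> y \<in> A \<Longrightarrow> integrable M (h x y)"
  shows "(\<integral>\<omega>. (\<Sum>x\<in>A. \<Sum>y\<in>A. h x y \<omega>) \<partial>M) = (\<Sum>x\<in>A. \<Sum>y\<in>A. \<integral>\<omega>. h x y \<omega> \<partial>M)"
proof -
  have "(\<integral>\<omega>. (\<Sum>x\<in>A. \<Sum>y\<in>A. h x y \<omega>) \<partial>M) = (\<Sum>x\<in>A. \<integral>\<omega>. (\<Sum>y\<in>A. h x y \<omega>) \<partial>M)"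
    using assms by (intro Bochner_Integration.integral_sum Bochner_Integration.integrable_sum) auto
  also have "\<dots> = (\<Sum>x\<in>A. \<Sum>y\<in>A. \<integral>\<omega>. h x y \<omega> \<partial>M)"
    using assms by (intro sum.cong refl Bochner_Integration.integral_sum) auto
  finally show ?thesis .
qed

section \<open>Second moments: deviation of the tree part and variance of the full moment\<close>

context edge_variables
begin

text \<open>Both walks have a free start, hence the square of \<open>card V / B\<close>; after
  normalisation this becomes the rate \<open>1 / B ^ 2\<close>.\<close>

lemma sum_pairs_bound:
  assumes "A \<subseteq> walks V N k"
  shows "(\<Sum>xs\<in>A. \<Sum>ys\<in>A. (1 / real B) ^ card (set xs \<union> set ys))
    \<le> ((real (2 * Suc k) + 1) ^ Suc k * (real (card V) / real B))\<^sup>2"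
proof -
  have fin: "finite (walks V N k)" by (intro finite_walks finite_N finV)
  have "(\<Sum>xs\<in>A. \<Sum>ys\<in>A. (1 / real B) ^ card (set xs \<union> set ys))
      \<le> (\<Sum>xs\<in>walks V N k. \<Sum>ys\<in>walks V N k. (1 / real B) ^ card (set xs \<union> set ys))"
    using assms fin by (intro order_trans[OF sum_mono2[OF fin assms] sum_mono[OF sum_mono2[OF fin assms]]])
      (auto intro: sum_nonneg)
  also have "\<dots> = (\<Sum>xss\<in>tuples (walks V N k) 2. (1 / real B) ^ card ({} \<union> \<Union>(set ` set xss)))"
    using fin by (simp add: numeral_2_eq_2 sum_tuples_Suc)
  also have "\<dots> \<le> ((real (2 * Suc k) + 1) ^ Suc k * (real (card V) / real B))\<^sup>2 * (1 / real B) ^ card ({} :: 'v set)"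
    by (rule sum_tuples_walks_bound) (use finite_N deg_le B1 BV finV in auto)
  finally show ?thesis by simp
qed

lemma single_edges_tree_walks:
  assumes "xs \<in> tree_walks k" "ys \<in> tree_walks k"
  shows "single_edges (edges xs @ edges ys) = {}"
proof -
  have c: "count_list (edges zs) e = (if e \<in> set (edges zs) then 2 else 0)" if "zs \<in> tree_walks k" for zs e
    using double_tree_count[of zs e] that by (auto simp: tree_walks_def count_list_0_iff)
  show ?thesis using assms by (auto simp: single_edges_def c)
qed

text \<open>Centring at \<open>tree_density\<close> treats bias and fluctuation at once. Pairs with
  a common edge have at most \<open>k\<close> vertices and are summed by weight. For edge-disjoint
  pairs the expectations in \<open>E X Y - E X - E Y + 1\<close> are products of squares over
  \<open>k\<close>, \<open>k div 2\<close> and \<open>k div 2\<close> edges, all close to 1, so the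
  ones cancel.\<close>

lemma expectation_tree_moment_le:
  assumes bound: "\<And>es. set es \<subseteq> edges_in V \<Longrightarrow> es \<noteq> [] \<Longrightarrow> \<bar>expectation (X es)\<bar> \<le> C (length es)"
    and square: "\<And>F. F \<subseteq> edges_in V \<Longrightarrow> F \<noteq> {} \<Longrightarrow>
      \<bar>expectation (\<lambda>\<omega>. \<Prod>e\<in>F. (Y e \<omega>)\<^sup>2) - 1\<bar> \<le> c (card F)"
    and C: "\<And>m. C m \<ge> 0" and c: "\<And>m. c m \<ge> 0" and k: "k \<ge> 1"
  shows "integrable M (\<lambda>\<omega>. (tree_moment k \<omega> - tree_density k)\<^sup>2)"
    and "expectation (\<lambda>\<omega>. (tree_moment k \<omega> - tree_density k)\<^sup>2)
      \<le> (C (2 * k) + 2 * C k + 1) * (real (2 * Suc k) + 1) ^ (2 * Suc k) / (real B)\<^sup>2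
        + (c k + 2 * c (k div 2)) * (real (ballot k 0))\<^sup>2" (is "?lhs \<le> ?rhs")
proof -
  let ?G = "tree_walks k" and ?n = "real (card V)"
  let ?X = "\<lambda>xs. X (edges xs)"
  define D where "D = C (2 * k) + 2 * C k + 1"
  define q where "q = c k + 2 * c (k div 2)"
  have G: "xs \<in> closed_walks k" if "xs \<in> ?G" for xs using that tree_walks_subset by blast
  have len: "length (edges xs) = k" if "xs \<in> ?G" for xs using closed_walkD(1)[OF G[OF that]] by simp
  have E: "set (edges xs) \<subseteq> edges_in V" if "xs \<in> ?G" for xs using closed_walkD(4)[OF G[OF that]] .
  have int1: "integrable M (?X xs)" if "xs \<in> ?G" for xs
    using E[OF that] by (rule integrable_edge_prod)
  have int2: "integrable M (\<lambda>\<omega>. ?X xs \<omega> * ?X ys \<omega>)" if "xs \<in> ?G" "ys \<in> ?G" for xs ys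
    unfolding edge_prod_simps(3)[symmetric]
    using E[OF that(1)] E[OF that(2)] by (intro integrable_edge_prod) simp
  have int: "integrable M (\<lambda>\<omega>. (?X xs \<omega> - 1) * (?X ys \<omega> - 1))" if "xs \<in> ?G" "ys \<in> ?G" for xs ys
  proof -
    have "integrable M (\<lambda>\<omega>. ?X xs \<omega> * ?X ys \<omega> - ?X xs \<omega> - ?X ys \<omega> + 1)"
      using int1 int2 that by auto
    thus ?thesis by (simp add: algebra_simps)
  qed
  have "tree_moment k \<omega> - tree_density k = (\<Sum>xs\<in>?G. ?X xs \<omega> - 1) / scale k" for \<omega>
    by (simp add: tree_moment_def tree_density_def sum_subtractf diff_divide_distrib)
  hence sq: "(tree_moment k \<omega> - tree_density k)\<^sup>2
      = (\<Sum>xs\<in>?G. \<Sum>ys\<in>?G. (?X xs \<omega> - 1) * (?X ys \<omega> - 1)) / (scale k)\<^sup>2" for \<omega>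
    by (simp add: power_divide power2_eq_square sum_product)
  show "integrable M (\<lambda>\<omega>. (tree_moment k \<omega> - tree_density k)\<^sup>2)"
    unfolding sq by (intro integrable_divide_zero Bochner_Integration.integrable_sum int)
  have each: "expectation (\<lambda>\<omega>. (?X xs \<omega> - 1) * (?X ys \<omega> - 1))
      \<le> D * (real B ^ k * (1 / real B) ^ card (set xs \<union> set ys)) + q"
    if xy: "xs \<in> ?G" "ys \<in> ?G" for xs ys
  proof -
    have "(\<lambda>\<omega>. (?X xs \<omega> - 1) * (?X ys \<omega> - 1)) = (\<lambda>\<omega>. ?X xs \<omega> * ?X ys \<omega> - ?X xs \<omega> - ?X ys \<omega> + 1)"
      by (simp add: algebra_simps)
    hence ex: "expectation (\<lambda>\<omega>. (?X xs \<omega> - 1) * (?X ys \<omega> - 1))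
        = expectation (X (edges xs @ edges ys)) - expectation (?X xs) - expectation (?X ys) + 1"
      using int1 int2 xy by (simp add: prob_space edge_prod_append)
    have ne: "edges zs \<noteq> []" if "zs \<in> ?G" for zs using len[OF that] k by (metis list.size(3) not_one_le_zero)
    show ?thesis
    proof (cases "set (edges xs) \<inter> set (edges ys) = {}")
      case False
      have "\<bar>expectation (X (edges xs @ edges ys))\<bar> \<le> C (2 * k)"
        using bound[of "edges xs @ edges ys"] E xy ne len by (simp add: mult_2)
      moreover have "\<bar>expectation (?X xs)\<bar> \<le> C k" "\<bar>expectation (?X ys)\<bar> \<le> C k"
        using bound[of "edges xs"] bound[of "edges ys"] E xy ne len by simp_all
      moreover have "e1 - e2 - e3 + 1 \<le> D"
        if "\<bar>e1\<bar> \<le> C (2 * k)" "\<bar>e2\<bar> \<le> C k" "\<bar>e3\<bar> \<le> C k" for e1 e2 e3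
        using that unfolding D_def by linarith
      ultimately have "expectation (\<lambda>\<omega>. (?X xs \<omega> - 1) * (?X ys \<omega> - 1)) \<le> D"
        unfolding ex by blast
      also have "D = D * 1" by simp
      also have "\<dots> \<le> D * (real B ^ k * (1 / real B) ^ card (set xs \<union> set ys))"
        using C by (intro mult_left_mono pair_weight_bound single_edges_tree_walks[OF xy] xy G False) (auto simp: D_def)
      finally show ?thesis using c[of k] c[of "k div 2"] by (simp add: q_def)
    next
      case True
      have sqr: "\<bar>expectation (?X zs) - 1\<bar> \<le> c (k div 2)" if "zs \<in> ?G" for zs
      proof -
        have "card (set (edges zs)) = k div 2" using tree_walk_edge_prod(2)[OF that] by linarith
        moreover have "expectation (?X zs) = expectation (\<lambda>\<omega>. \<Prod>e\<in>set (edges zs). (Y e \<omega>)\<^sup>2)"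
          by (intro Bochner_Integration.integral_cong refl) (rule tree_walk_edge_prod(1)[OF that])
        ultimately show ?thesis using square[of "set (edges zs)"] E[OF that] ne[OF that] by simp
      qed
      have "X (edges xs @ edges ys) = (\<lambda>\<omega>. \<Prod>e\<in>set (edges xs) \<union> set (edges ys). (Y e \<omega>)\<^sup>2)"
        using True by (intro ext) (simp add: prod.union_disjoint tree_walk_edge_prod(1)[OF xy(1)]
          tree_walk_edge_prod(1)[OF xy(2)])
      moreover have "card (set (edges xs) \<union> set (edges ys)) = k"
        using True tree_walk_edge_prod(2)[OF xy(1)] tree_walk_edge_prod(2)[OF xy(2)]
        by (simp add: card_Un_disjoint)
      ultimately have "\<bar>expectation (X (edges xs @ edges ys)) - 1\<bar> \<le> c k"
        using square[of "set (edges xs) \<union> set (edges ys)"] E[OF xy(1)] E[OF xy(2)] ne[OF xy(1)]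
        by simp
      moreover have "e1 - e2 - e3 + 1 \<le> q"
        if "\<bar>e1 - 1\<bar> \<le> c k" "\<bar>e2 - 1\<bar> \<le> c (k div 2)" "\<bar>e3 - 1\<bar> \<le> c (k div 2)" for e1 e2 e3
        using that unfolding q_def by linarith
      ultimately have "expectation (\<lambda>\<omega>. (?X xs \<omega> - 1) * (?X ys \<omega> - 1)) \<le> q"
        using sqr[OF xy(1)] sqr[OF xy(2)] unfolding ex by blast
      moreover have "0 \<le> D * (real B ^ k * (1 / real B) ^ card (set xs \<union> set ys))"
        using C by (simp add: D_def)
      ultimately show ?thesis by linarith
    qed
  qed
  have "expectation (\<lambda>\<omega>. (tree_moment k \<omega> - tree_density k)\<^sup>2)
      = (\<Sum>xs\<in>?G. \<Sum>ys\<in>?G. expectation (\<lambda>\<omega>. (?X xs \<omega> - 1) * (?X ys \<omega> - 1))) / (scale k)\<^sup>2"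
    unfolding sq integral_divide_zero
    by (subst integral_double_sum) (simp_all add: int)
  also have "\<dots> \<le> (\<Sum>xs\<in>?G. \<Sum>ys\<in>?G. D * (real B ^ k * (1 / real B) ^ card (set xs \<union> set ys)) + q) / (scale k)\<^sup>2"
    by (intro divide_right_mono sum_mono each) auto
  also have "\<dots> = D * real B ^ k * (\<Sum>xs\<in>?G. \<Sum>ys\<in>?G. (1 / real B) ^ card (set xs \<union> set ys)) / (scale k)\<^sup>2
      + q * (tree_density k)\<^sup>2"
    by (simp add: sum.distrib sum_distrib_left mult.assoc add_divide_distrib tree_density_def power2_eq_square mult_ac)
  also have "\<dots> \<le> D * real B ^ k * ((real (2 * Suc k) + 1) ^ Suc k * (?n / real B))\<^sup>2 / (scale k)\<^sup>2
      + q * (real (ballot k 0))\<^sup>2"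
    using C c tree_density_le tree_density_nonneg
    by (intro add_mono divide_right_mono mult_left_mono sum_pairs_bound power_mono)
      (auto simp: tree_walks_def D_def q_def)
  also have "(scale k)\<^sup>2 = ?n\<^sup>2 * real B ^ k"
    using B1 by (simp add: scale_def power_mult_distrib powr_realpow[symmetric] powr_powr)
  also have "D * real B ^ k * ((real (2 * Suc k) + 1) ^ Suc k * (?n / real B))\<^sup>2 / (?n\<^sup>2 * real B ^ k)
      = D * ((real (2 * Suc k) + 1) ^ Suc k)\<^sup>2 / (real B)\<^sup>2"
    using B1 V_pos by (simp add: power_mult_distrib power_divide)
  also have "((real (2 * Suc k) + 1) ^ Suc k)\<^sup>2 = (real (2 * Suc k) + 1) ^ (2 * Suc k)"
    by (simp only: power_mult[symmetric] mult.commute)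
  finally show "?lhs \<le> ?rhs" unfolding D_def q_def .
qed

lemma integrable_moment: "integrable M (moment k)"
  unfolding moment_def[abs_def]
  by (intro integrable_divide_zero Bochner_Integration.integrable_sum integrable_edge_prod closed_walkD(4))

text \<open>A covariance vanishes unless the walks share an edge and the pair has no single edge.
  The surviving pairs meet, so only the first walk has a free start; after division by the square of
  \<open>scale k\<close> the factor \<open>n / B\<close> becomes \<open>1 / (n * B)\<close>.\<close>

lemma variance_moment_le:
  assumes indep: "\<And>es. set es \<subseteq> edges_in V \<Longrightarrow>
      expectation (X es) = (\<Prod>e\<in>set es. expectation (\<lambda>\<omega>. Y e \<omega> ^ count_list es e))"
    and centered: "\<And>e. e \<in> edges_in V \<Longrightarrow> expectation (Y e) = 0"
    and bound: "\<And>es. set es \<subseteq> edges_in V \<Longrightarrow> es \<noteq> [] \<Longrightarrow> \<bar>expectation (X es)\<bar> \<le> C (length es)"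
    and C: "\<And>m. C m \<ge> 0" and k: "k \<ge> 1"
  shows "integrable M (\<lambda>\<omega>. (moment k \<omega> - expectation (moment k))\<^sup>2)"
    and "expectation (\<lambda>\<omega>. (moment k \<omega> - expectation (moment k))\<^sup>2)
      \<le> (C (2 * k) + (C k)\<^sup>2) * ((real k + 1) * (real (2 * Suc k) * (real (2 * Suc k) + 1) ^ k))
          * (real (2 * Suc k) + 1) ^ Suc k / (real (card V) * real B)" (is "?lhs \<le> ?rhs")
proof -
  let ?G = "closed_walks k" and ?n = "real (card V)" and ?K = "2 * Suc k"
  let ?X = "\<lambda>xs. X (edges xs)"
  let ?m = "\<lambda>xs. expectation (?X xs)"
  define D where "D = C (2 * k) + (C k)\<^sup>2"
  have D0: "D \<ge> 0" using C by (simp add: D_def)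
  have len: "length (edges xs) = k" if "xs \<in> ?G" for xs using closed_walkD(1)[OF that] by simp
  have ne: "edges zs \<noteq> []" if "zs \<in> ?G" for zs using len[OF that] k by (metis list.size(3) not_one_le_zero)
  have E: "set (edges xs) \<subseteq> edges_in V" if "xs \<in> ?G" for xs using closed_walkD(4)[OF that] .
  have int1: "integrable M (?X xs)" if "xs \<in> ?G" for xs
    using E[OF that] by (rule integrable_edge_prod)
  have int2: "integrable M (\<lambda>\<omega>. ?X xs \<omega> * ?X ys \<omega>)" if "xs \<in> ?G" "ys \<in> ?G" for xs ys
    unfolding edge_prod_simps(3)[symmetric]
    using E[OF that(1)] E[OF that(2)] by (intro integrable_edge_prod) simp
  have expand: "(\<lambda>\<omega>. (?X xs \<omega> - ?m xs) * (?X ys \<omega> - ?m ys))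
      = (\<lambda>\<omega>. ?X xs \<omega> * ?X ys \<omega> - ?m ys * ?X xs \<omega> - ?m xs * ?X ys \<omega> + ?m xs * ?m ys)" for xs ys
    by (simp add: algebra_simps)
  have int: "integrable M (\<lambda>\<omega>. (?X xs \<omega> - ?m xs) * (?X ys \<omega> - ?m ys))" if "xs \<in> ?G" "ys \<in> ?G" for xs ys
    unfolding expand using int1 int2 that by auto
  have mean: "expectation (moment k) = (\<Sum>xs\<in>?G. ?m xs) / scale k"
    unfolding moment_def[abs_def] integral_divide_zero
    by (subst Bochner_Integration.integral_sum) (auto intro: int1)
  have "moment k \<omega> - expectation (moment k) = (\<Sum>xs\<in>?G. ?X xs \<omega> - ?m xs) / scale k" for \<omega>
    by (simp add: moment_def[of k \<omega>] mean sum_subtractf diff_divide_distrib)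
  hence sq: "(moment k \<omega> - expectation (moment k))\<^sup>2
      = (\<Sum>xs\<in>?G. \<Sum>ys\<in>?G. (?X xs \<omega> - ?m xs) * (?X ys \<omega> - ?m ys)) / (scale k)\<^sup>2" for \<omega>
    by (simp add: power_divide power2_eq_square sum_product)
  show "integrable M (\<lambda>\<omega>. (moment k \<omega> - expectation (moment k))\<^sup>2)"
    unfolding sq by (intro integrable_divide_zero Bochner_Integration.integrable_sum int)
  have single_zero: "expectation (X es) = 0"
    if "set es \<subseteq> edges_in V" "e \<in> single_edges es" for es e
  proof -
    have "expectation (\<lambda>\<omega>. Y e \<omega> ^ count_list es e) = 0" "e \<in> set es"
      using that centered[of e] by (auto simp: single_edges_def)
    thus ?thesis unfolding indep[OF that(1)] by (auto intro: prod_zero)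
  qed
  \<comment> \<open>The distinction is by common vertices rather than common edges, the form in
    which \<open>sum_walks_meeting_bound\<close> counts.\<close>
  have each: "expectation (\<lambda>\<omega>. (?X xs \<omega> - ?m xs) * (?X ys \<omega> - ?m ys))
      \<le> (if set ys \<inter> set xs = {} then 0 else D * (real B ^ k * (1 / real B) ^ card (set xs \<union> set ys)))"
    if xy: "xs \<in> ?G" "ys \<in> ?G" for xs ys
  proof -
    let ?es = "edges xs @ edges ys"
    have Ees: "set ?es \<subseteq> edges_in V" using E xy by simp
    have ex: "expectation (\<lambda>\<omega>. (?X xs \<omega> - ?m xs) * (?X ys \<omega> - ?m ys)) = expectation (X ?es) - ?m xs * ?m ys"
      unfolding expand using int1 int2 xy by (simp add: prob_space edge_prod_append algebra_simps)
    show ?thesis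
    proof (cases "set (edges xs) \<inter> set (edges ys) \<noteq> {} \<and> single_edges ?es = {}")
      case True
      then obtain e where "e \<in> set (edges xs)" "e \<in> set (edges ys)" by blast
      hence meet: "set ys \<inter> set xs \<noteq> {}"
        using edge_in_edges[of e xs] edges_subset[of e ys] by auto
      have "\<bar>expectation (X ?es)\<bar> \<le> C (2 * k)"
        using bound[OF Ees] xy ne len by (simp add: mult_2)
      moreover have "\<bar>?m xs * ?m ys\<bar> \<le> (C k)\<^sup>2"
        unfolding abs_mult power2_eq_square
        using bound[of "edges xs"] bound[of "edges ys"] E xy ne len by (intro mult_mono) auto
      ultimately have "expectation (X ?es) - ?m xs * ?m ys \<le> D * 1" by (simp add: D_def)
      also have "\<dots> \<le> D * (real B ^ k * (1 / real B) ^ card (set xs \<union> set ys))"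
        using True by (intro mult_left_mono pair_weight_bound xy D0) auto
      finally show ?thesis using meet by (simp add: ex)
    next
      case False
      have "expectation (X ?es) = ?m xs * ?m ys"
      proof (cases "set (edges xs) \<inter> set (edges ys) = {}")
        case True
        have "(\<Prod>e\<in>set (edges xs). expectation (\<lambda>\<omega>. Y e \<omega> ^ count_list ?es e))
            = (\<Prod>e\<in>set (edges xs). expectation (\<lambda>\<omega>. Y e \<omega> ^ count_list (edges xs) e))"
          using True by (intro prod.cong refl) (simp add: disjoint_iff)
        moreover have "(\<Prod>e\<in>set (edges ys). expectation (\<lambda>\<omega>. Y e \<omega> ^ count_list ?es e))
            = (\<Prod>e\<in>set (edges ys). expectation (\<lambda>\<omega>. Y e \<omega> ^ count_list (edges ys) e))"
          using True[unfolded Int_commute[of "set (edges xs)"]]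
          by (intro prod.cong refl) (simp add: disjoint_iff)
        ultimately show ?thesis
          using True by (simp only: indep[OF Ees] indep[OF E[OF xy(1)]] indep[OF E[OF xy(2)]] set_append)
            (subst prod.union_disjoint, auto)
      next
        case inter: False
        \<comment> \<open>An edge that is single in the concatenation is single in one of the two
          walks, so a centred factor annihilates both the joint mean and the product of the
          means.\<close>
        with False obtain e where e: "e \<in> single_edges ?es" by blast
        hence "e \<in> single_edges (edges xs) \<or> e \<in> single_edges (edges ys)"
          by (auto simp: single_edges_def count_list_0_iff add_is_1)
        hence "?m xs * ?m ys = 0" using single_zero E xy by auto
        thus ?thesis using single_zero[OF Ees e] by simp
      qed
      thus ?thesis using D0 by (simp add: ex)
    qed
  qed
  have "expectation (\<lambda>\<omega>. (moment k \<omega> - expectation (moment k))\<^sup>2)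
      = (\<Sum>xs\<in>?G. \<Sum>ys\<in>?G. expectation (\<lambda>\<omega>. (?X xs \<omega> - ?m xs) * (?X ys \<omega> - ?m ys))) / (scale k)\<^sup>2"
    unfolding sq integral_divide_zero
    by (subst integral_double_sum) (simp_all add: int)
  also have "\<dots> \<le> (\<Sum>xs\<in>?G. \<Sum>ys\<in>?G. if set ys \<inter> set xs = {} then 0
      else D * (real B ^ k * (1 / real B) ^ card (set xs \<union> set ys))) / (scale k)\<^sup>2"
    by (intro divide_right_mono sum_mono each) auto
  also have "\<dots> = D * real B ^ k * (\<Sum>xs\<in>?G. \<Sum>ys\<in>{ys \<in> ?G. set ys \<inter> set xs \<noteq> {}}.
      (1 / real B) ^ card (set xs \<union> set ys)) / (scale k)\<^sup>2"
  proof -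
    have "(\<Sum>ys\<in>?G. if set ys \<inter> set xs = {} then 0
          else D * (real B ^ k * (1 / real B) ^ card (set xs \<union> set ys)))
        = (\<Sum>ys\<in>{ys \<in> ?G. set ys \<inter> set xs \<noteq> {}}. D * (real B ^ k * (1 / real B) ^ card (set xs \<union> set ys)))" for xs
      unfolding sum.inter_filter[OF finite_closed_walks] by (intro sum.cong) auto
    thus ?thesis by (simp only: sum_distrib_left mult.assoc)
  qed
  also have "\<dots> \<le> D * real B ^ k * (((real k + 1) * (real ?K * (real ?K + 1) ^ k))
      * ((real ?K + 1) ^ Suc k * (?n / real B))) / (scale k)\<^sup>2"
  proof (intro divide_right_mono mult_left_mono)
    let ?c = "(real k + 1) * (real ?K * (real ?K + 1) ^ k)"
    have fin: "finite (walks V N k)" by (intro finite_walks finite_N finV)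
    have "(\<Sum>ys\<in>{ys \<in> ?G. set ys \<inter> set xs \<noteq> {}}. (1 / real B) ^ card (set xs \<union> set ys))
        \<le> ?c * (1 / real B) ^ card (set xs)" if "xs \<in> ?G" for xs
    proof -
      have "(\<Sum>ys\<in>{ys \<in> ?G. set ys \<inter> set xs \<noteq> {}}. (1 / real B) ^ card (set xs \<union> set ys))
          \<le> (\<Sum>ys\<in>{ys \<in> walks V N k. set ys \<inter> set xs \<noteq> {}}. (1 / real B) ^ card (set xs \<union> set ys))"
        using fin by (intro sum_mono2) (auto simp: closed_walks_def)
      also have "\<dots> \<le> ?c * (1 / real B) ^ card (set xs)"
        by (rule sum_walks_meeting_bound[OF finite_N deg_le B1 sym finV])
          (use card_length[of xs] closed_walkD(1)[OF that] in auto)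
      finally show ?thesis .
    qed
    hence "(\<Sum>xs\<in>?G. \<Sum>ys\<in>{ys \<in> ?G. set ys \<inter> set xs \<noteq> {}}. (1 / real B) ^ card (set xs \<union> set ys))
        \<le> (\<Sum>xs\<in>?G. ?c * (1 / real B) ^ card (set xs))"
      by (rule sum_mono)
    also have "\<dots> = ?c * (\<Sum>xs\<in>?G. (1 / real B) ^ card (set xs))" by (simp only: sum_distrib_left)
    also have "\<dots> \<le> ?c * (\<Sum>xs\<in>walks V N k. (1 / real B) ^ card ({} \<union> set xs))"
      using fin by (intro mult_left_mono) (auto simp: closed_walks_def intro!: sum_mono2)
    also have "\<dots> \<le> ?c * ((real ?K + 1) ^ Suc k * (?n / real B) * (1 / real B) ^ card ({} :: 'v set))"
      by (intro mult_left_mono sum_walks_bound[OF finite_N deg_le B1 finV BV]) auto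
    finally show "(\<Sum>xs\<in>?G. \<Sum>ys\<in>{ys \<in> ?G. set ys \<inter> set xs \<noteq> {}}. (1 / real B) ^ card (set xs \<union> set ys))
        \<le> ?c * ((real ?K + 1) ^ Suc k * (?n / real B))" by simp
  qed (use D0 in auto)
  also have "(scale k)\<^sup>2 = ?n\<^sup>2 * real B ^ k"
    using B1 by (simp add: scale_def power_mult_distrib powr_realpow[symmetric] powr_powr)
  also have "D * real B ^ k * (((real k + 1) * (real ?K * (real ?K + 1) ^ k))
      * ((real ?K + 1) ^ Suc k * (?n / real B))) / (?n\<^sup>2 * real B ^ k)
    = D * ((real k + 1) * (real ?K * (real ?K + 1) ^ k)) * (real ?K + 1) ^ Suc k / (?n * real B)"
  proof -
    have eq: "D * b * (u * (w * (n / \<beta>))) / (n\<^sup>2 * b) = D * u * w / (n * \<beta>)"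
      if "b \<noteq> 0" "n \<noteq> 0" "\<beta> \<noteq> 0" for b u w n \<beta> :: real
      using that by (simp add: field_simps power2_eq_square)
    show ?thesis by (rule eq) (use B1 V_pos in auto)
  qed
  finally show "?lhs \<le> ?rhs" unfolding D_def .
qed

end

section \<open>Traces of band matrices\<close>

definition band_neighbours :: "nat \<Rightarrow> nat \<Rightarrow> nat \<Rightarrow> nat set" where
  "band_neighbours n b x = {y \<in> {1..n}. x \<in> {1..n} \<and> relevant n b x y}"

text \<open>Here \<open>r = (b - 1) / 2\<close>. The last two alternatives are the two corners of
  the periodic band.\<close>

lemma relevant_odd_iff:
  assumes "2 * r + 1 < n"
  shows "relevant n (2 * r + 1) x y \<longleftrightarrow>
    (x \<le> y + r \<and> y \<le> x + r) \<or> y + (n - r) \<le> x \<or> x + (n - r) \<le> y"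
proof -
  have "relevant n (2 * r + 1) x y \<longleftrightarrow>
      \<bar>real x - real y\<bar> \<le> real r \<or> real (n - r) \<le> \<bar>real x - real y\<bar>"
    using assms by (auto simp: relevant_def)
  also have "\<bar>real x - real y\<bar> \<le> real r \<longleftrightarrow> x \<le> y + r \<and> y \<le> x + r" by (simp add: abs_le_iff) linarith
  also have "real (n - r) \<le> \<bar>real x - real y\<bar> \<longleftrightarrow> y + (n - r) \<le> x \<or> x + (n - r) \<le> y"
  proof (cases "x \<le> y")
    case True
    hence "\<bar>real x - real y\<bar> = real (y - x)" by (simp add: of_nat_diff)
    thus ?thesis using True assms by (simp only: of_nat_le_iff) linarith
  next
    case False
    hence "\<bar>real x - real y\<bar> = real (x - y)" by (simp add: of_nat_diff)
    thus ?thesis using False assms by (simp only: of_nat_le_iff) linarith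
  qed
  finally show ?thesis .
qed

text \<open>Near an end the interval of radius \<open>r\<close> is cut off, and the corner condition
  restores exactly the missing points at the opposite end. This makes the relevance graph
  regular.\<close>

lemma card_band_neighbours:
  assumes "bandwidth n b" "x \<in> {1..n}"
  shows "card (band_neighbours n b x) = b"
proof (cases "b = n")
  case True
  hence "band_neighbours n b x = {1..n}" using assms by (auto simp: band_neighbours_def relevant_def)
  then show ?thesis using True by simp
next
  case False
  hence b: "b < n" "odd b" using assms(1) by (auto simp: bandwidth_def)
  then obtain r where r: "b = 2 * r + 1" by (auto elim: oddE)
  have n: "2 * r + 1 < n" using b r by simp
  note rel = relevant_odd_iff[OF n]
  consider "x \<le> r" | "r < x" "x \<le> n - r" | "n - r < x" by linarith
  thus ?thesis
  proof cases
    case 1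
    have "band_neighbours n b x = {1..x + r} \<union> {n - r + x..n}"
      using 1 n assms(2) unfolding band_neighbours_def r rel by auto
    moreover have "card ({1..x + r} \<union> {n - r + x..n}) = card {1..x + r} + card {n - r + x..n}"
      using n by (intro card_Un_disjoint) auto
    ultimately show ?thesis using 1 n by (simp add: r)
  next
    case 2
    have "band_neighbours n b x = {x - r..x + r}"
      using 2 n assms(2) unfolding band_neighbours_def r rel by auto
    thus ?thesis using 2 by (simp add: r)
  next
    case 3
    have "band_neighbours n b x = {x - r..n} \<union> {1..x - (n - r)}"
      using 3 n assms(2) unfolding band_neighbours_def r rel by auto
    moreover have "card ({x - r..n} \<union> {1..x - (n - r)}) = card {x - r..n} + card {1..x - (n - r)}"
      using n 3 assms(2) by (intro card_Un_disjoint) auto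
    ultimately show ?thesis using 3 n assms(2) by (simp add: r)
  qed
qed

lemma band_neighbours_sym: "y \<in> band_neighbours n b x \<Longrightarrow> x \<in> band_neighbours n b y"
  by (auto simp: band_neighbours_def relevant_def abs_minus_commute)

lemma pow_mat_Suc_left:
  assumes "A \<in> carrier_mat n n"
  shows "A ^\<^sub>m Suc k = A * (A ^\<^sub>m k :: 'a :: semiring_1 mat)"
proof (induction k)
  case (Suc k)
  have "A ^\<^sub>m Suc (Suc k) = (A * A ^\<^sub>m k) * A" using Suc by simp
  also have "\<dots> = A * (A ^\<^sub>m k * A)" using assms by (intro assoc_mult_mat) auto
  finally show ?case by simp
qed (use assms in simp)

text \<open>Powers are expanded from the left because \<open>walks_from\<close> grows at the head.
  Vertices start at 1 and matrix indices at 0, hence \<open>i - 1\<close>.\<close>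

lemma mat_pow_walks:
  fixes A :: "real mat"
  assumes A: "A \<in> carrier_mat n n" and N: "\<And>x. N x \<subseteq> {1..n}"
    and ent: "\<And>i j. i \<in> {1..n} \<Longrightarrow> j \<in> {1..n} \<Longrightarrow> A $$ (i - 1, j - 1) = (if j \<in> N i then w {i, j} else 0)"
    and j: "j \<in> {1..n}"
  shows "i \<in> {1..n} \<Longrightarrow> (A ^\<^sub>m k) $$ (i - 1, j - 1)
    = (\<Sum>ys\<in>walks_from N i k. if last (i # ys) = j then prod_list (map w (edges (i # ys))) else 0)"
proof (induction k arbitrary: i)
  case 0
  then show ?case using A j unfolding walks_from.simps pow_mat.simps by auto
next
  case (Suc k)
  let ?g = "\<lambda>i ys. if last (i # ys) = j then prod_list (map w (edges (i # ys))) else 0"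
  have finN: "finite (N x)" for x using N finite_subset by blast
  have lt: "i - 1 < n" "j - 1 < n" using Suc.prems j by auto
  have "(A ^\<^sub>m Suc k) $$ (i - 1, j - 1) = (\<Sum>l<n. A $$ (i - 1, l) * (A ^\<^sub>m k) $$ (l, j - 1))"
    unfolding pow_mat_Suc_left[OF A] using A lt
    by (auto simp: scalar_prod_def atLeast0LessThan intro!: sum.cong)
  also have "\<dots> = (\<Sum>y\<in>{1..n}. A $$ (i - 1, y - 1) * (A ^\<^sub>m k) $$ (y - 1, j - 1))"
    by (rule sum.reindex_bij_witness[of _ "\<lambda>y. y - 1" Suc]) auto
  also have "\<dots> = (\<Sum>y\<in>{1..n}. if y \<in> N i then w {i, y} * (\<Sum>ys\<in>walks_from N y k. ?g y ys) else 0)"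
    using Suc ent by (intro sum.cong) auto
  also have "\<dots> = (\<Sum>y\<in>N i. w {i, y} * (\<Sum>ys\<in>walks_from N y k. ?g y ys))"
    using N[of i] by (simp add: sum.If_cases Int_absorb1)
  also have "\<dots> = (\<Sum>y\<in>N i. \<Sum>ys\<in>walks_from N y k. ?g i (y # ys))"
    unfolding sum_distrib_left by (intro sum.cong) auto
  also have "\<dots> = (\<Sum>ys\<in>walks_from N i (Suc k). ?g i ys)"
    by (rule sum_walks_from_Suc[symmetric]) (rule finN)
  finally show ?case .
qed

text \<open>One variable per undirected edge, read off on or above the diagonal, so that the weight
  is a function of the edge alone.\<close>

definition edge_entry :: "(nat \<Rightarrow> nat \<Rightarrow> nat \<Rightarrow> 'w \<Rightarrow> real) \<Rightarrow> nat \<Rightarrow> nat set \<Rightarrow> 'w \<Rightarrow> real" where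
  "edge_entry a n e \<omega> = a n (Min e) (Max e) \<omega>"

lemma edge_entry_eq:
  assumes "triangular_scheme M a" "p \<in> {1..n}" "q \<in> {1..n}" "\<omega> \<in> space M"
  shows "edge_entry a n {p, q} \<omega> = a n p q \<omega>"
proof (cases "p \<le> q")
  case False
  then show ?thesis using assms by (auto simp: edge_entry_def triangular_scheme_def min_def max_def)
qed (simp add: edge_entry_def min_def max_def)

lemma edges_in_Min_Max:
  fixes e :: "'v::linorder set"
  assumes "e \<in> edges_in V"
  shows "Min e \<in> V" "Max e \<in> V" "e = {Min e, Max e}" "Min e \<le> Max e"
proof -
  obtain p q where pq: "p \<in> V" "q \<in> V" "e = {p, q}" using assms by (auto simp: edges_in_def)
  have "Min e = min p q" "Max e = max p q" by (simp_all add: pq)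
  thus "Min e \<in> V" "Max e \<in> V" "e = {Min e, Max e}" "Min e \<le> Max e"
    using pq by (cases "p \<le> q"; auto simp: min_def max_def)+
qed

lemma sum_eigenvalue_power_walks:
  fixes a b n \<omega>
  assumes n: "n \<ge> 1" and tri: "triangular_scheme M a" and \<omega>: "\<omega> \<in> space M"
    and vars: "edge_variables M {1..n} (band_neighbours n (b n)) (b n) (edge_entry a n)"
  shows "length (eigenvalue_list (band_matrix a b n \<omega>)) = n"
    and "(\<Sum>i<n. (eigenvalue_list (band_matrix a b n \<omega>) ! i) ^ k) / real n
      = edge_variables.moment {1..n} (band_neighbours n (b n)) (b n) (edge_entry a n) k \<omega>"
proof -
  interpret edge_variables M "{1..n}" "band_neighbours n (b n)" "b n" "edge_entry a n" by (rule vars)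
  let ?A = "band_matrix a b n \<omega>" and ?N = "band_neighbours n (b n)"
  define c where "c = real (b n) powr (- 1 / 2)"
  define w where "w e = c * edge_entry a n e \<omega>" for e
  have A: "?A \<in> carrier_mat n n" by (simp add: band_matrix_def)
  have ent: "?A $$ (i - 1, j - 1) = (if j \<in> ?N i then w {i, j} else 0)"
    if "i \<in> {1..n}" "j \<in> {1..n}" for i j
    using that edge_entry_eq[OF tri that \<omega>]
    by (auto simp: band_matrix_def w_def c_def band_neighbours_def)
  have sym: "?A $$ (i, j) = ?A $$ (j, i)" if "i < n" "j < n" for i j
  proof -
    have "Suc j \<in> ?N (Suc i) \<longleftrightarrow> Suc i \<in> ?N (Suc j)" using band_neighbours_sym by blast
    thus ?thesis using ent[of "Suc i" "Suc j"] ent[of "Suc j" "Suc i"] that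
      by (simp add: insert_commute)
  qed
  note S = sum_eigenvalue_power[OF A sym]
  show "length (eigenvalue_list ?A) = n" by (rule S(1))
  have "(\<Sum>i<n. (eigenvalue_list ?A ! i) ^ k) = (\<Sum>i<n. (?A ^\<^sub>m k) $$ (i, i))" by (rule S(2))
  also have "\<dots> = (\<Sum>x\<in>{1..n}. (?A ^\<^sub>m k) $$ (x - 1, x - 1))"
    by (rule sum.reindex_bij_witness[of _ "\<lambda>y. y - 1" Suc]) auto
  also have "\<dots> = (\<Sum>x\<in>{1..n}. \<Sum>ys\<in>walks_from ?N x k.
      if last (x # ys) = x then prod_list (map w (edges (x # ys))) else 0)"
    by (intro sum.cong refl mat_pow_walks[OF A NV ent]) auto
  also have "\<dots> = (\<Sum>xs\<in>walks {1..n} ?N k. if hd xs = last xs then prod_list (map w (edges xs)) else 0)"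
    unfolding sum_walks[OF finite_N finV] by (intro sum.cong refl if_cong) auto
  also have "\<dots> = (\<Sum>xs\<in>closed_walks k. prod_list (map w (edges xs)))"
    unfolding closed_walks_def by (rule sum.inter_filter[symmetric]) (intro finite_walks finite_N finV)
  also have "\<dots> = (\<Sum>xs\<in>closed_walks k. c ^ k * X (edges xs) \<omega>)"
  proof (intro sum.cong refl)
    fix xs assume "xs \<in> closed_walks k"
    hence len: "length (edges xs) = k" using closed_walkD(1) by simp
    have "prod_list (map w es) = c ^ length es * X es \<omega>" for es
      by (induction es) (auto simp: w_def mult_ac)
    thus "prod_list (map w (edges xs)) = c ^ k * X (edges xs) \<omega>" using len by simp
  qed
  also have "\<dots> = (\<Sum>xs\<in>closed_walks k. X (edges xs) \<omega>) / real (b n) powr (real k / 2)"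
  proof -
    have "c ^ k = real (b n) powr (- real k / 2)"
      using B1 by (simp add: c_def powr_realpow[symmetric] powr_powr)
    also have "\<dots> = 1 / real (b n) powr (real k / 2)"
      by (simp add: powr_minus_divide)
    finally show ?thesis by (simp add: sum_distrib_left[symmetric] sum_divide_distrib)
  qed
  finally show "(\<Sum>i<n. (eigenvalue_list ?A ! i) ^ k) / real n = moment k \<omega>"
    using card_atLeastAtMost[of 1 n]
    by (simp only: moment_def scale_def divide_divide_eq_left diff_Suc_1 mult.commute)
qed

section \<open>Convergence of the empirical moments\<close>

text \<open>By monotone convergence the pointwise series has finite expectation, so it converges
  almost surely and its terms tend to 0.\<close>

lemma (in prob_space) AE_tendsto_0_summable:
  fixes W :: "nat \<Rightarrow> 'a \<Rightarrow> real"
  assumes int: "\<And>n. integrable M (W n)" and nonneg: "\<And>n \<omega>. W n \<omega> \<ge> 0"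
    and le: "\<And>n. expectation (W n) \<le> e n" and e: "summable e"
  shows "AE \<omega> in M. (\<lambda>n. W n \<omega>) \<longlonglongrightarrow> 0"
proof -
  have [measurable]: "W n \<in> borel_measurable M" for n using int by auto
  have e0: "e n \<ge> 0" for n using order_trans[OF integral_nonneg_AE le] nonneg by simp
  have "(\<integral>\<^sup>+ \<omega>. (\<Sum>n. ennreal (W n \<omega>)) \<partial>M) = (\<Sum>n. \<integral>\<^sup>+ \<omega>. ennreal (W n \<omega>) \<partial>M)"
    by (intro nn_integral_suminf) auto
  also have "\<dots> = (\<Sum>n. ennreal (expectation (W n)))"
    using int nonneg by (intro suminf_cong nn_integral_eq_integral) auto
  also have "\<dots> \<le> (\<Sum>n. ennreal (e n))"
    using le by (intro suminf_le ennreal_leI) auto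
  also have "\<dots> = ennreal (\<Sum>n. e n)" using e e0 by (intro suminf_ennreal2) auto
  finally have "(\<integral>\<^sup>+ \<omega>. (\<Sum>n. ennreal (W n \<omega>)) \<partial>M) \<noteq> \<infinity>"
    by (metis ennreal_less_top infinity_ennreal_def leD top.not_eq_extremum)
  hence "AE \<omega> in M. (\<Sum>n. ennreal (W n \<omega>)) \<noteq> \<infinity>" by (intro nn_integral_PInf_AE) auto
  thus ?thesis
  proof eventually_elim
    case (elim \<omega>)
    hence "summable (\<lambda>n. W n \<omega>)" using nonneg by (intro summable_suminf_not_top) auto
    thus ?case by (rule summable_LIMSEQ_zero)
  qed
qed

text \<open>Markov's inequality around the moving centre \<open>c n\<close>, which is eventually
  within \<open>\<epsilon> / 2\<close> of the limit.\<close>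

lemma (in prob_space) tendsto_prob_of_L2:
  fixes Z :: "nat \<Rightarrow> 'a \<Rightarrow> real"
  assumes meas: "\<And>n. Z n \<in> borel_measurable M" and int: "\<And>n. integrable M (\<lambda>\<omega>. (Z n \<omega> - c n)\<^sup>2)"
    and lim: "(\<lambda>n. expectation (\<lambda>\<omega>. (Z n \<omega> - c n)\<^sup>2)) \<longlonglongrightarrow> 0" and c: "c \<longlonglongrightarrow> m" and \<epsilon>: "\<epsilon> > 0"
  shows "(\<lambda>n. prob {\<omega> \<in> space M. \<bar>Z n \<omega> - m\<bar> > \<epsilon>}) \<longlonglongrightarrow> 0"
proof (rule tendsto_sandwich[OF _ _ tendsto_const])
  note [measurable] = meas
  have "\<forall>\<^sub>F n in sequentially. \<bar>c n - m\<bar> < \<epsilon> / 2"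
    using tendstoD[OF c, of "\<epsilon> / 2"] \<epsilon> by (simp add: dist_real_def)
  thus "\<forall>\<^sub>F n in sequentially. prob {\<omega> \<in> space M. \<bar>Z n \<omega> - m\<bar> > \<epsilon>}
      \<le> expectation (\<lambda>\<omega>. (Z n \<omega> - c n)\<^sup>2) / (\<epsilon> / 2)\<^sup>2"
  proof eventually_elim
    case (elim n)
    have "(\<epsilon> / 2)\<^sup>2 \<le> (Z n \<omega> - c n)\<^sup>2" if "\<bar>Z n \<omega> - m\<bar> > \<epsilon>" for \<omega>
    proof -
      have "\<epsilon> / 2 \<le> \<bar>Z n \<omega> - c n\<bar>" using that elim by linarith
      hence "(\<epsilon> / 2)\<^sup>2 \<le> \<bar>Z n \<omega> - c n\<bar>\<^sup>2" using \<epsilon> by (intro power_mono) auto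
      thus ?thesis by simp
    qed
    hence "prob {\<omega> \<in> space M. \<bar>Z n \<omega> - m\<bar> > \<epsilon>} \<le> prob {\<omega> \<in> space M. (\<epsilon> / 2)\<^sup>2 \<le> (Z n \<omega> - c n)\<^sup>2}"
      by (intro finite_measure_mono) auto
    also have "\<dots> \<le> expectation (\<lambda>\<omega>. (Z n \<omega> - c n)\<^sup>2) / (\<epsilon> / 2)\<^sup>2"
      using \<epsilon> by (intro integral_Markov_inequality_measure[OF int sets.empty_sets]) auto
    finally show ?case .
  qed
  show "(\<lambda>n. expectation (\<lambda>\<omega>. (Z n \<omega> - c n)\<^sup>2) / (\<epsilon> / 2)\<^sup>2) \<longlonglongrightarrow> 0"
    using tendsto_divide[OF lim tendsto_const[of "(\<epsilon> / 2)\<^sup>2"]] \<epsilon> by simp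
qed simp

section \<open>Reduction of the semicircle law to convergence of each empirical moment\<close>

locale band_scheme = prob_space M for M :: "'w measure" +
  fixes a :: "nat \<Rightarrow> nat \<Rightarrow> nat \<Rightarrow> 'w \<Rightarrow> real" and b :: "nat \<Rightarrow> nat"
  assumes tri: "triangular_scheme M a" and mom: "all_moments_exist M a"
    and band: "\<And>n. n \<ge> 1 \<Longrightarrow> bandwidth n (b n)" and b_top: "filterlim b at_top sequentially"
begin

abbreviation ev :: "nat \<Rightarrow> 'w \<Rightarrow> nat \<Rightarrow> real" where
  "ev n \<omega> i \<equiv> eigenvalue_list (band_matrix a b n \<omega>) ! i"

definition emp_moment :: "nat \<Rightarrow> nat \<Rightarrow> 'w \<Rightarrow> real" where
  "emp_moment n k \<omega> = (\<Sum>i<n. ev n \<omega> i ^ k) / real n"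

lemma edge_vars:
  assumes n: "n \<ge> 1"
  shows "edge_variables M {1..n} (band_neighbours n (b n)) (b n) (edge_entry a n)"
proof unfold_locales
  show "card (band_neighbours n (b n) x) = b n" if "x \<in> {1..n}" for x
    using card_band_neighbours[OF band[OF n] that] .
  show "1 \<le> b n" "b n \<le> card {1..n}" using band[OF n] n by (auto simp: bandwidth_def)
  show "x \<in> band_neighbours n (b n) y" if "y \<in> band_neighbours n (b n) x" for x y
    using that by (rule band_neighbours_sym)
  show "integrable M (\<lambda>\<omega>. edge_entry a n e \<omega> ^ k)" if "e \<in> edges_in {1..n}" for e k
    using edges_in_Min_Max[OF that] mom n by (auto simp: all_moments_exist_def edge_entry_def)
qed (auto simp: band_neighbours_def)

abbreviation walk_moment :: "nat \<Rightarrow> nat \<Rightarrow> 'w \<Rightarrow> real" where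
  "walk_moment n \<equiv> edge_variables.moment {1..n} (band_neighbours n (b n)) (b n) (edge_entry a n)"

abbreviation tree_moment :: "nat \<Rightarrow> nat \<Rightarrow> 'w \<Rightarrow> real" where
  "tree_moment n \<equiv> edge_variables.tree_moment {1..n} (band_neighbours n (b n)) (b n) (edge_entry a n)"

abbreviation rest_moment :: "nat \<Rightarrow> nat \<Rightarrow> 'w \<Rightarrow> real" where
  "rest_moment n \<equiv> edge_variables.rest_moment {1..n} (band_neighbours n (b n)) (b n) (edge_entry a n)"

abbreviation tree_density :: "nat \<Rightarrow> nat \<Rightarrow> real" where
  "tree_density n \<equiv> edge_variables.tree_density {1..n} (band_neighbours n (b n)) (b n)"

lemma emp_moment_eq: "n \<ge> 1 \<Longrightarrow> \<omega> \<in> space M \<Longrightarrow> emp_moment n k \<omega> = walk_moment n k \<omega>"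
  unfolding emp_moment_def by (rule sum_eigenvalue_power_walks(2)[OF _ tri _ edge_vars])

text \<open>On \<open>space M\<close> the power sums are polynomials in the entries, so
  measurability of individual eigenvalues is never addressed.\<close>

lemma measurable_emp_moment: "emp_moment n k \<in> borel_measurable M"
proof (cases "n \<ge> 1")
  case True
  have "walk_moment n k \<in> borel_measurable M"
    using edge_variables.integrable_moment[OF edge_vars[OF True]] by auto
  thus ?thesis by (subst measurable_cong[OF emp_moment_eq[OF True]])
next
  case False
  thus ?thesis by (simp add: emp_moment_def[abs_def] not_le)
qed

lemma integral_esd_band_matrix:
  fixes f :: "real \<Rightarrow> real"
  shows "f \<in> borel_measurable borel \<Longrightarrow> (\<integral>x. f x \<partial>esd (band_matrix a b n \<omega>)) = (\<Sum>i<n. f (ev n \<omega> i)) / real n"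
  by (rule integral_esd) (auto simp: band_matrix_def)

lemma measurable_integral_esd:
  fixes f :: "real \<Rightarrow> real"
  assumes "continuous_on UNIV f"
  shows "(\<lambda>\<omega>. \<integral>x. f x \<partial>esd (band_matrix a b n \<omega>)) \<in> borel_measurable M"
proof (cases "n \<ge> 1")
  case True
  have f: "f \<in> borel_measurable borel" using assms by (rule borel_measurable_continuous_onI)
  have "(\<lambda>\<omega>. emp_moment n k \<omega> * real n) \<in> borel_measurable M" for k
    using measurable_emp_moment[of n k] by measurable
  hence "(\<lambda>\<omega>. \<Sum>i<n. ev n \<omega> i ^ k) \<in> borel_measurable M" for k
    using True by (simp add: emp_moment_def)
  thus ?thesis unfolding integral_esd_band_matrix[OF f]
    by (rule measurable_eigenvalue_average[OF assms])
next
  case False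
  have f: "f \<in> borel_measurable borel" using assms by (rule borel_measurable_continuous_onI)
  show ?thesis unfolding integral_esd_band_matrix[OF f] using False by (simp add: not_le)
qed

lemma criterion:
  fixes f :: "real \<Rightarrow> real"
  assumes "continuous_on UNIV f" "bounded (range f)" "\<epsilon> > 0"
  shows "\<exists>K \<delta>. \<delta> > 0 \<and> (\<forall>n\<ge>1. \<forall>\<omega>.
    (\<forall>k\<le>K. \<bar>emp_moment n k \<omega> - real (ballot k 0)\<bar> \<le> \<delta>) \<longrightarrow>
    \<bar>(\<integral>x. f x \<partial>esd (band_matrix a b n \<omega>)) - (\<integral>x. f x \<partial>semicircle)\<bar> \<le> \<epsilon>)"
proof -
  obtain Bd where "\<And>x. \<bar>f x\<bar> \<le> Bd" using assms(2) by (auto simp: bounded_iff)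
  from moment_criterion[OF assms(1) this assms(3)] show ?thesis
    unfolding integral_esd_band_matrix[OF borel_measurable_continuous_onI[OF assms(1)]] emp_moment_def
    by blast
qed

lemma emp_moment_0: "n \<ge> 1 \<Longrightarrow> emp_moment n 0 \<omega> = 1"
  by (simp add: emp_moment_def)

text \<open>By \<open>criterion\<close> a large deviation for \<open>f\<close> is covered by
  finitely many moment deviations, so a union bound suffices. Order 0 drops out because that moment
  is exactly 1.\<close>

lemma semicircle_law_in_probI:
  assumes lim: "\<And>k \<epsilon>. k \<ge> 1 \<Longrightarrow> \<epsilon> > 0 \<Longrightarrow>
    (\<lambda>n. prob {\<omega> \<in> space M. \<bar>emp_moment n k \<omega> - real (ballot k 0)\<bar> > \<epsilon>}) \<longlonglongrightarrow> 0"
  shows "semicircle_law_in_prob M (band_matrix a b)"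
  unfolding semicircle_law_in_prob_def tendsto_in_prob_def
proof (intro allI impI conjI)
  fix f :: "real \<Rightarrow> real" and n
  assume f: "continuous_on UNIV f \<and> bounded (range f)"
  show "(\<lambda>\<omega>. \<integral>x. f x \<partial>esd (band_matrix a b n \<omega>)) \<in> borel_measurable M"
    using measurable_integral_esd f by blast
next
  fix f :: "real \<Rightarrow> real" and \<epsilon> :: real
  assume f: "continuous_on UNIV f \<and> bounded (range f)" and \<epsilon>: "\<epsilon> > 0"
  obtain K \<delta> where \<delta>: "\<delta> > 0" and crit: "\<And>n \<omega>. n \<ge> 1 \<Longrightarrow>
      (\<forall>k\<le>K. \<bar>emp_moment n k \<omega> - real (ballot k 0)\<bar> \<le> \<delta>) \<Longrightarrow>
      \<bar>(\<integral>x. f x \<partial>esd (band_matrix a b n \<omega>)) - (\<integral>x. f x \<partial>semicircle)\<bar> \<le> \<epsilon>"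
    using criterion[of f \<epsilon>] f \<epsilon> by blast
  let ?P = "\<lambda>n k. {\<omega> \<in> space M. \<bar>emp_moment n k \<omega> - real (ballot k 0)\<bar> > \<delta>}"
  let ?E = "\<lambda>n. {\<omega> \<in> space M. \<bar>(\<integral>x. f x \<partial>esd (band_matrix a b n \<omega>)) - (\<integral>x. f x \<partial>semicircle)\<bar> > \<epsilon>}"
  note [measurable] = measurable_emp_moment
  show "(\<lambda>n. prob {\<omega> \<in> space M. \<bar>(\<integral>x. f x \<partial>esd (band_matrix a b n \<omega>)) - (\<integral>x. f x \<partial>semicircle)\<bar> > \<epsilon>}) \<longlonglongrightarrow> 0"
  proof (rule tendsto_sandwich[OF _ _ tendsto_const])
    have "prob (?E n)
        \<le> (\<Sum>k\<in>{1..K}. prob (?P n k))" if n: "n \<ge> 1" for n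
    proof -
      have "?E n
          \<subseteq> (\<Union>k\<in>{1..K}. ?P n k)"
      proof
        fix \<omega> assume \<omega>: "\<omega> \<in> ?E n"
        hence "\<not> (\<forall>k\<le>K. \<bar>emp_moment n k \<omega> - real (ballot k 0)\<bar> \<le> \<delta>)" using crit[OF n, of \<omega>] by auto
        then obtain k where k: "k \<le> K" "\<bar>emp_moment n k \<omega> - real (ballot k 0)\<bar> > \<delta>" by auto
        have "k \<noteq> 0" using k(2) \<delta> emp_moment_0[OF n] by (intro notI) simp
        thus "\<omega> \<in> (\<Union>k\<in>{1..K}. ?P n k)" using k \<omega> by auto
      qed
      hence "prob (?E n)
          \<le> prob (\<Union>k\<in>{1..K}. ?P n k)"
        by (intro finite_measure_mono) auto
      also have "\<dots> \<le> (\<Sum>k\<in>{1..K}. prob (?P n k))"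
        by (intro finite_measure_subadditive_finite) auto
      finally show ?thesis .
    qed
    thus "\<forall>\<^sub>F n in sequentially.
        prob (?E n)
        \<le> (\<Sum>k\<in>{1..K}. prob (?P n k))"
      by (auto simp: eventually_sequentially)
    show "(\<lambda>n. \<Sum>k\<in>{1..K}. prob (?P n k)) \<longlonglongrightarrow> 0"
      using lim \<delta> by (intro tendsto_null_sum) auto
  qed simp
qed

text \<open>The exceptional sets of the countably many moments unite to a null set, off which
  \<open>criterion\<close> applies to each outcome.\<close>

lemma semicircle_law_almost_surelyI:
  assumes lim: "\<And>k. k \<ge> 1 \<Longrightarrow> AE \<omega> in M. (\<lambda>n. emp_moment n k \<omega>) \<longlonglongrightarrow> real (ballot k 0)"
  shows "semicircle_law_almost_surely M (band_matrix a b)"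
  unfolding semicircle_law_almost_surely_def
proof (intro allI impI)
  fix f :: "real \<Rightarrow> real"
  assume f: "continuous_on UNIV f \<and> bounded (range f)"
  have "AE \<omega> in M. \<forall>k. k \<ge> 1 \<longrightarrow> (\<lambda>n. emp_moment n k \<omega>) \<longlonglongrightarrow> real (ballot k 0)"
    unfolding AE_all_countable using lim by auto
  thus "AE \<omega> in M. (\<lambda>n. \<integral>x. f x \<partial>esd (band_matrix a b n \<omega>)) \<longlonglongrightarrow> (\<integral>x. f x \<partial>semicircle)"
  proof eventually_elim
    case (elim \<omega>)
    have all: "(\<lambda>n. emp_moment n k \<omega>) \<longlonglongrightarrow> real (ballot k 0)" for k
    proof (cases "k = 0")
      case True
      have "(\<lambda>n. 1) \<longlonglongrightarrow> real (ballot k 0)" using True by simp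
      moreover have "\<forall>\<^sub>F n in sequentially. 1 = emp_moment n k \<omega>"
        using True emp_moment_0 by (auto simp: eventually_sequentially intro!: exI[of _ 1])
      ultimately show ?thesis by (rule Lim_transform_eventually)
    qed (use elim in auto)
    show ?case
    proof (rule LIMSEQ_I)
      fix r :: real assume r: "r > 0"
      obtain K \<delta> where \<delta>: "\<delta> > 0" and crit: "\<And>n \<omega>. n \<ge> 1 \<Longrightarrow>
          (\<forall>k\<le>K. \<bar>emp_moment n k \<omega> - real (ballot k 0)\<bar> \<le> \<delta>) \<Longrightarrow>
          \<bar>(\<integral>x. f x \<partial>esd (band_matrix a b n \<omega>)) - (\<integral>x. f x \<partial>semicircle)\<bar> \<le> r / 2"
        using criterion[of f "r / 2"] f r by (metis half_gt_zero)
      have "\<forall>\<^sub>F n in sequentially. \<forall>k\<in>{..K}. dist (emp_moment n k \<omega>) (real (ballot k 0)) < \<delta>"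
        using all \<delta> by (intro eventually_ball_finite) (auto simp: tendsto_iff)
      then obtain n0 where n0: "\<And>n k. n \<ge> n0 \<Longrightarrow> k \<le> K \<Longrightarrow> \<bar>emp_moment n k \<omega> - real (ballot k 0)\<bar> < \<delta>"
        by (auto simp: eventually_sequentially dist_real_def)
      have "norm ((\<integral>x. f x \<partial>esd (band_matrix a b n \<omega>)) - (\<integral>x. f x \<partial>semicircle)) < r" if "n \<ge> max 1 n0" for n
        using crit[of n \<omega>] n0[of n] that r by (force simp: less_imp_le)
      thus "\<exists>no. \<forall>n\<ge>no. norm ((\<integral>x. f x \<partial>esd (band_matrix a b n \<omega>)) - (\<integral>x. f x \<partial>semicircle)) < r" by blast
    qed
  qed
qed

text \<open>The lower bound on the tree count only loses the factor
  \<open>(1 - (k + 1) / b n) powr (k / 2)\<close>, which tends to 1 as the bandwidth grows.\<close>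

lemma tree_density_tendsto: "(\<lambda>n. tree_density n k) \<longlonglongrightarrow> real (ballot k 0)"
proof (rule tendsto_sandwich)
  have br: "filterlim (\<lambda>n. real (b n)) at_top sequentially"
    using b_top filterlim_compose filterlim_real_sequentially by blast
  hence "(\<lambda>n. real (Suc k) / real (b n)) \<longlonglongrightarrow> 0"
    by (intro real_tendsto_divide_at_top[OF tendsto_const])
  hence "(\<lambda>n. real (ballot k 0) * (1 - real (Suc k) / real (b n)) powr (real k / 2))
      \<longlonglongrightarrow> real (ballot k 0) * (1 - 0) powr (real k / 2)"
    by (intro tendsto_intros) auto
  thus "(\<lambda>n. real (ballot k 0) * (1 - real (Suc k) / real (b n)) powr (real k / 2)) \<longlonglongrightarrow> real (ballot k 0)"
    by simp
  have "\<forall>\<^sub>F n in sequentially. Suc (Suc k) \<le> b n" using b_top by (auto simp: filterlim_at_top)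
  hence "\<forall>\<^sub>F n in sequentially. b n > Suc k \<and> n \<ge> 1"
    using eventually_ge_at_top[of 1] by eventually_elim simp
  thus "\<forall>\<^sub>F n in sequentially. real (ballot k 0) * (1 - real (Suc k) / real (b n)) powr (real k / 2) \<le> tree_density n k"
    by eventually_elim (use edge_variables.tree_density_ge[OF edge_vars] in blast)
  show "\<forall>\<^sub>F n in sequentially. tree_density n k \<le> real (ballot k 0)"
    using edge_variables.tree_density_le[OF edge_vars] by (auto simp: eventually_sequentially)
qed simp

end

section \<open>From correlation bounds to convergence of moments\<close>

context band_scheme
begin

text \<open>Common interface of almost uncorrelated schemes with \<open>\<alpha> \<ge> 1 / 2\<close>
  and of Wigner schemes, phrased for edge lists so that it applies directly to concatenated
  walks.\<close>

definition correlation_bound :: "(nat \<Rightarrow> real) \<Rightarrow> bool" where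
  "correlation_bound C \<longleftrightarrow> (\<forall>n\<ge>1. \<forall>es. set es \<subseteq> edges_in {1..n} \<longrightarrow> es \<noteq> [] \<longrightarrow>
    \<bar>expectation (edge_prod (edge_entry a n) es)\<bar>
      \<le> C (length es) * real n powr (- real (card (single_edges es)) / 2))"

definition square_bound :: "(nat \<Rightarrow> nat \<Rightarrow> real) \<Rightarrow> bool" where
  "square_bound CC \<longleftrightarrow> (\<forall>n\<ge>1. \<forall>F. F \<subseteq> edges_in {1..n} \<longrightarrow> F \<noteq> {} \<longrightarrow>
    \<bar>expectation (\<lambda>\<omega>. \<Prod>e\<in>F. (edge_entry a n e \<omega>)\<^sup>2) - 1\<bar> \<le> CC (card F) n)"

lemmas correlation_boundD = correlation_bound_def[THEN iffD1, rule_format]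
lemmas square_boundD = square_bound_def[THEN iffD1, rule_format]

lemma correlation_bound_weak:
  assumes "correlation_bound C" "\<And>m. C m \<ge> 0" and n: "n \<ge> 1"
    and es: "set es \<subseteq> edges_in {1..n}" "es \<noteq> []"
  shows "\<bar>expectation (edge_prod (edge_entry a n) es)\<bar> \<le> C (length es)"
proof -
  have "real n powr (- real (card (single_edges es)) / 2) \<le> real n powr 0"
    using n by (intro powr_mono) auto
  hence "C (length es) * real n powr (- real (card (single_edges es)) / 2) \<le> C (length es) * 1"
    using n assms(2) by (intro mult_left_mono) auto
  thus ?thesis using correlation_boundD[OF assms(1) n es] by linarith
qed

text \<open>Tree part and rest are joined by \<open>(u + v)^2 \<le> 2 u^2 + 2 v^2\<close>. The
  superscripts \<open>k\<close> and \<open>k div 2\<close> are the edge numbers of two edge-disjoint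
  double trees and of a single one. \<open>R\<close> does not depend on \<open>n\<close>.\<close>

lemma sequence_bounds:
  assumes bound: "correlation_bound C"
    and square: "square_bound CC"
    and C: "\<And>m. C m \<ge> 0" and CC: "\<And>m n. CC m n \<ge> 0" and k: "k \<ge> 1"
  obtains R where "\<And>n. n \<ge> 1 \<Longrightarrow> integrable M (\<lambda>\<omega>. (walk_moment n k \<omega> - tree_density n k)\<^sup>2)"
    "\<And>n. n \<ge> 1 \<Longrightarrow> expectation (\<lambda>\<omega>. (walk_moment n k \<omega> - tree_density n k)\<^sup>2)
      \<le> R * (1 / (real (b n))\<^sup>2 + CC k n + CC (k div 2) n)"
proof -
  define R1 where "R1 = (C (2 * k) + 2 * C k + 1) * (real (2 * Suc k) + 1) ^ (2 * Suc k)"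
  define R2 where "R2 = C (2 * k) * (real (2 * Suc k) + 1) ^ (Suc k * 2)"
  define Q where "Q = (real (ballot k 0))\<^sup>2"
  define R where "R = 2 * R1 + 4 * Q + 2 * R2"
  have pos: "R1 \<ge> 0" "R2 \<ge> 0" "Q \<ge> 0" using C by (auto simp: R1_def R2_def Q_def)
  have main: "integrable M (\<lambda>\<omega>. (walk_moment n k \<omega> - tree_density n k)\<^sup>2) \<and>
      expectation (\<lambda>\<omega>. (walk_moment n k \<omega> - tree_density n k)\<^sup>2)
      \<le> R * (1 / (real (b n))\<^sup>2 + CC k n + CC (k div 2) n)" if n: "n \<ge> 1" for n
  proof -
    interpret E: edge_variables M "{1..n}" "band_neighbours n (b n)" "b n" "edge_entry a n"
      by (rule edge_vars[OF n])
    note b' = correlation_bound_weak[OF bound C n]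
    note T = E.expectation_tree_moment_le[where C = C and c = "\<lambda>m. CC m n", OF b' square_boundD[OF square n] C CC k]
    have Rm: "expectation (\<lambda>\<omega>. rest_moment n k \<omega> ^ 2) \<le> R2 / real (b n) ^ 2"
      using E.expectation_rest_moment_power_le[where C = C and z = 2 and k = k] correlation_boundD[OF bound n] C k
      by (simp add: R2_def)
    note Ri = E.integrable_rest_moment_power[of k 2]
    have sq: "(walk_moment n k \<omega> - tree_density n k)\<^sup>2
        \<le> 2 * (tree_moment n k \<omega> - tree_density n k)\<^sup>2 + 2 * rest_moment n k \<omega> ^ 2" for \<omega>
    proof -
      have "(u + v)\<^sup>2 \<le> 2 * u\<^sup>2 + 2 * v\<^sup>2" for u v :: real
        using sum_squares_bound[of u v] by (simp add: power2_sum)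
      from this[of "tree_moment n k \<omega> - tree_density n k" "rest_moment n k \<omega>"]
      show ?thesis unfolding E.moment_split by (simp add: algebra_simps)
    qed
    have int: "integrable M (\<lambda>\<omega>. 2 * (tree_moment n k \<omega> - tree_density n k)\<^sup>2 + 2 * rest_moment n k \<omega> ^ 2)"
      using T(1) Ri by auto
    have meas: "walk_moment n k \<in> borel_measurable M" using E.integrable_moment by auto
    have int': "integrable M (\<lambda>\<omega>. (walk_moment n k \<omega> - tree_density n k)\<^sup>2)"
    proof (rule Bochner_Integration.integrable_bound[OF int])
      show "(\<lambda>\<omega>. (walk_moment n k \<omega> - tree_density n k)\<^sup>2) \<in> borel_measurable M" using meas by measurable
    qed (use sq in auto)
    have "expectation (\<lambda>\<omega>. (walk_moment n k \<omega> - tree_density n k)\<^sup>2)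
        \<le> expectation (\<lambda>\<omega>. 2 * (tree_moment n k \<omega> - tree_density n k)\<^sup>2 + 2 * rest_moment n k \<omega> ^ 2)"
      using sq by (intro integral_mono int int') auto
    also have "\<dots> = 2 * expectation (\<lambda>\<omega>. (tree_moment n k \<omega> - tree_density n k)\<^sup>2)
        + 2 * expectation (\<lambda>\<omega>. rest_moment n k \<omega> ^ 2)"
      using T(1) Ri by simp
    also have "\<dots> \<le> 2 * (R1 / (real (b n))\<^sup>2 + (CC k n + 2 * CC (k div 2) n) * Q) + 2 * (R2 / (real (b n))\<^sup>2)"
      using T(2) Rm unfolding R1_def Q_def by (intro add_mono mult_left_mono) auto
    also have "\<dots> \<le> R * (1 / (real (b n))\<^sup>2 + CC k n + CC (k div 2) n)"
    proof -
      have "2 * (R1 * x + (u + 2 * v) * Q) + 2 * (R2 * x) \<le> R * (x + u + v)"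
        if "x \<ge> 0" "u \<ge> 0" "v \<ge> 0" for x u v
      proof -
        have "R * (x + u + v) - (2 * (R1 * x + (u + 2 * v) * Q) + 2 * (R2 * x))
            = 2 * R1 * (u + v) + 4 * Q * x + 2 * Q * u + 2 * R2 * (u + v)"
          by (simp add: R_def algebra_simps)
        also have "\<dots> \<ge> 0" using that pos by simp
        finally show ?thesis by simp
      qed
      from this[of "1 / (real (b n))\<^sup>2" "CC k n" "CC (k div 2) n"] show ?thesis using CC by simp
    qed
    finally show ?thesis using int' by blast
  qed
  show thesis by (rule that[OF conjunct1[OF main] conjunct2[OF main]])
qed

lemma tendsto_inverse_bandwidth_power: "z \<ge> 1 \<Longrightarrow> (\<lambda>n. 1 / real (b n) ^ z) \<longlonglongrightarrow> 0"
proof -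
  assume z: "z \<ge> 1"
  have br: "filterlim (\<lambda>n. real (b n)) at_top sequentially"
    using b_top filterlim_compose filterlim_real_sequentially by blast
  hence "filterlim (\<lambda>n. real (b n) ^ z) at_top sequentially"
    using z by (intro filterlim_pow_at_top) auto
  thus ?thesis by (intro real_tendsto_divide_at_top[OF tendsto_const])
qed

text \<open>The bounds start at index 1, hence the shift by one in the series. The even exponent
  covers second moments with \<open>z = 1\<close> and fourth moments with
  \<open>z = 2\<close>.\<close>

lemma AE_emp_moment_tendstoI:
  assumes int: "\<And>n. n \<ge> 1 \<Longrightarrow> integrable M (\<lambda>\<omega>. (walk_moment n k \<omega> - c n) ^ (2 * z))"
    and le: "\<And>n. n \<ge> 1 \<Longrightarrow> expectation (\<lambda>\<omega>. (walk_moment n k \<omega> - c n) ^ (2 * z)) \<le> e n"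
    and e: "summable e" and c: "c \<longlonglongrightarrow> m" and z: "z \<ge> 1"
  shows "AE \<omega> in M. (\<lambda>n. emp_moment n k \<omega>) \<longlonglongrightarrow> m"
proof -
  have "AE \<omega> in M. (\<lambda>n. (walk_moment (Suc n) k \<omega> - c (Suc n)) ^ (2 * z)) \<longlonglongrightarrow> 0"
    using e by (intro AE_tendsto_0_summable[where e = "\<lambda>n. e (Suc n)"] int le)
      (auto simp: summable_Suc_iff zero_le_even_power)
  with AE_space show ?thesis
  proof eventually_elim
    case (elim \<omega>)
    have "(\<lambda>n. root (2 * z) ((walk_moment (Suc n) k \<omega> - c (Suc n)) ^ (2 * z))) \<longlonglongrightarrow> root (2 * z) 0"
      by (intro tendsto_real_root elim)
    moreover have "root (2 * z) (u ^ (2 * z)) = \<bar>u\<bar>" for u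
      using z real_root_power_cancel[of "2 * z" "\<bar>u\<bar>"] by (simp add: power_even_abs)
    ultimately have "(\<lambda>n. \<bar>walk_moment (Suc n) k \<omega> - c (Suc n)\<bar>) \<longlonglongrightarrow> 0" by simp
    hence "(\<lambda>n. walk_moment (Suc n) k \<omega> - c (Suc n)) \<longlonglongrightarrow> 0" by (rule tendsto_rabs_zero_cancel)
    from tendsto_add[OF this LIMSEQ_Suc[OF c]]
    have "(\<lambda>n. emp_moment (Suc n) k \<omega>) \<longlonglongrightarrow> m" using emp_moment_eq[OF _ elim(1)] by simp
    thus ?case by (rule LIMSEQ_imp_Suc)
  qed
qed

lemma semicircle_law_in_prob_of_bounds:
  assumes bound: "correlation_bound C"
    and square: "square_bound CC"
    and C: "\<And>m. C m \<ge> 0" and CC: "\<And>m n. CC m n \<ge> 0" and lim: "\<And>m. CC m \<longlonglongrightarrow> 0"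
  shows "semicircle_law_in_prob M (band_matrix a b)"
proof (rule semicircle_law_in_probI)
  fix k :: nat and \<epsilon> :: real assume k: "k \<ge> 1" and \<epsilon>: "\<epsilon> > 0"
  obtain R where R: "\<And>n. n \<ge> 1 \<Longrightarrow> integrable M (\<lambda>\<omega>. (walk_moment n k \<omega> - tree_density n k)\<^sup>2)"
    "\<And>n. n \<ge> 1 \<Longrightarrow> expectation (\<lambda>\<omega>. (walk_moment n k \<omega> - tree_density n k)\<^sup>2)
      \<le> R * (1 / (real (b n))\<^sup>2 + CC k n + CC (k div 2) n)"
    using sequence_bounds[OF bound square C CC k] by blast
  have emp: "integrable M (\<lambda>\<omega>. (emp_moment n k \<omega> - tree_density n k)\<^sup>2)"
    "expectation (\<lambda>\<omega>. (emp_moment n k \<omega> - tree_density n k)\<^sup>2)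
      = expectation (\<lambda>\<omega>. (walk_moment n k \<omega> - tree_density n k)\<^sup>2)" if n: "n \<ge> 1" for n
  proof -
    have eq: "(emp_moment n k \<omega> - tree_density n k)\<^sup>2 = (walk_moment n k \<omega> - tree_density n k)\<^sup>2"
      if "\<omega> \<in> space M" for \<omega>
      by (simp only: emp_moment_eq[OF n that])
    show "integrable M (\<lambda>\<omega>. (emp_moment n k \<omega> - tree_density n k)\<^sup>2)"
      by (subst Bochner_Integration.integrable_cong[OF refl eq]) (assumption, rule R(1)[OF n])
    show "expectation (\<lambda>\<omega>. (emp_moment n k \<omega> - tree_density n k)\<^sup>2)
        = expectation (\<lambda>\<omega>. (walk_moment n k \<omega> - tree_density n k)\<^sup>2)"
      by (rule Bochner_Integration.integral_cong[OF refl eq])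
  qed
  show "(\<lambda>n. prob {\<omega> \<in> space M. \<bar>emp_moment n k \<omega> - real (ballot k 0)\<bar> > \<epsilon>}) \<longlonglongrightarrow> 0"
  proof (rule tendsto_prob_of_L2[OF measurable_emp_moment _ _ tree_density_tendsto \<epsilon>])
    show "integrable M (\<lambda>\<omega>. (emp_moment n k \<omega> - tree_density n k)\<^sup>2)" for n
    proof (cases "n \<ge> 1")
      \<comment> \<open>At index 0 the empirical moment is an empty sum divided by 0, hence 0, and
        the integrand is constant.\<close>
      case False
      thus ?thesis by (simp add: emp_moment_def not_le)
    qed (rule emp(1))
    show "(\<lambda>n. expectation (\<lambda>\<omega>. (emp_moment n k \<omega> - tree_density n k)\<^sup>2)) \<longlonglongrightarrow> 0"
    proof (rule tendsto_sandwich[OF _ _ tendsto_const])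
      show "\<forall>\<^sub>F n in sequentially. expectation (\<lambda>\<omega>. (emp_moment n k \<omega> - tree_density n k)\<^sup>2)
          \<le> R * (1 / (real (b n))\<^sup>2 + CC k n + CC (k div 2) n)"
        using R(2) emp(2) unfolding eventually_sequentially by (intro exI[of _ 1]) auto
      have "(\<lambda>n. R * (1 / (real (b n))\<^sup>2 + CC k n + CC (k div 2) n)) \<longlonglongrightarrow> R * (0 + 0 + 0)"
        using lim by (intro tendsto_intros tendsto_inverse_bandwidth_power) auto
      thus "(\<lambda>n. R * (1 / (real (b n))\<^sup>2 + CC k n + CC (k div 2) n)) \<longlonglongrightarrow> 0" by simp
    qed simp
  qed
qed

text \<open>Translates a set of edges into the indexed pairs of the correlation conditions. Ordering
  each pair makes \<open>edge_entry\<close> literally the entry \<open>a n (p i) (q i)\<close>, also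
  outside \<open>space M\<close>.\<close>

lemma edges_enumeration:
  assumes F: "F \<subseteq> edges_in {1..n::nat}"
  obtains p q where "fund_diff_pairs n (card F) p q" "bij_betw (\<lambda>i. {p i, q i}) {1..card F} F"
    "\<And>i. i \<in> {1..card F} \<Longrightarrow> p i \<le> q i"
proof -
  have "edges_in {1..n} \<subseteq> Pow {1..n}" by (auto simp: edges_in_def)
  hence "finite F" using F finite_subset by (metis finite_Pow_iff finite_atLeastAtMost)
  then obtain h where h: "bij_betw h {1..card F} F" using ex_bij_betw_nat_finite_1 by blast
  define p q where "p i = Min (h i)" and "q i = Max (h i)" for i
  have pq: "p i \<in> {1..n}" "q i \<in> {1..n}" "h i = {p i, q i}" "p i \<le> q i" if "i \<in> {1..card F}" for i
  proof -
    have "h i \<in> edges_in {1..n}" using h F that bij_betwE by blast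
    from edges_in_Min_Max[OF this] show "p i \<in> {1..n}" "q i \<in> {1..n}" "h i = {p i, q i}" "p i \<le> q i"
      unfolding p_def q_def .
  qed
  have bij: "bij_betw (\<lambda>i. {p i, q i}) {1..card F} F"
    using h pq(3) by (subst bij_betw_cong[of _ _ h]) auto
  moreover have "fund_diff_pairs n (card F) p q"
    unfolding fund_diff_pairs_def using pq(1,2) inj_onD[OF bij_betw_imp_inj_on[OF bij]] by blast
  ultimately show thesis using that pq(4) by blast
qed

text \<open>The multiplicities in the list become the exponents \<open>\<delta>\<close>, so the
  exponents equal to 1 are the single edges. The condition is applied with
  \<open>N = n\<close>.\<close>

lemma AAU1_bound:
  assumes aau: "AAU1 M \<alpha> a C" and \<alpha>: "\<alpha> \<ge> 1 / 2" and n: "n \<ge> 1"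
    and es: "set es \<subseteq> edges_in {1..n}" "es \<noteq> []"
  shows "\<bar>expectation (edge_prod (edge_entry a n) es)\<bar>
    \<le> \<bar>C (length es)\<bar> * real n powr (- real (card (single_edges es)) / 2)"
proof -
  let ?F = "set es"
  obtain p q where pq: "fund_diff_pairs n (card ?F) p q" "bij_betw (\<lambda>i. {p i, q i}) {1..card ?F} ?F"
    "\<And>i. i \<in> {1..card ?F} \<Longrightarrow> p i \<le> q i"
    using edges_enumeration[OF es(1)] by blast
  define \<delta> where "\<delta> i = count_list es {p i, q i}" for i
  have mem: "{p i, q i} \<in> ?F" if "i \<in> {1..card ?F}" for i using pq(2) that bij_betwE by blast
  have \<delta>: "\<forall>i\<in>{1..card ?F}. \<delta> i \<ge> 1"
  proof
    fix i assume "i \<in> {1..card ?F}"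
    hence "count_list es {p i, q i} \<noteq> 0" using mem by (simp add: count_list_0_iff)
    thus "\<delta> i \<ge> 1" by (simp add: \<delta>_def)
  qed
  have l: "card ?F \<ge> 1" using es(2) by (simp add: Suc_le_eq card_gt_0_iff)
  have prod: "(\<Prod>i=1..card ?F. a n (p i) (q i) \<omega> ^ \<delta> i) = edge_prod (edge_entry a n) es \<omega>" for \<omega>
  proof -
    have "(\<Prod>i=1..card ?F. a n (p i) (q i) \<omega> ^ \<delta> i)
        = (\<Prod>i=1..card ?F. edge_entry a n {p i, q i} \<omega> ^ count_list es {p i, q i})"
      using pq(3) by (intro prod.cong) (auto simp: edge_entry_def \<delta>_def min_def max_def)
    also have "\<dots> = edge_prod (edge_entry a n) es \<omega>"
      unfolding edge_prod_eq_prod by (rule prod.reindex_bij_betw[OF pq(2)])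
    finally show ?thesis .
  qed
  have sum: "(\<Sum>i=1..card ?F. \<delta> i) = length es"
    unfolding \<delta>_def sum.reindex_bij_betw[OF pq(2), of "count_list es"] by (simp add: sum_count_set)
  have "single_edges es = (\<lambda>i. {p i, q i}) ` {i \<in> {1..card ?F}. \<delta> i = 1}"
  proof -
    have "(\<lambda>i. {p i, q i}) ` {i \<in> {1..card ?F}. \<delta> i = 1}
        = {e \<in> (\<lambda>i. {p i, q i}) ` {1..card ?F}. count_list es e = 1}" unfolding \<delta>_def by blast
    thus ?thesis unfolding bij_betw_imp_surj_on[OF pq(2)] by (simp only: single_edges_def)
  qed
  moreover have "inj_on (\<lambda>i. {p i, q i}) {i \<in> {1..card ?F}. \<delta> i = 1}"
    by (rule inj_on_subset[OF bij_betw_imp_inj_on[OF pq(2)]]) auto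
  ultimately have s: "card {i \<in> {1..card ?F}. \<delta> i = 1} = card (single_edges es)" by (simp add: card_image)
  have "\<bar>expectation (edge_prod (edge_entry a n) es)\<bar>
      \<le> C (length es) * real n powr (- \<alpha> * real (card (single_edges es)))"
    using aau[unfolded AAU1_def, rule_format, OF n l pq(1) _ order_refl, of \<delta>] \<delta>
    unfolding prod sum s by blast
  also have "\<dots> \<le> \<bar>C (length es)\<bar> * real n powr (- real (card (single_edges es)) / 2)"
  proof (intro mult_mono powr_mono)
    have "1 / 2 * real (card (single_edges es)) \<le> \<alpha> * real (card (single_edges es))"
      using \<alpha> by (intro mult_right_mono) auto
    thus "- \<alpha> * real (card (single_edges es)) \<le> - real (card (single_edges es)) / 2" by simp
  qed (use n in auto)
  finally show ?thesis .
qed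

lemma AAU1_correlation_bound: "AAU1 M \<alpha> a C \<Longrightarrow> \<alpha> \<ge> 1 / 2 \<Longrightarrow> correlation_bound (\<lambda>m. \<bar>C m\<bar>)"
  unfolding correlation_bound_def using AAU1_bound by blast

lemma AAU2_bound:
  assumes aau: "AAU2 M a CC" and n: "n \<ge> 1" and F: "F \<subseteq> edges_in {1..n}" "F \<noteq> {}"
  shows "\<bar>expectation (\<lambda>\<omega>. \<Prod>e\<in>F. (edge_entry a n e \<omega>)\<^sup>2) - 1\<bar> \<le> CC (card F) n" and "card F \<ge> 1"
proof -
  obtain p q where pq: "fund_diff_pairs n (card F) p q" "bij_betw (\<lambda>i. {p i, q i}) {1..card F} F"
    "\<And>i. i \<in> {1..card F} \<Longrightarrow> p i \<le> q i"
    using edges_enumeration[OF F(1)] by blast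
  show l: "card F \<ge> 1" using F(2) bij_betw_finite[OF pq(2)] by (simp add: Suc_le_eq card_gt_0_iff)
  have "(\<Prod>i=1..card F. a n (p i) (q i) \<omega> ^ 2) = (\<Prod>e\<in>F. (edge_entry a n e \<omega>)\<^sup>2)" for \<omega>
  proof -
    have "(\<Prod>i=1..card F. a n (p i) (q i) \<omega> ^ 2) = (\<Prod>i=1..card F. (edge_entry a n {p i, q i} \<omega>)\<^sup>2)"
      using pq(3) by (intro prod.cong) (auto simp: edge_entry_def min_def max_def)
    also have "\<dots> = (\<Prod>e\<in>F. (edge_entry a n e \<omega>)\<^sup>2)" by (rule prod.reindex_bij_betw[OF pq(2)])
    finally show ?thesis .
  qed
  thus "\<bar>expectation (\<lambda>\<omega>. \<Prod>e\<in>F. (edge_entry a n e \<omega>)\<^sup>2) - 1\<bar> \<le> CC (card F) n"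
    using aau[unfolded AAU2_def, rule_format, OF n l pq(1) order_refl] by simp
qed

text \<open>For \<open>n \<ge> l\<close> the loops at \<open>1, ..., l\<close> are \<open>l\<close>
  distinct edges, so the constant dominates an absolute value. This carries summability of the
  constants over to their absolute values.\<close>

lemma AAU2_constant_nonneg:
  assumes "AAU2 M a CC" "l \<ge> 1" "n \<ge> l"
  shows "CC l n \<ge> 0"
proof -
  let ?F = "(\<lambda>i. {i, i}) ` {1..l}"
  have "?F \<subseteq> edges_in {1..n}" "?F \<noteq> {}" using assms by (auto simp: edges_in_def)
  moreover have "card ?F = l" by (subst card_image) (auto simp: inj_on_def)
  ultimately show ?thesis using AAU2_bound(1)[OF assms(1), of n ?F] assms(2,3) by simp
qed

end

section \<open>Wigner schemes and the semicircle law\<close>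

lemma (in prob_space) abs_expectation_le: "\<bar>expectation (f :: 'a \<Rightarrow> real)\<bar> \<le> expectation (\<lambda>\<omega>. \<bar>f \<omega>\<bar>)"
  by (rule integral_abs_bound)

context band_scheme
begin

text \<open>Independence is indexed by positions on or above the diagonal, and
  \<open>(Min e, Max e)\<close> embeds the edges there injectively.\<close>

lemma wigner_expectation_prod:
  assumes w: "wigner_scheme M a" and n: "n \<ge> 1" and F: "F \<subseteq> edges_in {1..n}" "finite F"
  shows "expectation (\<lambda>\<omega>. \<Prod>e\<in>F. edge_entry a n e \<omega> ^ \<delta> e)
    = (\<Prod>e\<in>F. expectation (\<lambda>\<omega>. edge_entry a n e \<omega> ^ \<delta> e))"
proof -
  let ?g = "\<lambda>e :: nat set. (Min e, Max e)"
  let ?J = "?g ` F"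
  define h where "h ij = \<delta> {fst ij, snd ij}" for ij :: "nat \<times> nat"
  have mm: "Min e \<in> {1..n}" "Max e \<in> {1..n}" "e = {Min e, Max e}" "Min e \<le> Max e" if "e \<in> F" for e
  proof -
    have "e \<in> edges_in {1..n}" using that F(1) by blast
    from edges_in_Min_Max[OF this] show "Min e \<in> {1..n}" "Max e \<in> {1..n}" "e = {Min e, Max e}"
      "Min e \<le> Max e" .
  qed
  have inj: "inj_on ?g F"
  proof (rule inj_onI)
    fix e f assume e: "e \<in> F" and f: "f \<in> F" and "?g e = ?g f"
    hence "{Min e, Max e} = {Min f, Max f}" by simp
    thus "e = f" by (simp only: mm(3)[OF e, symmetric] mm(3)[OF f, symmetric])
  qed
  have J: "?J \<subseteq> {(i, j). 1 \<le> i \<and> i \<le> j \<and> j \<le> n}"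
  proof
    fix ij assume "ij \<in> ?J"
    then obtain e where "e \<in> F" "ij = ?g e" by blast
    thus "ij \<in> {(i, j). 1 \<le> i \<and> i \<le> j \<and> j \<le> n}" using mm(1,2,4)[of e] by simp
  qed
  have hg: "h (?g e) = \<delta> e" if "e \<in> F" for e by (simp add: h_def mm(3)[OF that, symmetric])
  have "indep_vars (\<lambda>_. borel) (\<lambda>(i, j). a n i j) ?J"
    using w n J by (intro indep_vars_subset[OF _ J]) (auto simp: wigner_scheme_def)
  hence "indep_vars (\<lambda>_. borel) (\<lambda>ij \<omega>. (case ij of (i, j) \<Rightarrow> a n i j) \<omega> ^ h ij) ?J"
    by (rule indep_vars_compose2[where Y = "\<lambda>ij x. x ^ h ij"]) simp
  moreover have "integrable M (\<lambda>\<omega>. (case ij of (i, j) \<Rightarrow> a n i j) \<omega> ^ h ij)" if "ij \<in> ?J" for ij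
  proof -
    obtain e where "e \<in> F" "ij = ?g e" using \<open>ij \<in> ?J\<close> by blast
    thus ?thesis using mom n mm(1,2)[of e] by (simp add: all_moments_exist_def)
  qed
  ultimately have "expectation (\<lambda>\<omega>. \<Prod>ij\<in>?J. (case ij of (i, j) \<Rightarrow> a n i j) \<omega> ^ h ij)
      = (\<Prod>ij\<in>?J. expectation (\<lambda>\<omega>. (case ij of (i, j) \<Rightarrow> a n i j) \<omega> ^ h ij))"
    using F(2) by (intro indep_vars_lebesgue_integral) auto
  thus ?thesis by (simp add: prod.reindex[OF inj] edge_entry_def hg cong: prod.cong)
qed

text \<open>With a single edge, a centred factor makes the mean vanish and any decay in
  \<open>n\<close> is free. Without one no decay is claimed, and factorwise moment bounds suffice.
  Squares have mean exactly 1, hence the zero constants.\<close>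

lemma wigner_bounds:
  assumes w: "wigner_scheme M a"
  obtains C where "\<And>m. C m \<ge> 0"
    "\<And>n es. n \<ge> 1 \<Longrightarrow> set es \<subseteq> edges_in {1..n} \<Longrightarrow>
      expectation (edge_prod (edge_entry a n) es)
        = (\<Prod>e\<in>set es. expectation (\<lambda>\<omega>. edge_entry a n e \<omega> ^ count_list es e))"
    "\<And>n e. n \<ge> 1 \<Longrightarrow> e \<in> edges_in {1..n} \<Longrightarrow> expectation (edge_entry a n e) = 0"
    "correlation_bound C"
    "square_bound (\<lambda>_ _. 0)"
proof -
  define P where "P p C' \<longleftrightarrow> C' > 0 \<and> (\<forall>n\<ge>1. \<forall>i\<in>{1..n}. \<forall>j\<in>{1..n}.
      integrable M (\<lambda>\<omega>. \<bar>a n i j \<omega>\<bar> ^ p) \<and> expectation (\<lambda>\<omega>. \<bar>a n i j \<omega>\<bar> ^ p) \<le> C')" for p :: nat and C' :: real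
  have "\<exists>C'. P p C'" if "p \<ge> 1" for p
    using w that by (simp only: wigner_scheme_def P_def)
  then obtain C' where P: "\<And>p. p \<ge> 1 \<Longrightarrow> P p (C' p)" by metis
  have C': "C' p > 0" if "p \<ge> 1" for p using P[OF that] by (simp only: P_def)
  have C'2: "expectation (\<lambda>\<omega>. \<bar>a n i j \<omega>\<bar> ^ p) \<le> C' p"
    if "p \<ge> 1" "n \<ge> 1" "i \<in> {1..n}" "j \<in> {1..n}" for p n i j
    using P[OF that(1)] that(2-4) unfolding P_def by blast
  \<comment> \<open>\<open>Q m\<close> dominates the moment constants of all orders up to
    \<open>m\<close>; the summand 1 makes its powers increasing, so a product over at most
    \<open>m\<close> distinct edges is below \<open>Q m ^ m\<close>.\<close>
  define Q where "Q m = 1 + (\<Sum>p=1..m. C' p)" for m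
  have Q1: "Q m \<ge> 1" for m
  proof -
    have "0 \<le> (\<Sum>p=1..m. C' p)"
    proof (rule sum_nonneg)
      fix p assume "p \<in> {1..m}"
      thus "0 \<le> C' p" using C'[of p] by simp
    qed
    thus ?thesis by (simp add: Q_def)
  qed
  have C'Q: "C' p \<le> Q m" if "p \<in> {1..m}" for p m
  proof -
    have "C' p \<le> (\<Sum>p=1..m. C' p)"
    proof (rule member_le_sum)
      fix x assume "x \<in> {1..m} - {p}"
      thus "0 \<le> C' x" using C'[of x] by simp
    qed (use that in auto)
    thus ?thesis by (simp add: Q_def)
  qed
  have indep: "expectation (edge_prod (edge_entry a n) es)
        = (\<Prod>e\<in>set es. expectation (\<lambda>\<omega>. edge_entry a n e \<omega> ^ count_list es e))"
    if "n \<ge> 1" "set es \<subseteq> edges_in {1..n}" for n es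
    unfolding edge_prod_eq_prod using wigner_expectation_prod[OF w that, of "count_list es"] by simp
  have cent: "expectation (edge_entry a n e) = 0" and var: "expectation (\<lambda>\<omega>. (edge_entry a n e \<omega>)\<^sup>2) = 1"
    if "n \<ge> 1" "e \<in> edges_in {1..n}" for n e
  proof -
    have mm: "Min e \<in> {1..n}" "Max e \<in> {1..n}" using edges_in_Min_Max[OF that(2)] by auto
    have E: "expectation (a n (Min e) (Max e)) = 0" "variance (a n (Min e) (Max e)) = 1"
      using w that(1) mm unfolding wigner_scheme_def by blast+
    show "expectation (edge_entry a n e) = 0" using E(1) by (simp add: edge_entry_def[abs_def])
    show "expectation (\<lambda>\<omega>. (edge_entry a n e \<omega>)\<^sup>2) = 1" using E by (simp add: edge_entry_def)
  qed
  have bound: "\<bar>expectation (edge_prod (edge_entry a n) es)\<bar>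
        \<le> Q (length es) ^ length es * real n powr (- real (card (single_edges es)) / 2)"
    if n: "n \<ge> 1" and es: "set es \<subseteq> edges_in {1..n}" for n es
  proof (cases "single_edges es = {}")
    case True
    have "\<bar>expectation (\<lambda>\<omega>. edge_entry a n e \<omega> ^ count_list es e)\<bar> \<le> Q (length es)" if e: "e \<in> set es" for e
    proof -
      have "e \<in> edges_in {1..n}" using es e by blast
      note mm = edges_in_Min_Max[OF this]
      have "count_list es e \<noteq> 0" using e by (simp add: count_list_0_iff)
      hence c: "count_list es e \<in> {1..length es}" using count_le_length[of es e] by simp
      have "\<bar>expectation (\<lambda>\<omega>. edge_entry a n e \<omega> ^ count_list es e)\<bar>
          \<le> expectation (\<lambda>\<omega>. \<bar>a n (Min e) (Max e) \<omega>\<bar> ^ count_list es e)"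
        using abs_expectation_le[of "\<lambda>\<omega>. edge_entry a n e \<omega> ^ count_list es e"]
        by (simp add: power_abs edge_entry_def)
      also have "\<dots> \<le> C' (count_list es e)" using c n mm by (intro C'2) auto
      also have "\<dots> \<le> Q (length es)" using c by (rule C'Q)
      finally show ?thesis .
    qed
    hence "\<bar>expectation (edge_prod (edge_entry a n) es)\<bar> \<le> (\<Prod>e\<in>set es. Q (length es))"
      unfolding indep[OF n es] abs_prod by (intro prod_mono) auto
    also have "\<dots> = Q (length es) ^ card (set es)" by simp
    also have "\<dots> \<le> Q (length es) ^ length es" by (intro power_increasing card_length Q1)
    finally show ?thesis using True n by simp
  next
    case False
    then obtain e where "e \<in> set es" "count_list es e = 1" by (auto simp: single_edges_def)
    hence "expectation (edge_prod (edge_entry a n) es) = 0"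
      unfolding indep[OF n es] using cent[OF n, of e] es by (intro prod_zero bexI[of _ e]) auto
    thus ?thesis using Q1[of "length es"] by simp
  qed
  have square: "\<bar>expectation (\<lambda>\<omega>. \<Prod>e\<in>F. (edge_entry a n e \<omega>)\<^sup>2) - 1\<bar> \<le> 0"
    if "n \<ge> 1" "F \<subseteq> edges_in {1..n}" "F \<noteq> {}" for n F
  proof -
    have "edges_in {1..n} \<subseteq> Pow {1..n}" by (auto simp: edges_in_def)
    hence "finite F" using that(2) finite_subset[of F "Pow {1..n}"] by blast
    hence "expectation (\<lambda>\<omega>. \<Prod>e\<in>F. (edge_entry a n e \<omega>)\<^sup>2)
        = (\<Prod>e\<in>F. expectation (\<lambda>\<omega>. (edge_entry a n e \<omega>)\<^sup>2))"
      using wigner_expectation_prod[OF w that(1,2), of "\<lambda>_. 2"] by simp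
    also have "\<dots> = 1" using var[OF that(1)] that(2) by (intro prod.neutral) blast
    finally show ?thesis by simp
  qed
  show thesis
  proof (rule that[of "\<lambda>m. Q m ^ m"])
    show "0 \<le> Q m ^ m" for m using Q1[of m] by simp
      show "correlation_bound (\<lambda>m. Q m ^ m)" using bound by (simp only: correlation_bound_def) blast
    show "square_bound (\<lambda>_ _. 0)" using square by (simp only: square_bound_def) blast
  qed ((rule indep cent; assumption)+)
qed

text \<open>Two scales: the fluctuation around the mean is summable by the variance bound, while the
  mean itself converges because its distance from \<open>tree_density\<close> is of order
  \<open>1 / b n\<close>.\<close>

lemma almost_sure_of_wigner:
  assumes w: "wigner_scheme M a" and sum: "summable (\<lambda>n. 1 / (real n * real (b n)))"
  shows "semicircle_law_almost_surely M (band_matrix a b)"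
proof (rule semicircle_law_almost_surelyI)
  fix k :: nat assume k: "k \<ge> 1"
  obtain C where C: "\<And>m. C m \<ge> 0"
    and indep: "\<And>n es. n \<ge> 1 \<Longrightarrow> set es \<subseteq> edges_in {1..n} \<Longrightarrow>
      expectation (edge_prod (edge_entry a n) es)
        = (\<Prod>e\<in>set es. expectation (\<lambda>\<omega>. edge_entry a n e \<omega> ^ count_list es e))"
    and cent: "\<And>n e. n \<ge> 1 \<Longrightarrow> e \<in> edges_in {1..n} \<Longrightarrow> expectation (edge_entry a n e) = 0"
    and bound: "correlation_bound C"
    and square: "square_bound (\<lambda>_ _. 0)"
    using wigner_bounds[OF w] by blast
  obtain R where R: "\<And>n. n \<ge> 1 \<Longrightarrow> integrable M (\<lambda>\<omega>. (walk_moment n k \<omega> - tree_density n k)\<^sup>2)"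
    "\<And>n. n \<ge> 1 \<Longrightarrow> expectation (\<lambda>\<omega>. (walk_moment n k \<omega> - tree_density n k)\<^sup>2)
      \<le> R * (1 / (real (b n))\<^sup>2 + 0 + 0)"
    using sequence_bounds[where C = C and CC = "\<lambda>_ _. 0", OF bound square C order_refl k] by blast
  define D where "D = (C (2 * k) + (C k)\<^sup>2) * ((real k + 1) * (real (2 * Suc k) * (real (2 * Suc k) + 1) ^ k))
          * (real (2 * Suc k) + 1) ^ Suc k"
  define c where "c n = expectation (walk_moment n k)" for n
  have V: "integrable M (\<lambda>\<omega>. (walk_moment n k \<omega> - c n)\<^sup>2) \<and>
      expectation (\<lambda>\<omega>. (walk_moment n k \<omega> - c n)\<^sup>2) \<le> D * (1 / (real n * real (b n)))" if n: "n \<ge> 1" for n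
  proof -
    interpret E: edge_variables M "{1..n}" "band_neighbours n (b n)" "b n" "edge_entry a n"
      by (rule edge_vars[OF n])
    note b' = correlation_bound_weak[OF bound C n]
    note T = E.variance_moment_le[where C = C, OF indep[OF n] cent[OF n] b' C k]
    show ?thesis unfolding c_def using T by (simp add: D_def)
  qed
  have c: "c \<longlonglongrightarrow> real (ballot k 0)"
  proof -
    have le: "(c n - tree_density n k)\<^sup>2 \<le> R * (1 / (real (b n))\<^sup>2)" if n: "n \<ge> 1" for n
    proof -
      have int: "integrable M (walk_moment n k)" by (rule edge_variables.integrable_moment[OF edge_vars[OF n]])
      let ?U = "\<lambda>\<omega>. walk_moment n k \<omega> - tree_density n k"
      have "integrable M ?U" using int by simp
      \<comment> \<open>Nonnegativity of the variance of \<open>?U\<close> bounds the squared bias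
        by the second moment from \<open>sequence_bounds\<close>.\<close>
      from variance_positive[of ?U, unfolded variance_eq[OF this R(1)[OF n]]]
      have "0 \<le> expectation (\<lambda>\<omega>. (?U \<omega>)\<^sup>2) - (expectation ?U)\<^sup>2" .
      moreover have "expectation ?U = c n - tree_density n k" using int by (simp add: c_def prob_space)
      ultimately show ?thesis using R(2)[OF n] by simp
    qed
    have "(\<lambda>n. (c n - tree_density n k)\<^sup>2) \<longlonglongrightarrow> 0"
    proof (rule tendsto_sandwich[OF _ _ tendsto_const])
      show "\<forall>\<^sub>F n in sequentially. (c n - tree_density n k)\<^sup>2 \<le> R * (1 / (real (b n))\<^sup>2)"
        using le unfolding eventually_sequentially by blast
      show "(\<lambda>n. R * (1 / (real (b n))\<^sup>2)) \<longlonglongrightarrow> 0"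
        using tendsto_mult[OF tendsto_const tendsto_inverse_bandwidth_power[of 2], of R] by simp
    qed simp
    hence "(\<lambda>n. sqrt ((c n - tree_density n k)\<^sup>2)) \<longlonglongrightarrow> sqrt 0" by (rule tendsto_real_sqrt)
    hence "(\<lambda>n. c n - tree_density n k) \<longlonglongrightarrow> 0" by (simp add: tendsto_rabs_zero_iff)
    from tendsto_add[OF this tree_density_tendsto[of k]] show ?thesis by simp
  qed
  show "AE \<omega> in M. (\<lambda>n. emp_moment n k \<omega>) \<longlonglongrightarrow> real (ballot k 0)"
    by (rule AE_emp_moment_tendstoI[where z = 1 and c = c and e = "\<lambda>n. D * (1 / (real n * real (b n)))"])
      (use V c summable_mult[OF sum, of D] in auto)
qed

text \<open>For signs the tree part of the moment is deterministic.\<close>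
lemma almost_sure_of_signs:
  assumes bound: "correlation_bound C"
    and C: "\<And>m. C m \<ge> 0" and sum: "summable (\<lambda>n. 1 / real (b n) ^ 3)"
    and signs: "\<forall>n\<ge>1. \<forall>p\<in>{1..n}. \<forall>q\<in>{1..n}. \<forall>\<omega>\<in>space M. a n p q \<omega> \<in> {-1, 1}"
  shows "semicircle_law_almost_surely M (band_matrix a b)"
proof (rule semicircle_law_almost_surelyI)
  fix k :: nat assume k: "k \<ge> 1"
  \<comment> \<open>The order \<open>z = 4\<close> is even, so the moment controls absolute
    deviations, and its rate \<open>1 / b ^ 4\<close> is dominated by the summable
    \<open>1 / b ^ 3\<close>.\<close>
  define D where "D = C (4 * k) * (real (4 * Suc k) + 1) ^ (Suc k * 4)"
  have V: "integrable M (\<lambda>\<omega>. (walk_moment n k \<omega> - tree_density n k) ^ (2 * 2)) \<and>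
      expectation (\<lambda>\<omega>. (walk_moment n k \<omega> - tree_density n k) ^ (2 * 2)) \<le> D * (1 / real (b n) ^ 4)"
    if n: "n \<ge> 1" for n
  proof -
    interpret E: edge_variables M "{1..n}" "band_neighbours n (b n)" "b n" "edge_entry a n"
      by (rule edge_vars[OF n])
    have "tree_moment n k \<omega> = tree_density n k" if \<omega>: "\<omega> \<in> space M" for \<omega>
    proof -
      have "edge_prod (edge_entry a n) (edges xs) \<omega> = 1" if xs: "xs \<in> E.tree_walks k" for xs
      proof -
        have "(edge_entry a n e \<omega>)\<^sup>2 = 1" if "e \<in> set (edges xs)" for e
        proof -
          have "e \<in> edges_in {1..n}" using E.closed_walkD(4)[of xs k] E.tree_walks_subset xs that by blast
          hence "edge_entry a n e \<omega> \<in> {-1, 1}"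
            using edges_in_Min_Max[of e "{1..n}"] signs n \<omega> unfolding edge_entry_def by blast
          thus ?thesis by auto
        qed
        thus ?thesis using E.tree_walk_edge_prod(1)[OF xs] by simp
      qed
      thus ?thesis unfolding E.tree_moment_def E.tree_density_def by simp
    qed
    hence eq: "(walk_moment n k \<omega> - tree_density n k) ^ (2 * 2) = rest_moment n k \<omega> ^ 4" if "\<omega> \<in> space M" for \<omega>
      using that E.moment_split[of k \<omega>] by simp
    have "integrable M (\<lambda>\<omega>. (walk_moment n k \<omega> - tree_density n k) ^ (2 * 2))"
      by (subst Bochner_Integration.integrable_cong[OF refl eq]) (assumption, rule E.integrable_rest_moment_power)
    moreover have "expectation (\<lambda>\<omega>. (walk_moment n k \<omega> - tree_density n k) ^ (2 * 2))
        = expectation (\<lambda>\<omega>. rest_moment n k \<omega> ^ 4)"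
      by (rule Bochner_Integration.integral_cong[OF refl eq])
    moreover have "expectation (\<lambda>\<omega>. rest_moment n k \<omega> ^ 4) \<le> D * (1 / real (b n) ^ 4)"
      using E.expectation_rest_moment_power_le[where C = C and z = 4 and k = k] correlation_boundD[OF bound n] C k
      by (simp add: D_def)
    ultimately show ?thesis by simp
  qed
  have "summable (\<lambda>n. 1 / real (b n) ^ 4)"
  proof (rule summable_comparison_test'[OF sum])
    fix n assume "n \<ge> (0::nat)"
    show "norm (1 / real (b n) ^ 4) \<le> 1 / real (b n) ^ 3"
    proof (cases "b n = 0")
      case False
      hence "real (b n) ^ 3 \<le> real (b n) ^ 4" by (intro power_increasing) auto
      thus ?thesis using False by (simp add: field_simps)
    qed simp
  qed
  thus "AE \<omega> in M. (\<lambda>n. emp_moment n k \<omega>) \<longlonglongrightarrow> real (ballot k 0)"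
    by (intro AE_emp_moment_tendstoI[where z = 2 and c = "\<lambda>n. tree_density n k" and e = "\<lambda>n. D * (1 / real (b n) ^ 4)"]
        conjunct1[OF V] conjunct2[OF V] summable_mult tree_density_tendsto) auto
qed

lemma almost_sure_of_summable_bounds:
  assumes bound: "correlation_bound C"
    and square: "square_bound CC"
    and C: "\<And>m. C m \<ge> 0" and CC: "\<And>m n. CC m n \<ge> 0"
    and sum: "summable (\<lambda>n. 1 / (real (b n))\<^sup>2)" "\<And>m. summable (CC m)"
  shows "semicircle_law_almost_surely M (band_matrix a b)"
proof (rule semicircle_law_almost_surelyI)
  fix k :: nat assume k: "k \<ge> 1"
  obtain R where R: "\<And>n. n \<ge> 1 \<Longrightarrow> integrable M (\<lambda>\<omega>. (walk_moment n k \<omega> - tree_density n k)\<^sup>2)"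
    "\<And>n. n \<ge> 1 \<Longrightarrow> expectation (\<lambda>\<omega>. (walk_moment n k \<omega> - tree_density n k)\<^sup>2)
      \<le> R * (1 / (real (b n))\<^sup>2 + CC k n + CC (k div 2) n)"
    using sequence_bounds[OF bound square C CC k] by blast
  have "summable (\<lambda>n. R * (1 / (real (b n))\<^sup>2 + CC k n + CC (k div 2) n))"
    using sum by (intro summable_mult summable_add)
  thus "AE \<omega> in M. (\<lambda>n. emp_moment n k \<omega>) \<longlonglongrightarrow> real (ballot k 0)"
    using R tree_density_tendsto by (intro AE_emp_moment_tendstoI[where z = 1 and c = "\<lambda>n. tree_density n k"
      and e = "\<lambda>n. R * (1 / (real (b n))\<^sup>2 + CC k n + CC (k div 2) n)"]) auto
qed

end

theorem theorem2p5:
  fixes M :: "'w measure" and \<alpha> :: real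
    and a :: "nat \<Rightarrow> nat \<Rightarrow> nat \<Rightarrow> 'w \<Rightarrow> real" and b :: "nat \<Rightarrow> nat"
  assumes "prob_space M"
    and "\<alpha> > 0"
    and "almost_uncorrelated M \<alpha> a"
    and "\<And>n. n \<ge> 1 \<Longrightarrow> bandwidth n (b n)"
    and "filterlim b at_top sequentially"
  shows
    "(\<alpha> \<ge> 1 / 2 \<longrightarrow> semicircle_law_in_prob M (band_matrix a b)) \<and>
     (\<alpha> \<ge> 1 / 2 \<and> summable (\<lambda>n. 1 / real (b n) ^ 3) \<and>
        (\<forall>n\<ge>1. \<forall>p\<in>{1..n}. \<forall>q\<in>{1..n}. \<forall>\<omega>\<in>space M. a n p q \<omega> \<in> {-1, 1})
      \<longrightarrow> semicircle_law_almost_surely M (band_matrix a b)) \<and>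
     (\<forall>C CC D. strongly_almost_uncorrelated_with M \<alpha> a C CC D \<and> \<alpha> > 1 / 2 \<and>
        summable (\<lambda>n. 1 / real (b n) ^ 2) \<and>
        (\<forall>l\<ge>1. summable (\<lambda>n. 1 / real (b n) * D l n)) \<and>
        (\<forall>l\<ge>1. summable (\<lambda>n. CC l n))
      \<longrightarrow> semicircle_law_almost_surely M (band_matrix a b)) \<and>
     (wigner_scheme M a \<and> summable (\<lambda>n. 1 / (real n * real (b n)))
      \<longrightarrow> semicircle_law_almost_surely M (band_matrix a b))"
proof -
  obtain C CC where au: "almost_uncorrelated_with M \<alpha> a C CC"
    using assms(3) by (auto simp: almost_uncorrelated_def)
  interpret prob_space M by fact
  interpret band_scheme M a b
    by unfold_locales (use au assms(4,5) in \<open>auto simp: almost_uncorrelated_with_def\<close>)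
  \<comment> \<open>The definition leaves the constants with superscript 0 unconstrained, so they are replaced by 0.\<close>
  define pos where "pos CC m n = (if m = 0 then 0 else \<bar>CC m n\<bar>)" for CC :: "nat \<Rightarrow> nat \<Rightarrow> real" and m n :: nat
  have square: "square_bound (pos CC)" if "AAU2 M a CC" for CC
    unfolding square_bound_def
  proof (intro allI impI)
    fix n :: nat and F assume "1 \<le> n" "F \<subseteq> edges_in {1..n}" "F \<noteq> {}"
    from AAU2_bound[OF that this]
    show "\<bar>expectation (\<lambda>\<omega>. \<Prod>e\<in>F. (edge_entry a n e \<omega>)\<^sup>2) - 1\<bar> \<le> pos CC (card F) n"
      by (simp add: pos_def)
  qed
  show ?thesis
  proof (intro conjI impI allI)
    assume "\<alpha> \<ge> 1 / 2"
    show "semicircle_law_in_prob M (band_matrix a b)"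
    proof (rule semicircle_law_in_prob_of_bounds[where C = "\<lambda>m. \<bar>C m\<bar>" and CC = "pos CC"])
      show "pos CC m \<longlonglongrightarrow> 0" for m
      proof (cases "m = 0")
        case False
        hence "(\<lambda>n. \<bar>CC m n\<bar>) \<longlonglongrightarrow> 0"
          using au by (intro tendsto_rabs_zero) (simp add: almost_uncorrelated_with_def)
        thus ?thesis using False by (simp add: pos_def[abs_def])
      qed (simp add: pos_def[abs_def])
    qed (use au AAU1_correlation_bound[OF _ \<open>\<alpha> \<ge> 1 / 2\<close>] square in
        \<open>auto simp: almost_uncorrelated_with_def pos_def\<close>)
  next
    assume h: "\<alpha> \<ge> 1 / 2 \<and> summable (\<lambda>n. 1 / real (b n) ^ 3) \<and>
        (\<forall>n\<ge>1. \<forall>p\<in>{1..n}. \<forall>q\<in>{1..n}. \<forall>\<omega>\<in>space M. a n p q \<omega> \<in> {-1, 1})"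
    show "semicircle_law_almost_surely M (band_matrix a b)"
      by (rule almost_sure_of_signs[where C = "\<lambda>m. \<bar>C m\<bar>"])
        (use au h AAU1_correlation_bound in \<open>auto simp: almost_uncorrelated_with_def\<close>)
  next
    fix C CC D
    assume h: "strongly_almost_uncorrelated_with M \<alpha> a C CC D \<and> \<alpha> > 1 / 2 \<and>
        summable (\<lambda>n. 1 / real (b n) ^ 2) \<and>
        (\<forall>l\<ge>1. summable (\<lambda>n. 1 / real (b n) * D l n)) \<and>
        (\<forall>l\<ge>1. summable (\<lambda>n. CC l n))"
    hence aau: "AAU1 M \<alpha> a C" "AAU2 M a CC"
      by (auto simp: strongly_almost_uncorrelated_with_def almost_uncorrelated_with_def)
    show "semicircle_law_almost_surely M (band_matrix a b)"
    proof (rule almost_sure_of_summable_bounds[where C = "\<lambda>m. \<bar>C m\<bar>" and CC = "pos CC"])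
      show "summable (pos CC m)" for m
      proof (cases "m = 0")
        case False
        \<comment> \<open>The sign of \<open>CC m n\<close> is settled only for
          \<open>n \<ge> m\<close>, so the two sequences are compared from index \<open>m\<close>
          on.\<close>
        hence "\<forall>\<^sub>F n in sequentially. CC m n = pos CC m n"
          using AAU2_constant_nonneg[OF aau(2), of m] unfolding eventually_sequentially
          by (intro exI[of _ m]) (auto simp: pos_def)
        thus ?thesis using h False summable_cong[of "CC m" "pos CC m"] by simp
      qed (simp add: pos_def[abs_def])
      show "summable (\<lambda>n. 1 / (real (b n))\<^sup>2)" using h by blast
      show "correlation_bound (\<lambda>m. \<bar>C m\<bar>)" using h by (intro AAU1_correlation_bound[OF aau(1)]) auto
    qed (use square[OF aau(2)] in \<open>auto simp: pos_def\<close>)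
  next
    assume "wigner_scheme M a \<and> summable (\<lambda>n. 1 / (real n * real (b n)))"
    thus "semicircle_law_almost_surely M (band_matrix a b)" using almost_sure_of_wigner by blast
  qed
qed

end
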